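(* Take $\theta=\frac12$. Let $z,z'\in\mathbb{C}$ satisfy the admissibility conditions (for $\theta=\frac12$) given in the context, let $\xi\in(0,1)$ and $\eta>0$. (A) The point process $\underline{M}_{z,z',\xi,\theta=\frac12}$ on $\mathbb{Z}+\frac12$, i.e. the image of the mixed $z$-measure $M_{z,z',\xi,\theta=\frac12}$ under the embedding $\lambda\mapsto X'(\lambda)$, is the Pfaffian $L$-ensemble with $L=L_h$, where $$ h(x)=\begin{cases}\dfrac{[-2z+1]_{x-\frac12}\,[-2z'+1]_{x-\frac12}}{\Gamma(x+\frac12)}\,\xi^{x/2}, & x\in\mathbb{Z}_{\ge 0}+\frac12,\\[2mm] \dfrac{[2z]_{-x-\frac12}\,[2z']_{-x-\frac12}}{\Gamma(-x+\frac12)}\,\xi^{-x/2}, & x\in\mathbb{Z}_{\le 0}-\frac12.\end{cases} $$ That is, $\mathrm{Prob}(X)=\mathrm{Pf}\,L(X|X)/\mathrm{Pf}(J+L)$ for every finite $X\subset\mathbb{Z}+\frac12$. Moreover, $$\mathrm{Pf}(J+L)=(1-\xi)^{-2zz'}.$$ (B) The point process $\underline{M}_{\mathrm{Pl},\eta,\theta=\frac12}$ on $\mathbb{Z}+\frac12$, i.e. the image of the poissonized Plancherel measure $M_{\mathrm{Pl},\eta,\theta=\frac12}$ under the same embedding $\lambda\mapsto X'(\lambda)$, is the Pfaffian $L$-ensemble with $L=L_h$, where $$h(x)=\frac{(2\eta)^{\frac12|x|}}{\Gamma(|x|+\frac12)},\qquad x\in\mathbb{Z}+\tfrac12 .$$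
   Context: **Young diagrams and measures.** $\mathbb{Y}$ is the set of all Young diagrams (integer partitions), including the empty one; $|\lambda|$ is the number of boxes, $\lambda'$ the transposed diagram. For $\theta>0$, $z\in\mathbb{C}$: $$(z)_{\lambda,\theta}=\prod_{(i,j)\in\lambda}\bigl(z+(j-1)-(i-1)\theta\bigr),$$ $$H(\lambda,\theta)=\prod_{(i,j)\in\lambda}\bigl((\lambda_i-j)+(\lambda'_j-i)\theta+1\bigr),\quad H'(\lambda,\theta)=\prod_{(i,j)\in\lambda}\bigl((\lambda_i-j)+(\lambda'_j-i)\theta+\theta\bigr),$$ where $(i,j)$ is the box in row $i$, column $j$. The mixed $z$-measure with Jack parameter $\theta$ is, with $t=zz'/\theta$ and $\xi\in(0,1)$, $$M_{z,z',\xi,\theta}(\lambda)=(1-\xi)^t\,\xi^{|\lambda|}\,\frac{(z)_{\lambda,\theta}(z')_{\lambda,\theta}}{H(\lambda,\theta)H'(\lambda,\theta)},\quad \lambda\in\mathbb{Y}.$$ The poissonized Plancherel measure is, with $\eta>0$, $$M_{\mathrm{Pl},\eta,\theta}(\lambda)=e^{-\eta}\eta^{|\lambda|}\frac{\theta^{|\lambda|}}{H(\lambda,\theta)H'(\lambda,\theta)},\quad\lambda\in\mathbb{Y}.$$ Both are probability measures on $\mathbb{Y}$ (for the $z$-measure, under the following conditions). **Admissibility of $(z,z')$ for $\theta$**: one of the following holds. Principal series: $z\in\mathbb{C}\setminus(\mathbb{Z}_{\le0}+\mathbb{Z}_{\ge0}\theta)$ and $z'=\bar z$. Complementary series: $\theta$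 is rational and $z,z'$ are real numbers both lying in one of the (open) intervals between two consecutive numbers of the lattice $\mathbb{Z}+\mathbb{Z}\theta$. Degenerate series: for some $m\in\{1,2,\dots\}$, either ($z=m\theta$, $z'>(m-1)\theta$) or ($z'=m\theta$, $z>(m-1)\theta$) or ($z=-m$, $z'<-m+1$) or ($z'=-m$, $z<-m+1$), with $z,z'$ real. **Symbol $[a]_n$.** For $a\in\mathbb{C}$: $[a]_0=1$; $[a]_n=(a+1)(a+3)\cdots(a+n-1)$ for even $n\geq 2$; $[a]_n=a(a+2)\cdots(a+n-1)$ for odd $n$. **Embedding $\lambda\mapsto X'(\lambda)$.** Let $\lambda'\sqcup\lambda'=(\lambda'_1,\lambda'_1,\lambda'_2,\lambda'_2,\dots)$ (each row of the transposed diagram $\lambda'$ repeated twice), and let $(P'_1,\dots,P'_D|Q'_1,\dots,Q'_D)$ be its usual Frobenius coordinates: $D$ is the number of diagonal boxes of $\lambda'\sqcup\lambda'$, $P'_i$ the number of boxes in row $i$ to the right of the diagonal, $Q'_i$ the number of boxes in column $i$ below the diagonal. (If $D$ is odd then $P'_D=0$.) Put $X'(\lambda)=X'_-\sqcup X'_+$, where $X'_-=\{-Q'_1-\frac12,\dots,-Q'_D-\frac12\}$, and $X'_+=\{P'_{D-1}+\frac12,P'_{D-3}+\frac12,\dots,P'_1+\frac12\}$ if $D$ is even, $X'_+=\{\frac12,P'_{D-2}+\frac12,P'_{D-4}+\frac12,\dots,P'_1+\frac12\}$ if $D$ is odd. This is an injective map from $\mathbb{Y}$ to the set of finite subsets of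 $\mathbb{Z}+\frac12$. For a probability measure $M$ on $\mathbb{Y}$, $\underline{M}$ denotes the point process (probability measure on finite subsets of $\mathbb{Z}+\frac12$) obtained as the image of $M$; finite subsets not in the image have probability $0$. **Pfaffian $L$-ensembles.** Let $\mathfrak{X}$ be a countable set; each $x\in\mathfrak{X}$ has two copies $x',x''$. Let $L$ be a skew-symmetric matrix with rows and columns indexed by the points $x',x''$, written in $2\times2$ blocks $$L(x,y)=\begin{bmatrix}L(x',y')&L(x',y'')\\L(x'',y')&L(x'',y'')\end{bmatrix},\quad x,y\in\mathfrak{X}.$$ For finite $X=\{x_1,\dots,x_m\}\subset\mathfrak{X}$, $L(X|X)$ is the $2m\times2m$ antisymmetric submatrix with index order $x_1',x_1'',\dots,x_m',x_m''$ (its Pfaffian does not depend on the order of the $x_i$; for $X=\emptyset$ the Pfaffian is $1$). $J$ is the block matrix with $J(x,x)=\begin{bmatrix}0&1\\-1&0\end{bmatrix}$ and $J(x,y)=0$ for $x\ne y$. Suppose $\mathrm{Pf}\,L(X|X)\ge0$ for all finite $X$ and $\sum_X\mathrm{Pf}\,L(X|X)<\infty$ (sum over all finite subsets). One defines $\mathrm{Pf}(J+L):=\sum_{X}\mathrm{Pf}\,L(X|X)$, and the Pfaffian $L$-ensemble is the point process on $\mathfrak{X}$ with $\mathrm{Prob}_L(X)=\mathrm{Pf}\,L(X|X)/\mathrm{Pf}(J+L)$ for all finite $X\subset\mathfrak{X}$. Saying that a process is the Pfaffian $L$-ensemble includes the assertion that these two conditions on $L$ hold. **The matrix $L_h$.**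 Let $\mathfrak{X}=\mathbb{Z}+\frac12$. Parity: on $\mathbb{Z}_{\ge0}+\frac12$ the point $\frac12$ is even, $\frac32$ odd, and so on alternately; on $\mathbb{Z}_{\le0}-\frac12$ the point $-\frac12$ is even, $-\frac32$ odd, and so on alternately. Let $\epsilon(x,y)=-\epsilon(y,x)$ with, for $x<y$, $\epsilon(x,y)=1$ if $x$ is odd and $y$ is even, and $\epsilon(x,y)=0$ otherwise. For a function $h$ on $\mathbb{Z}+\frac12$, according to the decomposition $\mathbb{Z}+\frac12=(\mathbb{Z}_{\le0}-\frac12)\sqcup\{\frac12\}\sqcup(\mathbb{Z}_{\ge0}+\frac32)$, $$L_h=\begin{bmatrix}\mathrm{E}&\mathrm{A}&\mathrm{B}\\-\mathrm{A}^T&0&0\\-\mathrm{B}^T&0&0\end{bmatrix},$$ with $2\times2$ block entries $$\mathrm{E}(x,y)=\begin{bmatrix}\epsilon(x,y)&0\\0&0\end{bmatrix},\ x,y\in\mathbb{Z}_{\le0}-\tfrac12;\qquad \mathrm{A}(x,y)=\begin{bmatrix}\epsilon(x,y)&0\\0&\frac{h(x)h(y)}{x-y}\end{bmatrix},\ x\in\mathbb{Z}_{\le0}-\tfrac12,\ y=\tfrac12;$$ $$\mathrm{B}(x,y)=\begin{bmatrix}0&0\\\frac{h(x)h(y)}{x-y}&\frac{h(x)h(y-1)}{x-y+1}\end{bmatrix},\ x\in\mathbb{Z}_{\le0}-\tfrac12,\ y\in\mathbb{Z}_{\ge0}+\tfrac32.$$ *)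

theory Defs
  imports "HOL-Probability.Probability" "HOL-Combinatorics.Permutations"
begin

section \<open>Young diagrams\<close>

text \<open>A Young diagram is given by its weakly decreasing sequence of row lengths. Rows and columns
  are numbered from 0, so the pair \<open>(i, j)\<close> below is the box usually written \<open>(i + 1, j + 1)\<close>.\<close>

typedef young = "{p :: nat \<Rightarrow> nat. antimono p \<and> finite {i. p i \<noteq> 0}}"
  morphisms row_len Abs_young
  by (rule exI[of _ "\<lambda>_. 0"]) (auto simp: antimono_def)

setup_lifting type_definition_young

definition boxes :: "young \<Rightarrow> (nat \<times> nat) set" where
  "boxes \<mu> = {(i, j). j < row_len \<mu> i}"

definition num_boxes :: "young \<Rightarrow> nat" where
  "num_boxes \<mu> = card (boxes \<mu>)"

lift_definition transpose_young :: "young \<Rightarrow> young" is "\<lambda>p j. card {i. j < p i}"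
proof -
  fix p :: "nat \<Rightarrow> nat"
  assume p: "antimono p \<and> finite {i. p i \<noteq> 0}"
  have fin: "finite {i. j < p i}" for j
    using p by (auto intro: finite_subset[of _ "{i. p i \<noteq> 0}"])
  have "antimono (\<lambda>j. card {i. j < p i})"
    by (intro antimonoI card_mono fin) auto
  moreover have "{j. card {i. j < p i} \<noteq> 0} \<subseteq> {..<p 0}"
  proof
    fix j assume "j \<in> {j. card {i. j < p i} \<noteq> 0}"
    then obtain i where "j < p i"
      by (metis (mono_tags, lifting) Collect_empty_eq card.empty mem_Collect_eq)
    also have "p i \<le> p 0"
      using p by (auto dest: antimonoD)
    finally show "j \<in> {..<p 0}" by simp
  qed
  ultimately show "antimono (\<lambda>j. card {i. j < p i}) \<and> finite {j. card {i. j < p i} \<noteq> 0}"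
    using finite_subset by blast
qed

text \<open>\<open>double_rows \<mu>\<close> is \<open>\<mu> \<squnion> \<mu> = (\<mu>\<^sub>1, \<mu>\<^sub>1, \<mu>\<^sub>2, \<mu>\<^sub>2, \<dots>)\<close>.\<close>

lift_definition double_rows :: "young \<Rightarrow> young" is "\<lambda>p i. p (i div 2)"
proof -
  fix p :: "nat \<Rightarrow> nat"
  assume p: "antimono p \<and> finite {i. p i \<noteq> 0}"
  have "antimono (\<lambda>i. p (i div 2))"
    using p by (intro antimonoI) (auto dest: antimonoD intro: div_le_mono)
  moreover have "{i. p (i div 2) \<noteq> 0} \<subseteq> (\<Union>k \<in> {k. p k \<noteq> 0}. {2 * k, 2 * k + 1})"
    by auto
  then have "finite {i. p (i div 2) \<noteq> 0}"
    using p finite_subset by fastforce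
  ultimately show "antimono (\<lambda>i. p (i div 2)) \<and> finite {i. p (i div 2) \<noteq> 0}"
    by blast
qed

definition diag_len :: "young \<Rightarrow> nat" where
  "diag_len \<mu> = card {i. (i, i) \<in> boxes \<mu>}"

text \<open>Frobenius coordinates, meaningful for \<open>i < diag_len \<mu>\<close>; with the numbering from 0,
  \<open>frob_P \<mu> i\<close> is the coordinate usually written \<open>P\<^sub>i\<^sub>+\<^sub>1\<close>.\<close>

definition frob_P :: "young \<Rightarrow> nat \<Rightarrow> nat" where
  "frob_P \<mu> i = row_len \<mu> i - i - 1"

definition frob_Q :: "young \<Rightarrow> nat \<Rightarrow> nat" where
  "frob_Q \<mu> i = row_len (transpose_young \<mu>) i - i - 1"


section \<open>Measures on Young diagrams with Jack parameter\<close>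

definition poch_young :: "complex \<Rightarrow> real \<Rightarrow> young \<Rightarrow> complex" where
  "poch_young z \<theta> \<mu> = (\<Prod>(i, j)\<in>boxes \<mu>. z + of_nat j - of_nat i * of_real \<theta>)"

text \<open>For a box \<open>(i, j)\<close> of \<open>\<mu>\<close>, with the numbering from 0, the arm and leg lengths are
  \<open>row_len \<mu> i - (j + 1)\<close> and \<open>row_len (transpose_young \<mu>) j - (i + 1)\<close>.\<close>

definition H_hook :: "young \<Rightarrow> real \<Rightarrow> real" where
  "H_hook \<mu> \<theta> = (\<Prod>(i, j)\<in>boxes \<mu>.
     (real (row_len \<mu> i) - real (j + 1))
       + (real (row_len (transpose_young \<mu>) j) - real (i + 1)) * \<theta> + 1)"

definition H'_hook :: "young \<Rightarrow> real \<Rightarrow> real" where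
  "H'_hook \<mu> \<theta> = (\<Prod>(i, j)\<in>boxes \<mu>.
     (real (row_len \<mu> i) - real (j + 1))
       + (real (row_len (transpose_young \<mu>) j) - real (i + 1)) * \<theta> + \<theta>)"

definition principal_series :: "complex \<Rightarrow> complex \<Rightarrow> real \<Rightarrow> bool" where
  "principal_series z z' \<theta> \<longleftrightarrow>
     (\<nexists>k l :: nat. z = - of_nat k + of_nat l * of_real \<theta>) \<and> z' = cnj z"

definition lattice :: "real \<Rightarrow> real set" where
  "lattice \<theta> = {of_int k + of_int l * \<theta> | k l :: int. True}"

definition complementary_series :: "complex \<Rightarrow> complex \<Rightarrow> real \<Rightarrow> bool" where
  "complementary_series z z' \<theta> \<longleftrightarrow>
     \<theta> \<in> \<rat> \<and> z \<in> \<real> \<and> z' \<in> \<real> \<and>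
     (\<exists>a b. a \<in> lattice \<theta> \<and> b \<in> lattice \<theta> \<and> a < b \<and> {a<..<b} \<inter> lattice \<theta> = {} \<and>
            Re z \<in> {a<..<b} \<and> Re z' \<in> {a<..<b})"

definition degenerate_series :: "complex \<Rightarrow> complex \<Rightarrow> real \<Rightarrow> bool" where
  "degenerate_series z z' \<theta> \<longleftrightarrow>
     z \<in> \<real> \<and> z' \<in> \<real> \<and>
     (\<exists>m::nat. m \<ge> 1 \<and>
        (Re z = real m * \<theta> \<and> Re z' > (real m - 1) * \<theta> \<or>
         Re z' = real m * \<theta> \<and> Re z > (real m - 1) * \<theta> \<or>
         Re z = - real m \<and> Re z' < - real m + 1 \<or>
         Re z' = - real m \<and> Re z < - real m + 1))"

definition admissible :: "complex \<Rightarrow> complex \<Rightarrow> real \<Rightarrow> bool" where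
  "admissible z z' \<theta> \<longleftrightarrow>
     principal_series z z' \<theta> \<or> complementary_series z z' \<theta> \<or> degenerate_series z z' \<theta>"

text \<open>The measures are described by their point masses, which determine them uniquely
  (see the two lemmas below). The masses of the mixed z-measure are given by a complex expression;
  that this expression is real, nonnegative and sums to 1 is part of the assertion that
  a probability mass function satisfies \<open>is_mixed_z_measure\<close>.\<close>

definition is_mixed_z_measure ::
  "complex \<Rightarrow> complex \<Rightarrow> real \<Rightarrow> real \<Rightarrow> young pmf \<Rightarrow> bool" where
  "is_mixed_z_measure z z' \<xi> \<theta> M \<longleftrightarrow>
     (\<forall>\<mu>. complex_of_real (pmf M \<mu>) =
        (1 - of_real \<xi>) powr (z * z' / of_real \<theta>) * of_real \<xi> ^ num_boxes \<mu>
        * (poch_young z \<theta> \<mu> * poch_young z' \<theta> \<mu> / of_real (H_hook \<mu> \<theta> * H'_hook \<mu> \<theta>)))"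

definition is_poissonized_Plancherel :: "real \<Rightarrow> real \<Rightarrow> young pmf \<Rightarrow> bool" where
  "is_poissonized_Plancherel \<eta> \<theta> M \<longleftrightarrow>
     (\<forall>\<mu>. pmf M \<mu> =
        exp (- \<eta>) * \<eta> ^ num_boxes \<mu> * (\<theta> ^ num_boxes \<mu> / (H_hook \<mu> \<theta> * H'_hook \<mu> \<theta>)))"

lemma is_mixed_z_measure_unique:
  "is_mixed_z_measure z z' \<xi> \<theta> M \<Longrightarrow> is_mixed_z_measure z z' \<xi> \<theta> N \<Longrightarrow> M = N"
  unfolding is_mixed_z_measure_def by (intro pmf_eqI) (metis of_real_eq_iff)

lemma is_poissonized_Plancherel_unique:
  "is_poissonized_Plancherel \<eta> \<theta> M \<Longrightarrow> is_poissonized_Plancherel \<eta> \<theta> N \<Longrightarrow> M = N"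
  unfolding is_poissonized_Plancherel_def by (intro pmf_eqI) metis


section \<open>The embedding into finite subsets of the half-integers\<close>

definition half_ints :: "real set" where
  "half_ints = {of_int k + 1/2 | k :: int. True}"

text \<open>With the numbering of Frobenius coordinates from 0, the coordinates
  \<open>P'\<^sub>1, P'\<^sub>3, \<dots>\<close> with index less than \<open>D\<close> are those with even \<open>i\<close> and \<open>i + 1 < D\<close>.\<close>

definition X_minus :: "young \<Rightarrow> real set" where
  "X_minus \<mu> = (let \<nu> = double_rows (transpose_young \<mu>); D = diag_len \<nu> in
     {- real (frob_Q \<nu> i) - 1/2 | i. i < D})"

definition X_plus :: "young \<Rightarrow> real set" where
  "X_plus \<mu> = (let \<nu> = double_rows (transpose_young \<mu>); D = diag_len \<nu> in
     (if odd D then {1/2} else {}) \<union> {real (frob_P \<nu> i) + 1/2 | i. even i \<and> i + 1 < D})"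

definition X_embed :: "young \<Rightarrow> real set" where
  "X_embed \<mu> = X_minus \<mu> \<union> X_plus \<mu>"


section \<open>Pfaffian L-ensembles\<close>

text \<open>The Pfaffian of the \<open>2m \<times> 2m\<close> antisymmetric matrix \<open>(A a b)\<close>, \<open>a, b < 2m\<close>.\<close>

definition pfaffian :: "nat \<Rightarrow> (nat \<Rightarrow> nat \<Rightarrow> complex) \<Rightarrow> complex" where
  "pfaffian m A =
     (\<Sum>\<sigma> | \<sigma> permutes {..<2 * m}. of_int (sign \<sigma>) * (\<Prod>i<m. A (\<sigma> (2 * i)) (\<sigma> (2 * i + 1))))
     / (2 ^ m * fact m)"

text \<open>A matrix with rows and columns indexed by the copies \<open>x', x''\<close> of points is represented by
  its \<open>2 \<times> 2\<close> blocks: index 1 of the block stands for \<open>x'\<close> and index 2 for \<open>x''\<close>.\<close>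

type_synonym 'a block_matrix = "'a \<Rightarrow> 'a \<Rightarrow> complex ^ 2 ^ 2"

definition block :: "complex \<Rightarrow> complex \<Rightarrow> complex \<Rightarrow> complex \<Rightarrow> complex ^ 2 ^ 2" where
  "block a b c d = vector [vector [a, b], vector [c, d]]"

definition skew_on :: "'a set \<Rightarrow> 'a block_matrix \<Rightarrow> bool" where
  "skew_on S L \<longleftrightarrow> (\<forall>x\<in>S. \<forall>y\<in>S. L x y = - transpose (L y x))"

text \<open>\<open>Pf_minor L X\<close> is \<open>Pf L(X|X)\<close> with index order \<open>x\<^sub>1', x\<^sub>1'', \<dots>, x\<^sub>m', x\<^sub>m''\<close>; the points are
  listed increasingly, although for skew-symmetric \<open>L\<close> the value does not depend on their order.\<close>

definition Pf_minor :: "('a::linorder) block_matrix \<Rightarrow> 'a set \<Rightarrow> complex" where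
  "Pf_minor L X = (let xs = sorted_list_of_set X in
     pfaffian (card X) (\<lambda>a b. L (xs ! (a div 2)) (xs ! (b div 2))
                               $ (if even a then 1 else 2) $ (if even b then 1 else 2)))"

text \<open>\<open>Pf (J + L)\<close> is by definition the sum of \<open>Pf L(X|X)\<close> over all finite \<open>X\<close>.\<close>

definition Pf_J_plus :: "('a::linorder) set \<Rightarrow> 'a block_matrix \<Rightarrow> complex" where
  "Pf_J_plus S L = (\<Sum>\<^sub>\<infinity>X | finite X \<and> X \<subseteq> S. Pf_minor L X)"

definition is_Pfaffian_L_ensemble ::
  "('a::linorder) set \<Rightarrow> 'a block_matrix \<Rightarrow> 'a set pmf \<Rightarrow> bool" where
  "is_Pfaffian_L_ensemble S L N \<longleftrightarrow>
     skew_on S L \<and>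
     (\<forall>X. finite X \<and> X \<subseteq> S \<longrightarrow> Pf_minor L X \<in> \<real>\<^sub>\<ge>\<^sub>0) \<and>
     (Pf_minor L) summable_on {X. finite X \<and> X \<subseteq> S} \<and>
     set_pmf N \<subseteq> {X. finite X \<and> X \<subseteq> S} \<and>
     (\<forall>X. finite X \<and> X \<subseteq> S \<longrightarrow> complex_of_real (pmf N X) = Pf_minor L X / Pf_J_plus S L)"


section \<open>The matrix \<open>L\<^sub>h\<close>\<close>

text \<open>Parity is symmetric about 0: \<open>1/2\<close> and \<open>-1/2\<close> are even, \<open>3/2\<close> and \<open>-3/2\<close> are odd, etc.\<close>

definition even_pt :: "real \<Rightarrow> bool" where
  "even_pt x \<longleftrightarrow> (\<exists>k::nat. \<bar>x\<bar> = 2 * real k + 1/2)"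

definition odd_pt :: "real \<Rightarrow> bool" where
  "odd_pt x \<longleftrightarrow> (\<exists>k::nat. \<bar>x\<bar> = 2 * real k + 3/2)"

definition eps :: "real \<Rightarrow> real \<Rightarrow> complex" where
  "eps x y = (if x < y \<and> odd_pt x \<and> even_pt y then 1
              else if y < x \<and> odd_pt y \<and> even_pt x then - 1 else 0)"

definition E_block :: "real block_matrix" where
  "E_block x y = block (eps x y) 0
                       0         0"

definition A_block :: "(real \<Rightarrow> complex) \<Rightarrow> real block_matrix" where
  "A_block h x y = block (eps x y) 0
                         0         (h x * h y / of_real (x - y))"

definition B_block :: "(real \<Rightarrow> complex) \<Rightarrow> real block_matrix" where
  "B_block h x y = block 0 0
                         (h x * h y / of_real (x - y)) (h x * h (y - 1) / of_real (x - y + 1))"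

definition L_mat :: "(real \<Rightarrow> complex) \<Rightarrow> real block_matrix" where
  "L_mat h x y =
     (if x < 0 \<and> y < 0 then E_block x y
      else if x < 0 \<and> y = 1/2 then A_block h x y
      else if x < 0 \<and> y \<ge> 3/2 then B_block h x y
      else if x = 1/2 \<and> y < 0 then - transpose (A_block h y x)
      else if x \<ge> 3/2 \<and> y < 0 then - transpose (B_block h y x)
      else 0)"


section \<open>The functions \<open>h\<close>\<close>

text \<open>The symbol \<open>[a]\<^sub>n\<close>: \<open>(a + 1)(a + 3)\<cdots>(a + n - 1)\<close> for even \<open>n\<close>
  and \<open>a(a + 2)\<cdots>(a + n - 1)\<close> for odd \<open>n\<close>.\<close>

definition bracket :: "complex \<Rightarrow> nat \<Rightarrow> complex" where
  "bracket a n = (if even n then (\<Prod>k<n div 2. a + 2 * of_nat k + 1)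
                  else (\<Prod>k<(n + 1) div 2. a + 2 * of_nat k))"

text \<open>For half-integers \<open>x\<close> the subscripts \<open>x - 1/2\<close> and \<open>- x - 1/2\<close> are nonnegative integers
  in the respective cases, so taking the floor does not change them.\<close>

definition h_mixed :: "complex \<Rightarrow> complex \<Rightarrow> real \<Rightarrow> real \<Rightarrow> complex" where
  "h_mixed z z' \<xi> x =
     (if x > 0 then
        bracket (- 2 * z + 1) (nat \<lfloor>x - 1/2\<rfloor>) * bracket (- 2 * z' + 1) (nat \<lfloor>x - 1/2\<rfloor>)
          / of_real (Gamma (x + 1/2)) * of_real (\<xi> powr (x / 2))
      else
        bracket (2 * z) (nat \<lfloor>- x - 1/2\<rfloor>) * bracket (2 * z') (nat \<lfloor>- x - 1/2\<rfloor>)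
          / of_real (Gamma (- x + 1/2)) * of_real (\<xi> powr (- x / 2)))"

definition h_Plancherel :: "real \<Rightarrow> real \<Rightarrow> complex" where
  "h_Plancherel \<eta> x = of_real ((2 * \<eta>) powr (\<bar>x\<bar> / 2) / Gamma (\<bar>x\<bar> + 1/2))"

end

theory Submission
  imports Defs
begin

text \<open>For \<open>\<theta> = 1/2\<close> the product of the two hook products of \<open>\<lambda>\<close> is, up to \<open>4\<^sup>|\<^sup>\<lambda>\<^sup>|\<close>, the ordinary hook
  product of the doubled diagram \<open>\<nu> = \<lambda>' \<squnion> \<lambda>'\<close>. In Frobenius coordinates the inverse of the latter is a
  Cauchy determinant, and the Pochhammer factors split into brackets in these coordinates.
  On the other side, the Pfaffian of \<open>L(X|X)\<close> factors: the indices \<open>x'\<close> with \<open>x < 1\<close> contribute the Pfaffian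
  of \<open>\<epsilon>\<close>, which is 1 or 0 and detects the parities that characterise doubled diagrams, and the remaining
  indices contribute a Cauchy determinant, which vanishes unless its columns are distinct. Hence the minors
  vanish outside the image of the embedding and are proportional to the point masses on it.

  The total mass is found by adding boxes one at a time: the transition probabilities of the
  Jack-Plancherel growth are residues of an explicit rational function, and their first moments give
  a recursion in the number of boxes for the sums of the unnormalised weights, which leads to the
  exponential and the negative binomial series.\<close>

section \<open>Partial fractions\<close>

text \<open>The embedding explains the form of the matrix. In a diagram whose rows occur in pairs,
  \<open>P i = P (i + 1) + 1\<close> for even \<open>i\<close> (numbered from 0), so recording every
  second coordinate loses nothing, but a recorded point \<open>y\<close> has to supply two columns,
  at \<open>y\<close> and at \<open>y - 1\<close>; this is what the block \<open>B\<close> does. If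
  the number of diagonal boxes is odd, the unpaired last coordinate is 0; its column comes from the
  second copy of \<open>1/2\<close>, while the first copy makes the number of primed indices even.
  Pfaffians are sums over all permutations. To avoid tracking deleted rows and alternating signs,
  the row expansion replaces an index instead of deleting it, and the Cauchy determinant enters only
  through its product formula, which is shown to obey the same recursion. Convergence and
  normalisation cannot be taken for granted, as the measures are given by point masses only. Three
  moments of the transition probabilities suffice for them because
  \<open>(2 * z - c) * (2 * z' - c)\<close> is quadratic in the content \<open>c\<close>.\<close>

lemma partial_fractions:
  fixes a b :: "'i \<Rightarrow> 'a::field"
  assumes "finite K" "inj_on a K" "v \<notin> a ` K"
  shows "(\<Prod>k\<in>K. (v - b k) / (v - a k)) =
    1 + (\<Sum>k\<in>K. (a k - b k) * (\<Prod>j\<in>K-{k}. (a k - b j) / (a k - a j)) / (v - a k))"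
  using assms
proof (induction K arbitrary: v rule: finite_induct)
  case empty
  then show ?case by simp
next
  case (insert l K)
  let ?c = "\<lambda>k. (a k - b k) * (\<Prod>j\<in>K-{k}. (a k - b j) / (a k - a j))"
  have inj: "inj_on a K" and la: "a l \<notin> a ` K" and v: "v \<notin> a ` K" "v \<noteq> a l"
    using insert.prems insert.hyps by auto
  \<comment> \<open>The new factor is \<open>1 + (a l - b l) / (v - a l)\<close>. The induction
    hypothesis is used twice: at \<open>v\<close>, and at the new pole \<open>a l\<close>, where it
    evaluates the new residue.\<close>
  have IHv: "(\<Prod>k\<in>K. (v - b k) / (v - a k)) = 1 + (\<Sum>k\<in>K. ?c k / (v - a k))"
    using insert.IH[OF inj v(1)] .
  have IHl: "(\<Prod>k\<in>K. (a l - b k) / (a l - a k)) = 1 + (\<Sum>k\<in>K. ?c k / (a l - a k))"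
    using insert.IH[OF inj la] .
  have cl: "(\<Prod>j\<in>insert l K - {l}. (a l - b j) / (a l - a j)) = (\<Prod>k\<in>K. (a l - b k) / (a l - a k))"
    using insert.hyps by (intro prod.cong) auto
  have ck: "(a k - b k) * (\<Prod>j\<in>insert l K - {k}. (a k - b j) / (a k - a j)) / (v - a k) =
      ?c k * ((a k - b l) / (a k - a l)) / (v - a k)" if "k \<in> K" for k
  proof -
    have "insert l K - {k} = insert l (K - {k})" using that insert.hyps by auto
    then show ?thesis using insert.hyps by simp
  qed
  \<comment> \<open>The product of the simple poles \<open>1 / (v - a l)\<close> and
    \<open>1 / (v - a k)\<close> is separated; the residue at \<open>a k\<close> acquires the factor
    \<open>(a k - b l) / (a k - a l)\<close>.\<close>
  have key: "?c k / (v - a k) + (a l - b l) / (v - a l) * (?c k / (v - a k)) =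
      ?c k * ((a k - b l) / (a k - a l)) / (v - a k) + (a l - b l) / (v - a l) * (?c k / (a l - a k))"
    if "k \<in> K" for k
  proof -
    have ne: "v - a k \<noteq> 0" "a l - a k \<noteq> 0" "a k - a l \<noteq> 0" "v - a l \<noteq> 0"
      using that la v by (auto simp: image_iff)
    have id: "1 / y + s / w * (1 / y) = ((x + s) / x) / y - s / w * (1 / x)"
      if "x \<noteq> 0" "w \<noteq> 0" "y \<noteq> 0" "w = x + y" for x y w s :: 'a
    proof -
      have "(w + s) * x = (x + s) * w - s * y" using that(4) by (simp add: algebra_simps)
      then show ?thesis using that(1-3) by (simp add: divide_simps)
    qed
    have "1 / (v - a k) + (a l - b l) / (v - a l) * (1 / (v - a k)) =
      ((a k - a l + (a l - b l)) / (a k - a l)) / (v - a k) - (a l - b l) / (v - a l) * (1 / (a k - a l))"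
      by (rule id) (use ne in auto)
    also have "1 / (a k - a l) = - (1 / (a l - a k))"
      using ne by (simp add: field_simps)
    finally have eq: "1 / (v - a k) + (a l - b l) / (v - a l) * (1 / (v - a k)) =
      (a k - b l) / (a k - a l) / (v - a k) + (a l - b l) / (v - a l) * (1 / (a l - a k))"
      by simp
    have scale: "C / y + t * (C / y) = C * r / y + t * (C / z)"
      if "1 / y + t * (1 / y) = r / y + t * (1 / z)" for C t r y z :: 'a
    proof -
      have "C * (1 / y + t * (1 / y)) = C * (r / y + t * (1 / z))" using that by simp
      then show ?thesis by (simp add: distrib_left mult.commute mult.left_commute)
    qed
    show ?thesis by (rule scale[OF eq])
  qed
  have "(\<Prod>k\<in>insert l K. (v - b k) / (v - a k)) = (1 + (a l - b l) / (v - a l)) * (1 + (\<Sum>k\<in>K. ?c k / (v - a k)))"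
    using insert.hyps IHv v by (simp add: field_simps)
  also have "\<dots> = 1 + (a l - b l) / (v - a l) + (\<Sum>k\<in>K. ?c k / (v - a k) + (a l - b l) / (v - a l) * (?c k / (v - a k)))"
    unfolding sum.distrib sum_distrib_left[symmetric] by (simp add: algebra_simps)
  also have "(\<Sum>k\<in>K. ?c k / (v - a k) + (a l - b l) / (v - a l) * (?c k / (v - a k))) =
      (\<Sum>k\<in>K. ?c k * ((a k - b l) / (a k - a l)) / (v - a k) + (a l - b l) / (v - a l) * (?c k / (a l - a k)))"
    by (rule sum.cong) (use key in auto)
  also have "1 + (a l - b l) / (v - a l) + \<dots> = 1 + (\<Sum>k\<in>K. ?c k * ((a k - b l) / (a k - a l)) / (v - a k))
      + (a l - b l) * (1 + (\<Sum>k\<in>K. ?c k / (a l - a k))) / (v - a l)"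
    unfolding sum.distrib sum_distrib_left[symmetric] by (simp add: distrib_left add_divide_distrib)
  also have "\<dots> = 1 + (\<Sum>k\<in>insert l K. (a k - b k) * (\<Prod>j\<in>insert l K-{k}. (a k - b j) / (a k - a j)) / (v - a k))"
    using insert.hyps ck by (simp add: cl IHl[symmetric])
  finally show ?case .
qed

text \<open>The case \<open>b k = a k - \<beta>\<close>: the \<open>c K k\<close> are the residues
  of the product of the factors \<open>1 + \<beta> / (v - a k)\<close>, and the two sums are its
  coefficients at \<open>1 / v\<close> and \<open>1 / v^2\<close> at infinity. Adding boxes uses
  \<beta> = 2, removing them \<beta> = -2. The factor 2 avoids a division in an arbitrary
  field.\<close>

lemma partial_fractions_moments:
  fixes a :: "'i \<Rightarrow> 'a::field" and \<beta> :: 'a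
  assumes "finite K" "inj_on a K"
  defines "c \<equiv> \<lambda>K k. \<beta> * (\<Prod>j\<in>K-{k}. (a k - a j + \<beta>) / (a k - a j))"
  shows "(\<Sum>k\<in>K. c K k) = \<beta> * of_nat (card K)"
    and "2 * (\<Sum>k\<in>K. c K k * a k) =
      2 * \<beta> * (\<Sum>k\<in>K. a k) + \<beta>^2 * of_nat (card K) * (of_nat (card K) - 1)"
  using assms(1,2)
proof (induction K rule: finite_induct)
  case empty
  {
    case 1 show ?case by simp
  next
    case 2 show ?case by simp
  }
next
  case (insert l K)
  note hyps = insert.hyps(1,2)
  have inj: "inj_on a K" and la: "a l \<notin> a ` K" if "inj_on a (insert l K)"
    using that insert.hyps by auto
  have cl: "c (insert l K) l = \<beta> * (1 + (\<Sum>k\<in>K. c K k / (a l - a k)))" if "inj_on a (insert l K)"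
  proof -
    have "(\<Prod>j\<in>insert l K - {l}. (a l - a j + \<beta>) / (a l - a j)) =
        (\<Prod>k\<in>K. (a l - (a k - \<beta>)) / (a l - a k))"
      using hyps by (intro prod.cong) (auto simp: algebra_simps)
    also have "\<dots> = 1 + (\<Sum>k\<in>K. c K k / (a l - a k))"
      using partial_fractions[OF hyps(1) inj[OF that] la[OF that], of "\<lambda>k. a k - \<beta>"]
      by (simp add: c_def algebra_simps)
    finally show ?thesis by (simp add: c_def)
  qed
  have ck: "c (insert l K) k = c K k + \<beta> * (c K k / (a k - a l))" if "inj_on a (insert l K)" "k \<in> K" for k
  proof -
    have "insert l K - {k} = insert l (K - {k})" using that hyps by auto
    moreover have "a k \<noteq> a l" using la that by (metis imageI)
    ultimately show ?thesis
      using hyps by (simp add: c_def field_simps)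
  qed
  have neg: "c K k / (a k - a l) = - (c K k / (a l - a k))" for k
    by (metis minus_diff_eq minus_divide_right)
  {
    case 1
    have "(\<Sum>k\<in>K. c (insert l K) k) = (\<Sum>k\<in>K. c K k + \<beta> * (c K k / (a k - a l)))"
      using ck[OF 1] by simp
    also have "\<dots> = (\<Sum>k\<in>K. c K k) - \<beta> * (\<Sum>k\<in>K. c K k / (a l - a k))"
      unfolding neg by (simp add: sum.distrib sum_distrib_left sum_subtractf)
    finally show ?case
      using hyps insert.IH(1)[OF inj[OF 1]] by (simp add: cl[OF 1] algebra_simps)
  next
    case 2
    have "(\<Sum>k\<in>K. c (insert l K) k * a k) = (\<Sum>k\<in>K. c K k * a k + \<beta> * (c K k - a l * (c K k / (a l - a k))))"
    proof (rule sum.cong[OF refl])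
      fix k assume k: "k \<in> K"
      then have ne: "a l \<noteq> a k" "a k - a l \<noteq> 0" "a l - a k \<noteq> 0" using la[OF 2] by (auto simp: image_iff)
      then have "c K k / (a k - a l) * a k = c K k - a l * (c K k / (a l - a k))"
        unfolding neg by (simp add: field_simps)
      then have "\<beta> * (c K k / (a k - a l)) * a k = \<beta> * (c K k - a l * (c K k / (a l - a k)))"
        by (simp only: mult.assoc)
      then show "c (insert l K) k * a k = c K k * a k + \<beta> * (c K k - a l * (c K k / (a l - a k)))"
        unfolding ck[OF 2 k] by (simp only: distrib_right)
    qed
    also have "\<dots> = (\<Sum>k\<in>K. c K k * a k) + \<beta> * ((\<Sum>k\<in>K. c K k) - a l * (\<Sum>k\<in>K. c K k / (a l - a k)))"
      by (simp add: sum.distrib sum_distrib_left sum_subtractf right_diff_distrib)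
    finally have "2 * (\<Sum>k\<in>insert l K. c (insert l K) k * a k) =
        2 * (\<Sum>k\<in>K. c K k * a k) + 2 * \<beta> * (\<beta> * of_nat (card K) + a l)"
      using hyps insert.IH(1)[OF inj[OF 2]] by (simp add: cl[OF 2] algebra_simps)
    also have "\<dots> = 2 * \<beta> * (\<Sum>k\<in>insert l K. a k) + \<beta>^2 * of_nat (card (insert l K)) * (of_nat (card (insert l K)) - 1)"
      using hyps insert.IH(2)[OF inj[OF 2]] by (simp add: algebra_simps power2_eq_square)
    finally show ?case .
  }
qed

section \<open>Pfaffians of lists of indices\<close>

definition pf_term :: "nat \<Rightarrow> (nat \<Rightarrow> nat \<Rightarrow> complex) \<Rightarrow> (nat \<Rightarrow> nat) \<Rightarrow> complex" where
  "pf_term m A \<sigma> = of_int (sign \<sigma>) * (\<Prod>i<m. A (\<sigma> (2 * i)) (\<sigma> (2 * i + 1)))"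

lemma pfaffian_pf_term: "pfaffian m A = (\<Sum>\<sigma> | \<sigma> permutes {..<2*m}. pf_term m A \<sigma>) / (2 ^ m * fact m)"
  by (simp add: pfaffian_def pf_term_def)

lemma pfaffian_0 [simp]: "pfaffian 0 A = 1"
  by (simp add: pfaffian_def)

lemma pfaffian_cong:
  assumes "\<And>a b. a < 2 * m \<Longrightarrow> b < 2 * m \<Longrightarrow> A a b = B a b"
  shows "pfaffian m A = pfaffian m B"
proof -
  have "pf_term m A \<sigma> = pf_term m B \<sigma>" if "\<sigma> permutes {..<2*m}" for \<sigma>
  proof -
    have "\<sigma> i < 2 * m" if "i < 2 * m" for i
      using permutes_in_image[OF \<open>\<sigma> permutes _\<close>, of i] that by simp
    then show ?thesis
      unfolding pf_term_def by (intro arg_cong2[where f = "(*)"] prod.cong refl assms) auto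
  qed
  then show ?thesis
    unfolding pfaffian_pf_term by (intro arg_cong2[where f = "(/)"] sum.cong) auto
qed

section \<open>Symmetries of the Pfaffian sum and expansion along the first row\<close>

lemma sign_compose_permutes:
  assumes "finite S" "p permutes S" "q permutes S"
  shows "sign (p \<circ> q) = sign p * sign q"
  using assms by (intro sign_compose permutes_imp_permutation)

lemma pf_term_compose_left:
  assumes "\<sigma> permutes {..<2*m}" "\<tau> permutes {..<2*m}"
  shows "pf_term m A (\<tau> \<circ> \<sigma>) = of_int (sign \<tau>) * pf_term m (\<lambda>a b. A (\<tau> a) (\<tau> b)) \<sigma>"
  using assms by (simp add: pf_term_def sign_compose_permutes[of "{..<2*m}"])

lemma pfaffian_permute:
  assumes \<tau>: "\<tau> permutes {..<2*m}"
  shows "pfaffian m (\<lambda>a b. A (\<tau> a) (\<tau> b)) = of_int (sign \<tau>) * pfaffian m A"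
proof -
  have "(\<Sum>\<sigma> | \<sigma> permutes {..<2*m}. pf_term m A \<sigma>) =
      (\<Sum>\<sigma> | \<sigma> permutes {..<2*m}. pf_term m A (\<tau> \<circ> \<sigma>))"
    by (rule setum_permutations_compose_left[OF \<tau>])
  also have "\<dots> = (\<Sum>\<sigma> | \<sigma> permutes {..<2*m}. of_int (sign \<tau>) * pf_term m (\<lambda>a b. A (\<tau> a) (\<tau> b)) \<sigma>)"
    by (rule sum.cong) (auto simp: pf_term_compose_left[OF _ \<tau>])
  finally have "pfaffian m A = of_int (sign \<tau>) * pfaffian m (\<lambda>a b. A (\<tau> a) (\<tau> b))"
    by (simp add: pfaffian_pf_term sum_distrib_left)
  then have "of_int (sign \<tau>) * pfaffian m A =
      of_int (sign \<tau> * sign \<tau>) * pfaffian m (\<lambda>a b. A (\<tau> a) (\<tau> b))"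
    by (simp del: sign_idempotent)
  then show ?thesis by simp
qed

text \<open>The sign of the permutation and exactly one matrix entry change sign. Together with
  \<open>pf_term_swap_pairs\<close> this suffices to bring the index 0 from any position to the
  first one.\<close>

lemma pf_term_swap_in_pair:
  assumes \<sigma>: "\<sigma> permutes {..<2*m}" and i: "i < m"
    and skew: "\<And>a b. a < 2*m \<Longrightarrow> b < 2*m \<Longrightarrow> A a b = - A b a"
  shows "pf_term m A (\<sigma> \<circ> Transposition.transpose (2*i) (2*i+1)) = pf_term m A \<sigma>"
proof -
  let ?t = "Transposition.transpose (2*i) (2*i+1)"
  have t: "?t permutes {..<2*m}" using i by (intro permutes_swap_id) auto
  have lt: "\<sigma> k < 2 * m" if "k < 2 * m" for k
    using permutes_in_image[OF \<sigma>, of k] that by simp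
  have "(\<Prod>k<m. A ((\<sigma> \<circ> ?t) (2*k)) ((\<sigma> \<circ> ?t) (2*k+1))) =
      (\<Prod>k<m. (if k = i then -1 else 1) * A (\<sigma> (2*k)) (\<sigma> (2*k+1)))"
  proof (intro prod.cong refl)
    fix k assume "k \<in> {..<m}"
    show "A ((\<sigma> \<circ> ?t) (2*k)) ((\<sigma> \<circ> ?t) (2*k+1)) = (if k = i then -1 else 1) * A (\<sigma> (2*k)) (\<sigma> (2*k+1))"
    proof (cases "k = i")
      case True
      then show ?thesis using skew[of "\<sigma> (2*i+1)" "\<sigma> (2*i)"] lt[of "2*i"] lt[of "2*i+1"] i by auto
    next
      case False
      then have "2 * k \<noteq> 2 * i" "2 * k + 1 \<noteq> 2 * i" "2 * k \<noteq> 2 * i + 1" "2 * k + 1 \<noteq> 2 * i + 1"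
        by presburger+
      then show ?thesis using False by (simp add: Transposition.transpose_def)
    qed
  qed
  also have "\<dots> = - (\<Prod>k<m. A (\<sigma> (2*k)) (\<sigma> (2*k+1)))"
    using i by (simp add: prod.distrib)
  finally have "(\<Prod>k<m. A ((\<sigma> \<circ> ?t) (2*k)) ((\<sigma> \<circ> ?t) (2*k+1))) = \<dots>" .
  moreover have sg: "sign (\<sigma> \<circ> ?t) = - sign \<sigma>"
    using sign_compose_permutes[OF _ \<sigma> t] by (simp add: sign_swap_id)
  ultimately show ?thesis
    unfolding pf_term_def sg by simp
qed

text \<open>Exchanging two whole pairs is a product of two transpositions, hence even, and only
  reorders the factors.\<close>

lemma pf_term_swap_pairs:
  assumes \<sigma>: "\<sigma> permutes {..<2*m}" and i: "i < m"
  shows "pf_term m A (\<sigma> \<circ> (Transposition.transpose 0 (2*i) \<circ> Transposition.transpose 1 (2*i+1))) = pf_term m A \<sigma>"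
proof (cases "i = 0")
  case True
  then show ?thesis by simp
next
  case False
  let ?t = "Transposition.transpose 0 (2*i) \<circ> Transposition.transpose 1 (2*i+1)"
  have t1: "Transposition.transpose 0 (2*i) permutes {..<2*m}" "Transposition.transpose 1 (2*i+1) permutes {..<2*m}"
    using i by (intro permutes_swap_id; simp)+
  then have t: "?t permutes {..<2*m}" by (intro permutes_compose)
  have sg: "sign ?t = 1"
    using False by (subst sign_compose_permutes[OF _ t1]) (auto simp: sign_swap_id)
  have k: "?t (2*k) = 2 * Transposition.transpose 0 i k" "?t (2*k+1) = 2 * Transposition.transpose 0 i k + 1" for k
    using False by (auto simp: Transposition.transpose_def)
  have "(\<Prod>k<m. A ((\<sigma> \<circ> ?t) (2*k)) ((\<sigma> \<circ> ?t) (2*k+1))) =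
      (\<Prod>k<m. A (\<sigma> (2 * Transposition.transpose 0 i k)) (\<sigma> (2 * Transposition.transpose 0 i k + 1)))"
    unfolding o_apply[of \<sigma> ?t] k ..
  also have "\<dots> = (\<Prod>k<m. A (\<sigma> (2 * k)) (\<sigma> (2 * k + 1)))"
  proof -
    have "Transposition.transpose 0 i permutes {..<m}" using i by (intro permutes_swap_id) auto
    from prod.permute[OF this, of "\<lambda>k. A (\<sigma> (2 * k)) (\<sigma> (2 * k + 1))"]
    show ?thesis by (simp add: o_def)
  qed
  finally have P: "(\<Prod>k<m. A ((\<sigma> \<circ> ?t) (2*k)) ((\<sigma> \<circ> ?t) (2*k+1))) = \<dots>" .
  have "sign (\<sigma> \<circ> ?t) = sign \<sigma>"
    unfolding sign_compose_permutes[OF finite_lessThan \<sigma> t] sg by simp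
  then show ?thesis
    unfolding pf_term_def P by (simp only:)
qed

lemma sum_permutes_compose_right_at:
  assumes \<tau>: "\<tau> permutes S" and "finite S" and \<tau>0: "\<tau> x = y"
    and f: "\<And>\<sigma>. \<sigma> permutes S \<Longrightarrow> f (\<sigma> \<circ> \<tau>) = f \<sigma>"
  shows "(\<Sum>\<sigma> | \<sigma> permutes S \<and> \<sigma> y = z. f \<sigma>) = (\<Sum>\<sigma> | \<sigma> permutes S \<and> \<sigma> x = z. f \<sigma>)"
proof (rule sum.reindex_bij_witness[of _ "\<lambda>\<sigma>. \<sigma> \<circ> inv \<tau>" "\<lambda>\<sigma>. \<sigma> \<circ> \<tau>"])
  show "\<And>a. a \<in> {\<sigma>. \<sigma> permutes S \<and> \<sigma> y = z} \<Longrightarrow> (a \<circ> \<tau>) \<circ> inv \<tau> = a"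
    by (simp add: o_assoc[symmetric] permutes_inv_o[OF \<tau>])
  show "\<And>b. b \<in> {\<sigma>. \<sigma> permutes S \<and> \<sigma> x = z} \<Longrightarrow> (b \<circ> inv \<tau>) \<circ> \<tau> = b"
    by (simp add: o_assoc[symmetric] permutes_inv_o[OF \<tau>])
  show "a \<circ> \<tau> \<in> {\<sigma>. \<sigma> permutes S \<and> \<sigma> x = z}" if "a \<in> {\<sigma>. \<sigma> permutes S \<and> \<sigma> y = z}" for a
    using that \<tau> \<tau>0 by (auto intro: permutes_compose)
  show "b \<circ> inv \<tau> \<in> {\<sigma>. \<sigma> permutes S \<and> \<sigma> y = z}" if "b \<in> {\<sigma>. \<sigma> permutes S \<and> \<sigma> x = z}" for b
  proof -
    have "inv \<tau> y = x" using \<tau>0 permutes_inv_eq[OF \<tau>] by simp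
    then show ?thesis using that \<tau> by (auto intro: permutes_compose permutes_inv)
  qed
  show "\<And>a. a \<in> {\<sigma>. \<sigma> permutes S \<and> \<sigma> y = z} \<Longrightarrow> f (a \<circ> \<tau>) = f a"
    using f by simp
qed

text \<open>The permutations are sorted by the position at which they take the value 0. An even
  position is brought to the front by an exchange of pairs, an odd one by an additional swap inside
  its pair, so all \<open>2 * m\<close> positions contribute equally.\<close>

lemma sum_pf_term_first:
  assumes m: "m > 0"
    and skew: "\<And>a b. a < 2*m \<Longrightarrow> b < 2*m \<Longrightarrow> A a b = - A b a"
  shows "(\<Sum>\<sigma> | \<sigma> permutes {..<2*m}. pf_term m A \<sigma>) =
    of_nat (2*m) * (\<Sum>\<sigma> | \<sigma> permutes {..<2*m} \<and> \<sigma> 0 = 0. pf_term m A \<sigma>)"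
proof -
  let ?S = "{..<2*m}"
  have eq: "(\<Sum>\<sigma> | \<sigma> permutes ?S \<and> \<sigma> s = 0. pf_term m A \<sigma>) = (\<Sum>\<sigma> | \<sigma> permutes ?S \<and> \<sigma> 0 = 0. pf_term m A \<sigma>)"
    if s: "s < 2 * m" for s
  proof -
    define i where "i = s div 2"
    have i: "i < m" using s by (auto simp: i_def)
    have t0: "Transposition.transpose 0 (2*i) permutes {..<2*m}" "Transposition.transpose 1 (2*i+1) permutes {..<2*m}"
      "Transposition.transpose (2*i) (2*i+1) permutes {..<2*m}"
      using i by (intro permutes_swap_id; simp)+
    have even: "(\<Sum>\<sigma> | \<sigma> permutes ?S \<and> \<sigma> (2*i) = 0. pf_term m A \<sigma>) = (\<Sum>\<sigma> | \<sigma> permutes ?S \<and> \<sigma> 0 = 0. pf_term m A \<sigma>)"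
    proof (rule sum_permutes_compose_right_at)
      show "(Transposition.transpose 0 (2*i) \<circ> Transposition.transpose 1 (2*i+1)) permutes ?S"
        using t0 by (intro permutes_compose)
      show "(Transposition.transpose 0 (2*i) \<circ> Transposition.transpose 1 (2*i+1)) 0 = 2 * i"
        by (simp add: Transposition.transpose_def)
      show "pf_term m A (\<sigma> \<circ> (Transposition.transpose 0 (2*i) \<circ> Transposition.transpose 1 (2*i+1))) = pf_term m A \<sigma>"
        if "\<sigma> permutes ?S" for \<sigma>
        by (rule pf_term_swap_pairs[OF that i])
    qed simp
    have odd: "(\<Sum>\<sigma> | \<sigma> permutes ?S \<and> \<sigma> (2*i+1) = 0. pf_term m A \<sigma>) = (\<Sum>\<sigma> | \<sigma> permutes ?S \<and> \<sigma> (2*i) = 0. pf_term m A \<sigma>)"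
      by (rule sum_permutes_compose_right_at[symmetric, OF t0(3)])
         (simp_all only: finite_lessThan transpose_apply_second pf_term_swap_in_pair[OF _ i skew])
    have "s = 2 * i \<or> s = 2 * i + 1" by (auto simp: i_def)
    then show ?thesis using even odd by auto
  qed
  have "(\<Sum>\<sigma> | \<sigma> permutes ?S. pf_term m A \<sigma>) =
      (\<Sum>s\<in>?S. \<Sum>\<sigma> | \<sigma> \<in> {\<sigma>. \<sigma> permutes ?S} \<and> inv \<sigma> 0 = s. pf_term m A \<sigma>)"
  proof (rule sum.group[symmetric])
    show "(\<lambda>\<sigma>. inv \<sigma> 0) ` {\<sigma>. \<sigma> permutes ?S} \<subseteq> ?S"
    proof safe
      fix \<sigma> assume "\<sigma> permutes ?S"
      from permutes_in_image[OF permutes_inv[OF this], of 0] m show "inv \<sigma> 0 < 2 * m" by simp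
    qed
  qed (auto intro: finite_permutations)
  also have "\<dots> = (\<Sum>s\<in>?S. \<Sum>\<sigma> | \<sigma> permutes ?S \<and> \<sigma> s = 0. pf_term m A \<sigma>)"
    by (intro sum.cong refl) (auto simp: permutes_inv_eq permutes_inverses)
  also have "\<dots> = (\<Sum>s\<in>?S. \<Sum>\<sigma> | \<sigma> permutes ?S \<and> \<sigma> 0 = 0. pf_term m A \<sigma>)"
    by (intro sum.cong[OF refl] eq) simp
  finally show ?thesis by simp
qed

text \<open>Permutations fixing 0 and 1 are permutations of the remaining indices shifted by 2;
  transporting them by \<open>map_permutation\<close> keeps the sign.\<close>

lemma sum_pf_term_first_two:
  "(\<Sum>\<sigma> | \<sigma> permutes {..<2 * Suc m} \<and> \<sigma> 0 = 0 \<and> \<sigma> 1 = 1. pf_term (Suc m) A \<sigma>) =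
    A 0 1 * (\<Sum>\<rho> | \<rho> permutes {..<2*m}. pf_term m (\<lambda>a b. A (a + 2) (b + 2)) \<rho>)"
proof -
  let ?f = "\<lambda>a::nat. a + 2" and ?S = "{..<2*m}" and ?T = "{2..<2 * Suc m}"
  let ?F = "map_permutation ?S ?f"
  have bij: "bij_betw ?f ?S ?T"
    by (rule bij_betwI[of _ _ _ "\<lambda>a. a - 2"]) auto
  have inj: "inj_on ?f ?S" by (auto simp: inj_on_def)
  have Tsub: "{\<sigma>. \<sigma> permutes {..<2 * Suc m} \<and> \<sigma> 0 = 0 \<and> \<sigma> 1 = 1} = {\<sigma>. \<sigma> permutes ?T}"
  proof safe
    fix \<sigma> assume *: "\<sigma> permutes {..<2 * Suc m}" "\<sigma> 0 = 0" "\<sigma> 1 = 1"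
    show "\<sigma> permutes ?T"
    proof (rule permutes_superset[OF *(1)])
      fix x assume "x \<in> {..<2 * Suc m} - ?T"
      then have "x = 0 \<or> x = 1" by auto
      then show "\<sigma> x = x" using * by auto
    qed
  next
    fix \<sigma> assume *: "\<sigma> permutes ?T"
    show "\<sigma> permutes {..<2 * Suc m}" by (rule permutes_subset[OF *]) auto
    show "\<sigma> 0 = 0" "\<sigma> 1 = 1" by (rule permutes_not_in[OF *]; simp)+
  qed
  have "(\<Sum>\<sigma> | \<sigma> permutes ?T. pf_term (Suc m) A \<sigma>) = (\<Sum>\<rho> | \<rho> permutes ?S. pf_term (Suc m) A (?F \<rho>))"
  proof (rule sum.reindex_bij_witness[of _ ?F "map_permutation ?T (inv_into ?S ?f)"])
    fix \<sigma> assume "\<sigma> \<in> {\<sigma>. \<sigma> permutes ?T}"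
    then have s: "\<sigma> permutes ?T" by simp
    have b': "bij_betw (inv_into ?S ?f) ?T ?S" using bij by (rule bij_betw_inv_into)
    show "map_permutation ?T (inv_into ?S ?f) \<sigma> \<in> {\<rho>. \<rho> permutes ?S}"
      using map_permutation_permutes[OF b' s] by simp
    show "?F (map_permutation ?T (inv_into ?S ?f) \<sigma>) = \<sigma>"
      by (rule map_permutation_compose_inv[OF b' s]) (rule bij_betw_inv_into_right[OF bij])
    then show "pf_term (Suc m) A (?F (map_permutation ?T (inv_into ?S ?f) \<sigma>)) = pf_term (Suc m) A \<sigma>"
      by simp
  next
    fix \<rho> assume "\<rho> \<in> {\<rho>. \<rho> permutes ?S}"
    then have r: "\<rho> permutes ?S" by simp
    show "?F \<rho> \<in> {\<sigma>. \<sigma> permutes ?T}" using map_permutation_permutes[OF bij r] by simp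
    show "map_permutation ?T (inv_into ?S ?f) (?F \<rho>) = \<rho>"
      by (rule map_permutation_compose_inv[OF bij r]) (rule inv_into_f_f[OF inj])
  qed
  also have "\<dots> = (\<Sum>\<rho> | \<rho> permutes ?S. A 0 1 * pf_term m (\<lambda>a b. A (a + 2) (b + 2)) \<rho>)"
  proof (intro sum.cong refl)
    fix \<rho> assume "\<rho> \<in> {\<rho>. \<rho> permutes ?S}"
    then have r: "\<rho> permutes ?S" by simp
    have FT: "?F \<rho> permutes ?T" by (rule map_permutation_permutes[OF bij r])
    have F01: "?F \<rho> 0 = 0" "?F \<rho> 1 = 1"
      by (rule permutes_not_in[OF FT]; simp)+
    have F2: "?F \<rho> (a + 2) = \<rho> a + 2" if "a < 2 * m" for a
      using map_permutation_apply[OF inj, of a \<rho>] that by simp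
    have "(\<Prod>i<Suc m. A (?F \<rho> (2*i)) (?F \<rho> (2*i+1))) =
        A 0 1 * (\<Prod>i<m. A (?F \<rho> (2*i+2)) (?F \<rho> (2*i+1+2)))"
      using F01 by (subst prod.lessThan_Suc_shift) simp
    also have "(\<Prod>i<m. A (?F \<rho> (2*i+2)) (?F \<rho> (2*i+1+2))) = (\<Prod>i<m. A (\<rho> (2*i) + 2) (\<rho> (2*i+1) + 2))"
      by (intro prod.cong refl arg_cong2[where f = A] F2) auto
    finally show "pf_term (Suc m) A (?F \<rho>) = A 0 1 * pf_term m (\<lambda>a b. A (a + 2) (b + 2)) \<rho>"
      unfolding pf_term_def using sign_map_permutation[OF inj r] by (simp add: algebra_simps)
  qed
  finally show ?thesis
    unfolding Tsub by (simp add: sum_distrib_left)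
qed

text \<open>After the normalisation \<open>\<sigma> 0 = 0\<close> the permutations are sorted by
  \<open>j = \<sigma> 1\<close>. Composition from the left with the transposition of 1 and
  \<open>j\<close> reduces to \<open>\<sigma> 1 = 1\<close> at the cost of one sign, and row 1 takes
  the place that row \<open>j\<close> had.\<close>

lemma pfaffian_expand:
  assumes skew: "\<And>a b. a < 2 * Suc m \<Longrightarrow> b < 2 * Suc m \<Longrightarrow> A a b = - A b a"
  shows "pfaffian (Suc m) A = A 0 1 * pfaffian m (\<lambda>a b. A (a + 2) (b + 2)) -
    (\<Sum>j\<in>{2..<2 * Suc m}. A 0 j * pfaffian m (\<lambda>a b. A (Transposition.transpose 1 j (a + 2)) (Transposition.transpose 1 j (b + 2))))"
proof -
  let ?S = "{..<2 * Suc m}"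
  let ?G = "\<lambda>j. \<Sum>\<sigma> | \<sigma> permutes ?S \<and> \<sigma> 0 = 0 \<and> \<sigma> 1 = j. pf_term (Suc m) A \<sigma>"
  let ?c = "2 ^ m * fact m :: complex"
  have G1: "?G 1 = A 0 1 * (pfaffian m (\<lambda>a b. A (a + 2) (b + 2)) * ?c)"
    by (simp add: sum_pf_term_first_two[simplified] pfaffian_pf_term)
  have Gj: "?G j = - (A 0 j * (pfaffian m (\<lambda>a b. A (Transposition.transpose 1 j (a + 2)) (Transposition.transpose 1 j (b + 2))) * ?c))"
    if j: "j \<in> {2..<2 * Suc m}" for j
  proof -
    let ?t = "Transposition.transpose 1 j"
    have t: "?t permutes ?S" using j by (intro permutes_swap_id) auto
    have neg: "pf_term (Suc m) A (?t \<circ> \<sigma>) = - pf_term (Suc m) (\<lambda>a b. A (?t a) (?t b)) \<sigma>"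
      if "\<sigma> permutes ?S" for \<sigma>
      unfolding pf_term_compose_left[OF that t] using j by (simp add: sign_swap_id)
    have "?G j = (\<Sum>\<sigma> | \<sigma> permutes ?S \<and> \<sigma> 0 = 0 \<and> \<sigma> 1 = 1. pf_term (Suc m) A (?t \<circ> \<sigma>))"
    proof (rule sum.reindex_bij_witness[of _ "\<lambda>\<sigma>. ?t \<circ> \<sigma>" "\<lambda>\<sigma>. ?t \<circ> \<sigma>"])
      fix \<sigma> assume "\<sigma> \<in> {\<sigma>. \<sigma> permutes ?S \<and> \<sigma> 0 = 0 \<and> \<sigma> 1 = j}"
      then show "?t \<circ> \<sigma> \<in> {\<sigma>. \<sigma> permutes ?S \<and> \<sigma> 0 = 0 \<and> \<sigma> 1 = 1}"
        using j t by (auto intro: permutes_compose simp: Transposition.transpose_def)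
      show "?t \<circ> (?t \<circ> \<sigma>) = \<sigma>" by (simp add: fun_eq_iff)
      show "pf_term (Suc m) A (?t \<circ> (?t \<circ> \<sigma>)) = pf_term (Suc m) A \<sigma>" by (simp add: o_assoc)
    next
      fix \<sigma> assume "\<sigma> \<in> {\<sigma>. \<sigma> permutes ?S \<and> \<sigma> 0 = 0 \<and> \<sigma> 1 = 1}"
      then show "?t \<circ> \<sigma> \<in> {\<sigma>. \<sigma> permutes ?S \<and> \<sigma> 0 = 0 \<and> \<sigma> 1 = j}"
        using j t by (auto intro: permutes_compose simp: Transposition.transpose_def)
      show "?t \<circ> (?t \<circ> \<sigma>) = \<sigma>" by (simp add: fun_eq_iff)
    qed
    also have "\<dots> = (\<Sum>\<sigma> | \<sigma> permutes ?S \<and> \<sigma> 0 = 0 \<and> \<sigma> 1 = 1. - pf_term (Suc m) (\<lambda>a b. A (?t a) (?t b)) \<sigma>)"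
      by (intro sum.cong[OF refl] neg) simp
    also have "\<dots> = - (A 0 j * (\<Sum>\<rho> | \<rho> permutes {..<2*m}. pf_term m (\<lambda>a b. A (?t (a + 2)) (?t (b + 2))) \<rho>))"
      unfolding sum_negf sum_pf_term_first_two using j by (simp add: Transposition.transpose_def)
    finally show ?thesis by (simp add: pfaffian_pf_term)
  qed
  have sumG: "(\<Sum>j\<in>{2..<2 * Suc m}. ?G j) = (\<Sum>j\<in>{2..<2 * Suc m}.
      - (A 0 j * (pfaffian m (\<lambda>a b. A (Transposition.transpose 1 j (a + 2)) (Transposition.transpose 1 j (b + 2))) * ?c)))"
    by (intro sum.cong refl Gj)
  have "(\<Sum>\<sigma> | \<sigma> permutes ?S \<and> \<sigma> 0 = 0. pf_term (Suc m) A \<sigma>) =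
      (\<Sum>j\<in>insert 1 {2..<2 * Suc m}. \<Sum>\<sigma> | \<sigma> \<in> {\<sigma>. \<sigma> permutes ?S \<and> \<sigma> 0 = 0} \<and> \<sigma> 1 = j. pf_term (Suc m) A \<sigma>)"
  proof (rule sum.group[symmetric])
    show "(\<lambda>\<sigma>. \<sigma> 1) ` {\<sigma>. \<sigma> permutes ?S \<and> \<sigma> 0 = 0} \<subseteq> insert 1 {2..<2 * Suc m}"
    proof safe
      fix \<sigma> assume *: "\<sigma> permutes ?S" "\<sigma> 0 = 0" "\<sigma> 1 \<notin> {2..<2 * Suc m}"
      have "\<sigma> 1 \<in> ?S" using permutes_in_image[OF *(1), of 1] by simp
      moreover have "\<sigma> 1 \<noteq> \<sigma> 0" using permutes_inj[OF *(1)] by (auto dest: injD)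
      ultimately show "\<sigma> 1 = 1" using * by auto
    qed
    show "finite {\<sigma>. \<sigma> permutes ?S \<and> \<sigma> 0 = 0}"
      by (rule finite_subset[OF _ finite_permutations[of ?S]]) auto
  qed simp
  also have "\<dots> = (\<Sum>j\<in>insert 1 {2..<2 * Suc m}. ?G j)"
    by (intro sum.cong refl) auto
  also have "\<dots> = ?G 1 + (\<Sum>j\<in>{2..<2 * Suc m}. ?G j)"
    by (subst sum.insert) auto
  also have "\<dots> = (A 0 1 * pfaffian m (\<lambda>a b. A (a + 2) (b + 2)) -
    (\<Sum>j\<in>{2..<2 * Suc m}. A 0 j * pfaffian m (\<lambda>a b. A (Transposition.transpose 1 j (a + 2)) (Transposition.transpose 1 j (b + 2))))) * ?c"
    unfolding G1 sumG
    by (simp only: sum_negf sum_distrib_right left_diff_distrib mult.assoc add_uminus_conv_diff)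
  finally have first: "(\<Sum>\<sigma> | \<sigma> permutes ?S \<and> \<sigma> 0 = 0. pf_term (Suc m) A \<sigma>) = \<dots>" .
  \<comment> \<open>The factor \<open>2 * Suc m\<close> of the normalisation cancels against the
    number of positions in \<open>sum_pf_term_first\<close>.\<close>
  have c: "2 ^ Suc m * fact (Suc m) = of_nat (2 * Suc m) * ?c"
    by simp
  have quot: "t / (n * d) = r" if "t = n * (r * d)" "n \<noteq> 0" "d \<noteq> 0" for t n d r :: complex
    using that by simp
  show ?thesis
    unfolding pfaffian_pf_term[of "Suc m" A] c
  proof (rule quot)
    show "of_nat (2 * Suc m) \<noteq> (0::complex)" unfolding of_nat_eq_0_iff by simp
    show "(\<Sum>\<sigma> | \<sigma> permutes ?S. pf_term (Suc m) A \<sigma>) = of_nat (2 * Suc m) *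
        ((A 0 1 * pfaffian m (\<lambda>a b. A (a + 2) (b + 2)) -
          (\<Sum>j\<in>{2..<2 * Suc m}. A 0 j * pfaffian m
            (\<lambda>a b. A (Transposition.transpose 1 j (a + 2)) (Transposition.transpose 1 j (b + 2))))) * ?c)"
      unfolding first[symmetric] by (rule sum_pf_term_first[OF zero_less_Suc skew])
  qed simp
qed

text \<open>Rows are addressed by labels in a list, so that swapping, moving and replacing rows
  become list operations. Because of the rounding in \<open>div\<close>, the last entry of a list of
  odd length is ignored; hence the evenness conditions below.\<close>

definition pf_list :: "('i \<Rightarrow> 'i \<Rightarrow> complex) \<Rightarrow> 'i list \<Rightarrow> complex" where
  "pf_list A xs = pfaffian (length xs div 2) (\<lambda>a b. A (xs ! a) (xs ! b))"

lemma pf_list_Nil [simp]: "pf_list A [] = 1"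
  by (simp add: pf_list_def)

lemma pf_list_cong:
  assumes "length xs = length ys"
    and "\<And>i j. i < length xs \<Longrightarrow> j < length xs \<Longrightarrow> A (xs ! i) (xs ! j) = B (ys ! i) (ys ! j)"
  shows "pf_list A xs = pf_list B ys"
  unfolding pf_list_def using assms by (auto intro!: pfaffian_cong)

lemma pf_list_swap:
  assumes "even (length xs)" "i < length xs" "j < length xs" "i \<noteq> j"
  shows "pf_list A (xs[i := xs ! j, j := xs ! i]) = - pf_list A xs"
proof -
  let ?n = "length xs div 2"
  have n: "2 * ?n = length xs" using assms by simp
  have t: "Transposition.transpose i j permutes {..<2 * ?n}"
    unfolding n using assms by (intro permutes_swap_id) auto
  have "pf_list A (xs[i := xs ! j, j := xs ! i]) =
      pfaffian ?n (\<lambda>a b. A (xs ! Transposition.transpose i j a) (xs ! Transposition.transpose i j b))"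
    unfolding pf_list_def length_list_update using n assms
    by (intro pfaffian_cong arg_cong2[where f = A]) (auto simp: nth_list_update Transposition.transpose_def)
  also have "\<dots> = - pf_list A xs"
    using pfaffian_permute[OF t, of "\<lambda>a b. A (xs ! a) (xs ! b)"] assms
    by (simp add: pf_list_def sign_swap_id)
  finally show ?thesis .
qed

lemma pf_list_swap_adjacent:
  assumes "even (length us + length vs)"
  shows "pf_list A (us @ x # y # vs) = - pf_list A (us @ y # x # vs)"
  using pf_list_swap[of "us @ y # x # vs" "length us" "Suc (length us)" A] assms
  by (simp add: nth_append list_update_append)

lemma pf_list_move:
  assumes "odd (length us + length vs + length ws)"
  shows "pf_list A (us @ x # vs @ ws) = (-1) ^ length vs * pf_list A (us @ vs @ x # ws)"
  using assms
proof (induction vs arbitrary: us)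
  case (Cons v vs)
  have "pf_list A (us @ x # v # (vs @ ws)) = - pf_list A (us @ v # x # (vs @ ws))"
    by (rule pf_list_swap_adjacent) (use Cons.prems in auto)
  then show ?case using Cons.IH[of "us @ [v]"] Cons.prems by simp
qed simp

definition pf_skew :: "('i \<Rightarrow> 'i \<Rightarrow> complex) \<Rightarrow> bool" where
  "pf_skew A \<longleftrightarrow> (\<forall>x y. A x y = - A y x)"

text \<open>Expansion along the first row. Instead of deleting the index \<open>zs ! i\<close>, the index \<open>y\<close> is put in
  its place; for this reason all terms of the sum carry the same sign.\<close>

lemma pf_list_expand:
  assumes skew: "pf_skew A" and ev: "even (length zs)"
  shows "pf_list A (x # y # zs) =
    A x y * pf_list A zs - (\<Sum>i<length zs. A x (zs ! i) * pf_list A (zs[i := y]))"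
proof -
  let ?m = "length zs div 2"
  let ?xs = "x # y # zs"
  have m: "length ?xs div 2 = Suc ?m" "2 * ?m = length zs" using ev by auto
  have "pf_list A ?xs = A (?xs ! 0) (?xs ! 1) * pfaffian ?m (\<lambda>a b. A (?xs ! (a + 2)) (?xs ! (b + 2))) -
    (\<Sum>j\<in>{2..<2 * Suc ?m}. A (?xs ! 0) (?xs ! j) *
      pfaffian ?m (\<lambda>a b. A (?xs ! Transposition.transpose 1 j (a + 2)) (?xs ! Transposition.transpose 1 j (b + 2))))"
    unfolding pf_list_def m(1) using skew unfolding pf_skew_def by (intro pfaffian_expand) blast
  also have "?xs ! 0 = x" by simp
  also have "?xs ! 1 = y" by simp
  also have "pfaffian ?m (\<lambda>a b. A (?xs ! (a + 2)) (?xs ! (b + 2))) = pf_list A zs"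
    by (simp add: pf_list_def)
  also have "(\<Sum>j\<in>{2..<2 * Suc ?m}. A x (?xs ! j) *
      pfaffian ?m (\<lambda>a b. A (?xs ! Transposition.transpose 1 j (a + 2)) (?xs ! Transposition.transpose 1 j (b + 2)))) =
     (\<Sum>i<length zs. A x (zs ! i) * pf_list A (zs[i := y]))"
  proof (rule sum.reindex_bij_witness[of _ "\<lambda>i. i + 2" "\<lambda>j. j - 2"])
    fix j assume j: "j \<in> {2..<2 * Suc ?m}"
    then obtain i where i: "j = i + 2" "i < length zs"
      by (metis add_2_eq_Suc' atLeastLessThan_iff le_add_diff_inverse2 less_diff_conv m(2) mult_Suc_right add.commute nat_add_left_cancel_less)
    show "A x (zs ! (j - 2)) * pf_list A (zs[j - 2 := y]) = A x (?xs ! j) *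
      pfaffian ?m (\<lambda>a b. A (?xs ! Transposition.transpose 1 j (a + 2)) (?xs ! Transposition.transpose 1 j (b + 2)))"
      unfolding pf_list_def length_list_update
      by (intro arg_cong2[where f = "(*)"] pfaffian_cong arg_cong2[where f = A])
         (use i m(2) in \<open>auto simp: nth_list_update Transposition.transpose_def\<close>)
  qed (use m(2) in auto)
  finally show ?thesis .
qed

lemma pf_list_zero_row:
  assumes "pf_skew A" "even (length zs)" "\<And>z. z \<in> set (y # zs) \<Longrightarrow> A x z = 0"
  shows "pf_list A (x # y # zs) = 0"
  using assms by (simp add: pf_list_expand)

lemma pf_list_zero_row_odd:
  assumes "pf_skew A" "odd (length zs)" "\<And>z. z \<in> set zs \<Longrightarrow> A x z = 0"
  shows "pf_list A (x # zs) = 0"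
proof (cases zs)
  case (Cons y ys)
  then show ?thesis using assms pf_list_zero_row[of A ys y x] by simp
qed (use assms in auto)

lemma pf_list_equal_rows:
  assumes "even (length xs)" "i < length xs" "j < length xs" "i \<noteq> j" "pf_skew A"
    and eq: "\<And>z. z \<in> set xs \<Longrightarrow> A (xs ! i) z = A (xs ! j) z"
  shows "pf_list A xs = 0"
proof -
  have eq': "A z (xs ! i) = A z (xs ! j)" if "z \<in> set xs" for z
    using eq[OF that] assms(5) unfolding pf_skew_def by metis
  have "pf_list A (xs[i := xs ! j, j := xs ! i]) = pf_list A xs"
    by (rule pf_list_cong) (use assms eq eq' in \<open>auto simp: nth_list_update\<close>)
  then show ?thesis using pf_list_swap[OF assms(1-4), of A] by simp
qed

text \<open>Once the row of \<open>y\<close> is moved to the front, only its entry at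
  \<open>x\<close> contributes to the expansion.\<close>

lemma pf_list_peel_pair:
  assumes "pf_skew A" "even (length zs)" "\<And>z. z \<in> set zs \<Longrightarrow> A y z = 0"
  shows "pf_list A (x # y # zs) = A x y * pf_list A zs"
proof -
  have "pf_list A (x # y # zs) = - pf_list A (y # x # zs)"
    using pf_list_swap_adjacent[of "[]" zs A x y] assms(2) by simp
  also have "\<dots> = - (A y x * pf_list A zs)"
    using assms by (simp add: pf_list_expand)
  also have "A y x = - A x y" using assms(1) unfolding pf_skew_def by metis
  finally show ?thesis by simp
qed

text \<open>If only indices of different kinds (\<open>U\<close> or not) are coupled, every matching pairs the two kinds.\<close>

lemma pf_list_unbalanced:
  assumes "pf_skew A" "even (length xs)"
    and "\<And>a b. U a = U b \<Longrightarrow> A a b = 0"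
    and "length (filter U xs) \<noteq> length (filter (\<lambda>x. \<not> U x) xs)"
  shows "pf_list A xs = 0"
  using assms(2,4)
proof (induction "length xs" arbitrary: xs rule: less_induct)
  case less
  consider "xs = []" | x where "xs = [x]" | x y zs where "xs = x # y # zs"
    by (metis list.exhaust)
  then show ?case
  proof cases
    case 3
    have ev: "even (length zs)" using less.prems 3 by simp
    \<comment> \<open>Up to order, \<open>zs[i := y]\<close> is \<open>x # y # zs\<close> without
      \<open>x\<close> and \<open>zs ! i\<close>. If these two are of different kinds, both counts
      drop by 1 and the imbalance persists.\<close>
    have cnt: "length (filter P (zs[i := y])) + (if P (zs ! i) then 1 else 0) =
        length (filter P zs) + (if P y then 1 else 0)" if "i < length zs" for i P
    proof -
      have "zs = take i zs @ zs ! i # drop (Suc i) zs" using that by (rule id_take_nth_drop)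
      then have "length (filter P zs) = length (filter P (take i zs @ zs ! i # drop (Suc i) zs))" by simp
      then show ?thesis using that by (simp add: upd_conv_take_nth_drop)
    qed
    have "A x y * pf_list A zs = 0"
    proof (cases "U x = U y")
      case False
      then have "length (filter U zs) \<noteq> length (filter (\<lambda>x. \<not> U x) zs)"
        using less.prems 3 by (auto split: if_splits)
      then show ?thesis using less.hyps[of zs] 3 ev by simp
    qed (use assms(3) in simp)
    moreover have z2: "A x (zs ! i) * pf_list A (zs[i := y]) = 0" if i: "i < length zs" for i
    proof (cases "U x = U (zs ! i)")
      case False
      then have "length (filter U (zs[i := y])) \<noteq> length (filter (\<lambda>x. \<not> U x) (zs[i := y]))"
        using less.prems(2) 3 cnt[OF i, of U] cnt[OF i, of "\<lambda>x. \<not> U x"] by (auto split: if_splits)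
      then show ?thesis using less.hyps[of "zs[i := y]"] 3 ev by simp
    qed (use assms(3) in simp)
    moreover have "(\<Sum>i<length zs. A x (zs ! i) * pf_list A (zs[i := y])) = 0"
      by (intro sum.neutral ballI z2) simp
    ultimately show ?thesis
      unfolding 3 pf_list_expand[OF assms(1) ev] by simp
  qed (use less.prems in auto)
qed

section \<open>Cauchy Pfaffians\<close>

fun interleave :: "'a list \<Rightarrow> 'a list \<Rightarrow> 'a list" where
  "interleave (u # us) (v # vs) = u # v # interleave us vs"
| "interleave _ _ = []"

lemma interleave_append:
  "length us = length vs \<Longrightarrow> interleave (us @ us') (vs @ vs') = interleave us vs @ interleave us' vs'"
  by (induction us vs rule: list_induct2) auto

lemma length_interleave [simp]:
  "length us = length vs \<Longrightarrow> length (interleave us vs) = 2 * length vs"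
  by (induction us vs rule: list_induct2) auto

lemma set_interleave:
  "length us = length vs \<Longrightarrow> set (interleave us vs) = set us \<union> set vs"
  by (induction us vs rule: list_induct2) auto

lemma nth_interleave:
  "length us = length vs \<Longrightarrow> k < length vs \<Longrightarrow>
    interleave us vs ! (2 * k) = us ! k \<and> interleave us vs ! (2 * k + 1) = vs ! k"
proof (induction us vs arbitrary: k rule: list_induct2)
  case (Cons u us v vs)
  then show ?case by (cases k) auto
qed simp

lemma interleave_update:
  "length us = length vs \<Longrightarrow> k < length vs \<Longrightarrow>
    (interleave us vs)[2 * k + 1 := v] = interleave us (vs[k := v])"
proof (induction us vs arbitrary: k rule: list_induct2)
  case (Cons u us v vs)
  then show ?case by (cases k) auto
qed simp

text \<open>The pairs are unshuffled from the right: the last \<open>u\<close> is moved across all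
  earlier \<open>v\<close>s, which costs one sign each, so the exponent is
  \<open>0 + 1 + ... + (n - 1)\<close>. The tail \<open>ws\<close> is general because it collects
  the pairs already treated.\<close>

lemma pf_list_interleave:
  assumes "length us = length vs" "even (length ws)"
  shows "pf_list A (interleave us vs @ ws) = (-1) ^ (\<Sum>{..<length vs}) * pf_list A (us @ vs @ ws)"
  using assms
proof (induction us arbitrary: vs ws rule: rev_induct)
  case (snoc u us)
  then obtain vs' v where vs: "vs = vs' @ [v]" and len: "length us = length vs'"
    by (cases vs rule: rev_cases) auto
  have "pf_list A (interleave (us @ [u]) vs @ ws) = pf_list A (interleave us vs' @ u # v # ws)"
    unfolding vs by (simp add: interleave_append[OF len])
  also have "\<dots> = (-1) ^ (\<Sum>{..<length vs'}) * pf_list A (us @ vs' @ u # v # ws)"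
    by (rule snoc.IH[OF len]) (use snoc.prems in simp)
  also have "pf_list A (us @ u # vs' @ v # ws) = (-1) ^ length vs' * pf_list A (us @ vs' @ u # v # ws)"
    by (rule pf_list_move) (use snoc.prems len in simp)
  then have "pf_list A (us @ vs' @ u # v # ws) = (-1) ^ length vs' * pf_list A (us @ u # vs' @ v # ws)"
    by (simp add: power_add[symmetric] mult.assoc[symmetric] del: power_add)
  finally show ?case by (simp add: vs power_add)
qed simp

lemma pf_list_interleave_flip:
  assumes "length as = length bs" "even (length us)"
  shows "pf_list A (us @ interleave as bs) = (-1) ^ length bs * pf_list A (us @ interleave bs as)"
  using assms
proof (induction as bs arbitrary: us rule: list_induct2)
  case (Cons a as b bs)
  have "pf_list A (us @ a # b # interleave as bs) = - pf_list A (us @ b # a # interleave as bs)"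
    by (rule pf_list_swap_adjacent) (use Cons in simp)
  then show ?case using Cons.IH[of "us @ [b, a]"] Cons.prems by simp
qed simp

section \<open>Vandermonde products and Cauchy determinants\<close>

definition vandermonde :: "nat \<Rightarrow> (nat \<Rightarrow> complex) \<Rightarrow> complex" where
  "vandermonde n y = (\<Prod>j<n. \<Prod>i<j. y j - y i)"

text \<open>The value of \<open>det (1 / (x i - y j))\<close>, \<open>i, j < n\<close>.\<close>

definition cauchy :: "nat \<Rightarrow> (nat \<Rightarrow> complex) \<Rightarrow> (nat \<Rightarrow> complex) \<Rightarrow> complex" where
  "cauchy n x y = (-1) ^ (\<Sum>{..<n}) * vandermonde n x * vandermonde n y / (\<Prod>i<n. \<Prod>j<n. x i - y j)"

lemma vandermonde_cong: "(\<And>i. i < n \<Longrightarrow> y i = z i) \<Longrightarrow> vandermonde n y = vandermonde n z"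
  unfolding vandermonde_def by (intro prod.cong refl) auto

lemma cauchy_cong:
  "(\<And>i. i < n \<Longrightarrow> x i = x' i) \<Longrightarrow> (\<And>i. i < n \<Longrightarrow> y i = y' i) \<Longrightarrow> cauchy n x y = cauchy n x' y'"
  unfolding cauchy_def using vandermonde_cong[of n x x'] vandermonde_cong[of n y y'] by simp

lemma vandermonde_Suc_shift:
  "vandermonde (Suc n) y = (\<Prod>i<n. y (Suc i) - y 0) * vandermonde n (\<lambda>i. y (Suc i))"
  unfolding vandermonde_def
  by (subst prod.lessThan_Suc_shift) (simp add: prod.lessThan_Suc_shift prod.distrib del: prod.lessThan_Suc)

text \<open>Only the factors containing the index \<open>k\<close> change, and those on both sides
  carry the same sign. In the cross-multiplied form the identity also covers coinciding
  nodes.\<close>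

lemma vandermonde_update:
  assumes "k < n"
  shows "vandermonde n (y(k := t)) * (\<Prod>j\<in>{..<n}-{k}. y k - y j) =
    vandermonde n y * (\<Prod>j\<in>{..<n}-{k}. t - y j)"
  using assms
proof (induction n)
  case (Suc n)
  have S: "vandermonde (Suc n) z = vandermonde n z * (\<Prod>i<n. z n - z i)" for z
    by (simp add: vandermonde_def)
  show ?case
  proof (cases "k = n")
    case True
    have "vandermonde n (y(n := t)) = vandermonde n y"
      by (rule vandermonde_cong) auto
    moreover have "{..<Suc n} - {n} = {..<n}" by auto
    moreover have "(\<Prod>i<n. (y(n := t)) n - (y(n := t)) i) = (\<Prod>i<n. t - y i)"
      by (intro prod.cong) auto
    ultimately show ?thesis unfolding True S by (simp del: fun_upd_apply)
  next
    case False
    then have k: "k < n" using Suc.prems by simp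
    have set: "{..<Suc n} - {k} = insert n ({..<n} - {k})" using k by auto
    have p1: "(\<Prod>i<n. (y(k := t)) n - (y(k := t)) i) = (y n - t) * (\<Prod>i\<in>{..<n}-{k}. y n - y i)"
      using False k by (subst prod.remove[of _ k]) (auto intro!: prod.cong)
    have p2: "(\<Prod>i<n. y n - y i) = (y n - y k) * (\<Prod>i\<in>{..<n}-{k}. y n - y i)"
      using k by (subst prod.remove[of _ k]) auto
    have "vandermonde (Suc n) (y(k := t)) * (\<Prod>j\<in>{..<Suc n}-{k}. y k - y j) =
       (vandermonde n (y(k := t)) * (\<Prod>j\<in>{..<n}-{k}. y k - y j)) * (y n - t) * (y k - y n) * (\<Prod>i\<in>{..<n}-{k}. y n - y i)"
      unfolding S p1 set by simp
    also have "\<dots> = vandermonde (Suc n) y * (\<Prod>j\<in>{..<Suc n}-{k}. t - y j)"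
      unfolding Suc.IH[OF k] S p2 set by (simp add: algebra_simps)
    finally show ?thesis .
  qed
qed simp

lemma cauchy_update:
  assumes k: "k < n"
    and ne: "\<And>i j. i < n \<Longrightarrow> j < n \<Longrightarrow> x i \<noteq> y j" and net: "\<And>i. i < n \<Longrightarrow> x i \<noteq> t"
  shows "cauchy n x (y(k := t)) * (\<Prod>i<n. x i - t) * (\<Prod>j\<in>{..<n}-{k}. y k - y j) =
    cauchy n x y * (\<Prod>i<n. x i - y k) * (\<Prod>j\<in>{..<n}-{k}. t - y j)"
proof -
  let ?R = "\<Prod>i<n. \<Prod>j\<in>{..<n}-{k}. x i - y j"
  have d1: "(\<Prod>i<n. \<Prod>j<n. x i - (y(k := t)) j) = (\<Prod>i<n. x i - t) * ?R"
  proof -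
    have "(\<Prod>j<n. x i - (y(k := t)) j) = (x i - t) * (\<Prod>j\<in>{..<n}-{k}. x i - y j)" for i
      using k by (subst prod.remove[of _ k]) (auto intro!: prod.cong)
    then show ?thesis by (simp add: prod.distrib del: fun_upd_apply)
  qed
  have d2: "(\<Prod>i<n. \<Prod>j<n. x i - y j) = (\<Prod>i<n. x i - y k) * ?R"
  proof -
    have "(\<Prod>j<n. x i - y j) = (x i - y k) * (\<Prod>j\<in>{..<n}-{k}. x i - y j)" for i
      using k by (subst prod.remove[of _ k]) auto
    then show ?thesis by (simp add: prod.distrib)
  qed
  have nz: "?R \<noteq> 0" "(\<Prod>i<n. x i - t) \<noteq> 0" "(\<Prod>i<n. x i - y k) \<noteq> 0"
    using ne net k by auto
  have aux: "s * vx * v' / (T * R) * T * P = s * vx * v / (Y * R) * Y * P'"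
    if "v' * P = v * P'" "T \<noteq> 0" "R \<noteq> 0" "Y \<noteq> 0" for s vx v v' T R Y P P' :: complex
  proof -
    have "s * vx * v' / (T * R) * T * P = s * vx * (v' * P) / R" using that(2-4) by simp
    also have "\<dots> = s * vx * v / (Y * R) * Y * P'" unfolding that(1) using that(2-4) by simp
    finally show ?thesis .
  qed
  show ?thesis
    unfolding cauchy_def d1 d2 by (rule aux[OF vandermonde_update[OF k]]) (use nz in auto)
qed

text \<open>With \<open>F v = \<Prod> (v - x' i) / (v - y' i)\<close> both sides are multiples of
  \<open>F (x 0) / (F (y 0) (x 0 - y 0))\<close>; the sum on the right comes from the partial fractions of \<open>F\<close>.\<close>

lemma cauchy_expand:
  assumes ne: "\<And>i j. i < Suc n \<Longrightarrow> j < Suc n \<Longrightarrow> x i \<noteq> y j" and inj: "inj_on y {..<Suc n}"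
  defines "x' \<equiv> \<lambda>i. x (Suc i)" and "y' \<equiv> \<lambda>i. y (Suc i)"
  shows "cauchy (Suc n) x y =
    cauchy n x' y' / (x 0 - y 0) - (\<Sum>k<n. cauchy n x' (y'(k := y 0)) / (x 0 - y' k))"
proof -
  define C where "C = cauchy n x' y'"
  define F where "F = (\<lambda>v. \<Prod>i<n. (v - x' i) / (v - y' i))"
  define c where "c = (\<lambda>k. (y' k - x' k) * (\<Prod>j\<in>{..<n}-{k}. (y' k - x' j) / (y' k - y' j)))"
  have inj': "inj_on y' {..<n}"
    using inj by (auto simp: inj_on_def y'_def)
  have y0: "y 0 \<noteq> y' k" if "k < n" for k
    using inj that by (auto simp: inj_on_def y'_def)
  have ne': "x 0 \<noteq> y 0" "\<And>k. k < n \<Longrightarrow> x 0 \<noteq> y' k" "\<And>i. i < n \<Longrightarrow> x' i \<noteq> y 0"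
      "\<And>i k. i < n \<Longrightarrow> k < n \<Longrightarrow> x' i \<noteq> y' k"
    using ne by (auto simp: x'_def y'_def)
  have Fy: "F (y 0) = 1 + (\<Sum>k<n. c k / (y 0 - y' k))"
    unfolding F_def c_def by (rule partial_fractions) (use inj' y0 in auto)
  have Fx: "F (x 0) = 1 + (\<Sum>k<n. c k / (x 0 - y' k))"
    unfolding F_def c_def by (rule partial_fractions) (use inj' ne' in auto)
  have Fy0: "F (y 0) \<noteq> 0"
    unfolding F_def using ne' y0 by (auto simp: eq_commute[of "y 0"])
  have lhs: "cauchy (Suc n) x y = C * F (x 0) / (F (y 0) * (x 0 - y 0))"
  proof -
    have vx: "vandermonde (Suc n) x = (-1) ^ n * (\<Prod>i<n. x 0 - x' i) * vandermonde n x'"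
    proof -
      have "(\<Prod>i<n. x (Suc i) - x 0) = (\<Prod>i<n. (-1) * (x 0 - x' i))"
        by (intro prod.cong) (auto simp: x'_def)
      then show ?thesis unfolding vandermonde_Suc_shift x'_def prod.distrib by simp
    qed
    have vy: "vandermonde (Suc n) y = (-1) ^ n * (\<Prod>i<n. y 0 - y' i) * vandermonde n y'"
    proof -
      have "(\<Prod>i<n. y (Suc i) - y 0) = (\<Prod>i<n. (-1) * (y 0 - y' i))"
        by (intro prod.cong) (auto simp: y'_def)
      then show ?thesis unfolding vandermonde_Suc_shift y'_def prod.distrib by simp
    qed
    have d: "(\<Prod>i<Suc n. \<Prod>j<Suc n. x i - y j) =
       (x 0 - y 0) * (\<Prod>j<n. x 0 - y' j) * ((-1) ^ n * (\<Prod>i<n. y 0 - x' i)) * (\<Prod>i<n. \<Prod>j<n. x' i - y' j)"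
    proof -
      have "(\<Prod>i<n. x' i - y 0) = (\<Prod>i<n. (-1) * (y 0 - x' i))" by simp
      then have "(\<Prod>i<n. x' i - y 0) = (-1) ^ n * (\<Prod>i<n. y 0 - x' i)" unfolding prod.distrib by simp
      then show ?thesis
        by (simp add: prod.lessThan_Suc_shift prod.distrib x'_def y'_def del: prod.lessThan_Suc)
    qed
    have Fq: "F v = (\<Prod>i<n. v - x' i) / (\<Prod>i<n. v - y' i)" for v
      by (simp add: F_def prod_dividef)
    have aux: "(s * e) * (e * a * vx) * (e * b * vy) / (z * p * (e * q) * R) = s * vx * vy / R * (a / p) / (q / b * z)"
      if "e * e = 1" "b \<noteq> 0" for s e a vx b vy z p q R :: complex
    proof -
      have e: "e \<noteq> 0" using that(1) by auto
      have "(s * e) * (e * a * vx) * (e * b * vy) / (z * p * (e * q) * R) =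
          (e * e) * (s * a * vx * b * vy) * e / (e * (z * p * q * R))" by (simp add: mult_ac)
      also have "\<dots> = (s * a * vx * b * vy) / (z * p * q * R)" using e that(1) by simp
      finally show ?thesis using that(2) by (simp add: mult_ac)
    qed
    show ?thesis
      unfolding C_def cauchy_def vx vy d Fq sum.lessThan_Suc power_add
      by (rule aux) (use y0 in \<open>auto simp: power_mult_distrib[symmetric]\<close>)
  qed
  \<comment> \<open>Moving the node \<open>y' k\<close> to \<open>y 0\<close> turns the Cauchy
    product \<open>C\<close> into \<open>C\<close> times the residue \<open>c k\<close> of
    \<open>F\<close> at \<open>y' k\<close>, up to an elementary denominator.\<close>
  have summand: "cauchy n x' (y'(k := y 0)) = C * c k / ((y 0 - y' k) * F (y 0))" if k: "k < n" for k
  proof -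
    have upd: "cauchy n x' (y'(k := y 0)) * (\<Prod>i<n. x' i - y 0) * (\<Prod>j\<in>{..<n}-{k}. y' k - y' j) =
      C * (\<Prod>i<n. x' i - y' k) * (\<Prod>j\<in>{..<n}-{k}. y 0 - y' j)"
      unfolding C_def by (rule cauchy_update[OF k]) (use ne' in auto)
    have r: "(\<Prod>j<n. f j) = f k * (\<Prod>j\<in>{..<n}-{k}. f j)" for f :: "nat \<Rightarrow> complex"
      using k by (subst prod.remove[of _ k]) auto
    have n1: "(\<Prod>i<n. x' i - y 0) = (-1) ^ n * (\<Prod>i<n. y 0 - x' i)"
      using prod.distrib[of "\<lambda>_. -1" "\<lambda>i. y 0 - x' i" "{..<n}"] by simp
    have n2: "(\<Prod>i<n. x' i - y' k) = (-1) ^ n * ((y' k - x' k) * (\<Prod>j\<in>{..<n}-{k}. y' k - x' j))"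
      using prod.distrib[of "\<lambda>_. -1" "\<lambda>i. y' k - x' i" "{..<n}"] unfolding r[of "\<lambda>i. y' k - x' i"] by simp
    have nz: "(\<Prod>i<n. y 0 - x' i) \<noteq> 0" "(\<Prod>j\<in>{..<n}-{k}. y' k - y' j) \<noteq> 0" "(\<Prod>j\<in>{..<n}-{k}. y 0 - y' j) \<noteq> 0" "y 0 - y' k \<noteq> 0"
      using ne' y0 k inj' by (auto simp: inj_on_def eq_commute[of "y 0"])
    have aux: "U = C * (a * (b / d)) / (g * (p / (g * q)))"
      if "U * (e * p) * d = C * (e * (a * b)) * q" "e \<noteq> 0" "p \<noteq> 0" "d \<noteq> 0" "q \<noteq> 0" "g \<noteq> 0" for U C a b d g p q e :: complex
      using that by (simp add: field_simps)
    show ?thesis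
      unfolding F_def c_def prod_dividef r[of "\<lambda>j. y 0 - y' j"]
      by (rule aux[OF upd[unfolded n1 n2]]) (use nz in auto)
  qed
  \<comment> \<open>The fraction \<open>1 / ((y 0 - y' k) * (x 0 - y' k))\<close> is the difference
    of its two simple fractions divided by \<open>x 0 - y 0\<close>. The sums over \<open>k\<close>
    are then the partial fraction sums of \<open>F (y 0)\<close> and \<open>F (x 0)\<close>.\<close>
  have "cauchy n x' y' / (x 0 - y 0) - (\<Sum>k<n. cauchy n x' (y'(k := y 0)) / (x 0 - y' k)) =
     C / (x 0 - y 0) - (\<Sum>k<n. C / (F (y 0) * (x 0 - y 0)) * (c k / (y 0 - y' k) - c k / (x 0 - y' k)))"
  proof -
    have "cauchy n x' (y'(k := y 0)) / (x 0 - y' k) =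
        C / (F (y 0) * (x 0 - y 0)) * (c k / (y 0 - y' k) - c k / (x 0 - y' k))" if k: "k < n" for k
    proof -
      have aux: "C * c / (p * F) / q = C / (F * z) * (c / p - c / q)"
        if "q - p = z" "p \<noteq> 0" "q \<noteq> 0" "F \<noteq> 0" "z \<noteq> 0" for C c p q F z :: complex
        using that(2-5) unfolding that(1)[symmetric] by (simp add: field_simps)
      show ?thesis
        unfolding summand[OF k] by (rule aux) (use ne' y0 k Fy0 in \<open>auto simp: eq_commute[of "y 0"]\<close>)
    qed
    then show ?thesis by (simp add: C_def)
  qed
  also have "\<dots> = C / (x 0 - y 0) - C / (F (y 0) * (x 0 - y 0)) * (F (y 0) - F (x 0))"
    unfolding sum_distrib_left[symmetric] sum_subtractf Fx Fy by simp
  also have "\<dots> = C * F (x 0) / (F (y 0) * (x 0 - y 0))"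
  proof -
    have "C / w - C / (f * w) * (f - g) = C * g / (f * w)" if "f \<noteq> 0" "w \<noteq> 0" for f g w
      using that by (simp add: field_simps)
    from this[of "F (y 0)" "x 0 - y 0"] show ?thesis using Fy0 ne'(1) by simp
  qed
  finally show ?thesis unfolding lhs by simp
qed

lemma sum_lessThan_double:
  fixes f :: "nat \<Rightarrow> 'a::comm_monoid_add"
  shows "(\<Sum>i<2*n. f i) = (\<Sum>k<n. f (2 * k)) + (\<Sum>k<n. f (2 * k + 1))"
  by (induction n) (auto simp: add_ac)

lemma prod_list_update:
  fixes f :: "'a \<Rightarrow> 'b::comm_monoid_mult"
  assumes "k < length vs"
  shows "prod_list (map f (vs[k := v])) * f (vs ! k) = prod_list (map f vs) * f v"
  using assms
proof (induction vs arbitrary: k)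
  case (Cons w vs)
  then show ?case by (cases k) (auto simp: ac_simps)
qed simp

text \<open>The expansion along \<open>u\<close> and \<open>cauchy_expand\<close> are the same
  recursion. In the interleaved list the even positions hold further \<open>u\<close>s, where the
  entry vanishes, and replacing position \<open>2 * k + 1\<close> by \<open>v\<close> replaces the
  node \<open>y' k\<close> by \<open>y 0\<close>.\<close>

lemma pf_list_cauchy:
  assumes "pf_skew A" "length us = length vs"
    and "\<And>u u'. u \<in> set us \<Longrightarrow> u' \<in> set us \<Longrightarrow> A u u' = 0"
    and "\<And>u v. u \<in> set us \<Longrightarrow> v \<in> set vs \<Longrightarrow> A u v = \<alpha> u * \<beta> v / (X u - Y v)"
    and "\<And>u v. u \<in> set us \<Longrightarrow> v \<in> set vs \<Longrightarrow> X u \<noteq> Y v"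
    and "distinct (map Y vs)"
  shows "pf_list A (interleave us vs) =
    prod_list (map \<alpha> us) * prod_list (map \<beta> vs) * cauchy (length vs) (\<lambda>i. X (us ! i)) (\<lambda>i. Y (vs ! i))"
  using assms(2-6)
proof (induction us arbitrary: vs)
  case Nil
  then show ?case by (simp add: cauchy_def vandermonde_def)
next
  case (Cons u us)
  then obtain v vs' where vs: "vs = v # vs'" and len: "length us = length vs'"
    by (cases vs) auto
  let ?zs = "interleave us vs'" and ?n = "length vs'"
  let ?a = "prod_list (map \<alpha> us)" and ?b = "prod_list (map \<beta> vs')"
  let ?x = "\<lambda>i. X ((u # us) ! i)" and ?y = "\<lambda>i. Y ((v # vs') ! i)"
  let ?x' = "\<lambda>i. ?x (Suc i)" and ?y' = "\<lambda>i. ?y (Suc i)"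
  note z = Cons.prems(2) and A = Cons.prems(3) and ne = Cons.prems(4) and dist = Cons.prems(5)
  have IH: "pf_list A (interleave us ws) = ?a * prod_list (map \<beta> ws) *
      cauchy ?n ?x' (\<lambda>i. Y (ws ! i))" if "length ws = ?n" "set ws \<subseteq> set vs" "distinct (map Y ws)" for ws
    using Cons.IH[of ws] that len z A ne by (auto simp: subset_iff)
  have IH1: "pf_list A ?zs = ?a * ?b * cauchy ?n ?x' ?y'"
    using IH[of vs'] dist vs by auto
  \<comment> \<open>The weight of \<open>vs' ! k\<close> may be 0, so it is kept as a factor on the
    left; in the expansion it is supplied by the entry of row \<open>u\<close> at
    \<open>vs' ! k\<close>.\<close>
  have IH2: "pf_list A (interleave us (vs'[k := v])) * \<beta> (vs' ! k) =
      ?a * ?b * \<beta> v * cauchy ?n ?x' (?y'(k := Y v))" if k: "k < ?n" for k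
  proof -
    have "distinct (map Y (vs'[k := v]))"
      unfolding map_update by (rule distinct_list_update) (use dist vs in auto)
    moreover have "set (vs'[k := v]) \<subseteq> set vs"
      using set_update_subset_insert[of vs' k v] vs by auto
    ultimately have "pf_list A (interleave us (vs'[k := v])) = ?a * prod_list (map \<beta> (vs'[k := v])) *
      cauchy ?n ?x' (\<lambda>i. Y (vs'[k := v] ! i))" by (intro IH) auto
    also have "cauchy ?n ?x' (\<lambda>i. Y (vs'[k := v] ! i)) = cauchy ?n ?x' (?y'(k := Y v))"
      by (rule cauchy_cong) (auto simp: nth_list_update)
    finally show ?thesis
      using prod_list_update[OF k, of \<beta> v] by (simp add: mult_ac)
  qed
  have zero: "(\<Sum>k<?n. A u (?zs ! (2 * k)) * pf_list A (?zs[2 * k := v])) = 0"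
    using nth_interleave[OF len] z len by (intro sum.neutral) auto
  have one: "(\<Sum>k<?n. A u (?zs ! (2 * k + 1)) * pf_list A (?zs[2 * k + 1 := v])) =
    (\<Sum>k<?n. \<alpha> u * (?a * ?b * \<beta> v) * (cauchy ?n ?x' (?y'(k := ?y 0)) / (?x 0 - ?y' k)))"
  proof (intro sum.cong refl)
    fix k assume "k \<in> {..<?n}"
    then have k: "k < ?n" by simp
    have "A u (?zs ! (2 * k + 1)) = \<alpha> u * \<beta> (vs' ! k) / (X u - Y (vs' ! k))"
      using nth_interleave[OF len k] A[of u "vs' ! k"] k vs by simp
    then have "A u (?zs ! (2 * k + 1)) * pf_list A (?zs[2 * k + 1 := v]) =
        \<alpha> u * (pf_list A (interleave us (vs'[k := v])) * \<beta> (vs' ! k)) / (X u - Y (vs' ! k))"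
      unfolding interleave_update[OF len k] by simp
    then show "A u (?zs ! (2 * k + 1)) * pf_list A (?zs[2 * k + 1 := v]) =
        \<alpha> u * (?a * ?b * \<beta> v) * (cauchy ?n ?x' (?y'(k := ?y 0)) / (?x 0 - ?y' k))"
      unfolding IH2[OF k] by simp
  qed
  have cx: "cauchy (Suc ?n) ?x ?y = cauchy ?n ?x' ?y' / (?x 0 - ?y 0) -
      (\<Sum>k<?n. cauchy ?n ?x' (?y'(k := ?y 0)) / (?x 0 - ?y' k))"
  proof (rule cauchy_expand)
    show "?x i \<noteq> ?y j" if "i < Suc ?n" "j < Suc ?n" for i j
      using ne[of "(u # us) ! i" "(v # vs') ! j"] nth_mem[of i "u # us"] nth_mem[of j "v # vs'"] that len vs
      by simp
    show "inj_on ?y {..<Suc ?n}"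
      using dist vs by (auto simp: inj_on_def distinct_conv_nth nth_map simp del: distinct.simps list.map)
  qed
  have "pf_list A (interleave (u # us) vs) = A u v * pf_list A ?zs -
      (\<Sum>i<2 * ?n. A u (?zs ! i) * pf_list A (?zs[i := v]))"
    using pf_list_expand[OF assms(1), of ?zs u v] len vs by simp
  also have "\<dots> = \<alpha> u * (?a * ?b * \<beta> v) * cauchy (Suc ?n) ?x ?y"
    unfolding sum_lessThan_double zero one cx sum_distrib_left[symmetric] IH1
    using A[of u v] vs by (simp add: algebra_simps)
  finally show ?case using vs by (simp add: mult_ac)
qed

section \<open>Pfaffian minors of the matrix \<open>L\<^sub>h\<close>\<close>

text \<open>The index \<open>(x, False)\<close> stands for \<open>x'\<close> and \<open>(x, True)\<close> for \<open>x''\<close>.\<close>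

fun entry :: "real block_matrix \<Rightarrow> real \<times> bool \<Rightarrow> real \<times> bool \<Rightarrow> complex" where
  "entry L (x, b) (y, c) = L x y $ (if b then 2 else 1) $ (if c then 2 else 1)"

declare entry.simps [simp del]

definition doubled :: "'a list \<Rightarrow> ('a \<times> bool) list" where
  "doubled xs = interleave (map (\<lambda>x. (x, False)) xs) (map (\<lambda>x. (x, True)) xs)"

lemma doubled_simps [simp]:
  "doubled [] = []" "doubled (x # xs) = (x, False) # (x, True) # doubled xs"
  "length (doubled xs) = 2 * length xs" "set (doubled xs) = set xs \<times> UNIV"
  by (auto simp: doubled_def set_interleave UNIV_bool)

lemma doubled_append: "doubled (xs @ ys) = doubled xs @ doubled ys"
  by (simp add: doubled_def interleave_append)

lemma nth_doubled: "a < 2 * length xs \<Longrightarrow> doubled xs ! a = (xs ! (a div 2), odd a)"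
proof (induction xs arbitrary: a)
  case (Cons x xs)
  consider "a = 0" | "a = 1" | b where "a = Suc (Suc b)"
    by (metis One_nat_def not0_implies_Suc)
  then show ?case using Cons by cases auto
qed simp

lemma Pf_minor_pf_list: "Pf_minor L X = pf_list (entry L) (doubled (sorted_list_of_set X))"
  unfolding Pf_minor_def Let_def pf_list_def
  by (simp, intro pfaffian_cong) (simp add: nth_doubled entry.simps)

section \<open>Half-integers, parities and the entries of the matrix\<close>

lemma half_ints_cases:
  assumes "x \<in> half_ints"
  obtains "x < 0" | "x = 1/2" | "x \<ge> 3/2"
proof -
  obtain k :: int where k: "x = of_int k + 1/2" using assms by (auto simp: half_ints_def)
  consider "k \<le> -1" | "k = 0" | "k \<ge> 1" by linarith
  then show ?thesis using that k by cases auto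
qed

lemma half_ints_parity:
  assumes "x \<in> half_ints"
  shows "odd_pt x \<longleftrightarrow> \<not> even_pt x"
proof -
  obtain k :: int where k: "x = of_int k + 1/2" using assms by (auto simp: half_ints_def)
  obtain n :: nat where n: "\<bar>x\<bar> = real n + 1/2"
  proof (cases "k \<ge> 0")
    case True
    then show ?thesis using k that[of "nat k"] by auto
  next
    case False
    then show ?thesis using k that[of "nat (- k - 1)"] by auto
  qed
  have o: "odd_pt x \<longleftrightarrow> odd n"
  proof
    assume "odd_pt x"
    then obtain j :: nat where "\<bar>x\<bar> = 2 * real j + 3/2" by (auto simp: odd_pt_def)
    then have "real n = real (2 * j + 1)" using n by simp
    then have "n = 2 * j + 1" by (simp only: of_nat_eq_iff)
    then show "odd n" by simp
  next
    assume "odd n"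
    then obtain j where "n = 2 * j + 1" by (auto elim: oddE)
    then show "odd_pt x" using n by (auto simp: odd_pt_def intro!: exI[of _ j])
  qed
  have e: "even_pt x \<longleftrightarrow> even n"
  proof
    assume "even_pt x"
    then obtain j :: nat where "\<bar>x\<bar> = 2 * real j + 1/2" by (auto simp: even_pt_def)
    then have "real n = real (2 * j)" using n by simp
    then have "n = 2 * j" by (simp only: of_nat_eq_iff)
    then show "even n" by simp
  next
    assume "even n"
    then obtain j where "n = 2 * j" by (auto elim: evenE)
    then show "even_pt x" using n by (auto simp: even_pt_def intro!: exI[of _ j])
  qed
  show ?thesis using o e by simp
qed

lemma block_nth [simp]:
  "block a b c d $ 1 $ 1 = a" "block a b c d $ 1 $ 2 = b"
  "block a b c d $ 2 $ 1 = c" "block a b c d $ 2 $ 2 = d"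
  by (simp_all add: block_def)

lemma mat2_eqI:
  fixes M N :: "complex ^ 2 ^ 2"
  assumes "M $ 1 $ 1 = N $ 1 $ 1" "M $ 1 $ 2 = N $ 1 $ 2" "M $ 2 $ 1 = N $ 2 $ 1" "M $ 2 $ 2 = N $ 2 $ 2"
  shows "M = N"
  using assms by (simp add: vec_eq_iff forall_2)

lemma eps_skew: "eps y x = - eps x y"
  by (auto simp: eps_def)

lemma E_block_skew: "E_block x y = - Finite_Cartesian_Product.transpose (E_block y x)"
  by (rule mat2_eqI) (simp_all add: E_block_def Finite_Cartesian_Product.transpose_def eps_skew[of x y])

lemma transpose_uminus: "Finite_Cartesian_Product.transpose (- M) = - Finite_Cartesian_Product.transpose (M :: 'a::ring_1 ^ 'n ^ 'm)"
  by (simp add: vec_eq_iff Finite_Cartesian_Product.transpose_def)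

lemma eps_zero:
  "a < b \<Longrightarrow> \<not> odd_pt a \<Longrightarrow> eps a b = 0" "a < b \<Longrightarrow> \<not> even_pt b \<Longrightarrow> eps a b = 0"
  "a < b \<Longrightarrow> \<not> odd_pt a \<Longrightarrow> eps b a = 0" "a < b \<Longrightarrow> \<not> even_pt b \<Longrightarrow> eps b a = 0" "eps a a = 0"
  by (auto simp: eps_def)

lemma eps_odd: "a < b \<Longrightarrow> odd_pt a \<Longrightarrow> eps a b = (if even_pt b then 1 else 0)"
  by (simp add: eps_def)

lemma L_mat_skew: "L_mat h x y = - Finite_Cartesian_Product.transpose (L_mat h y x)"
proof (cases "x < 0"; cases "y < 0")
  assume "x < 0" "y < 0"
  then show ?thesis using E_block_skew[of x y] by (simp add: L_mat_def)
next
  have zero: "Finite_Cartesian_Product.transpose 0 = (0 :: complex ^ 2 ^ 2)"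
    by (simp add: vec_eq_iff Finite_Cartesian_Product.transpose_def)
  {
    assume "x < 0" "\<not> y < 0"
    then show ?thesis by (simp add: L_mat_def transpose_uminus zero)
  next
    assume "\<not> x < 0" "y < 0"
    then show ?thesis by (simp add: L_mat_def transpose_uminus zero)
  next
    assume "\<not> x < 0" "\<not> y < 0"
    then show ?thesis by (simp add: L_mat_def zero)
  }
qed

lemma skew_on_L_mat: "skew_on S (L_mat h)"
  unfolding skew_on_def using L_mat_skew by blast

lemma pf_skew_entry_L_mat: "pf_skew (entry (L_mat h))"
  unfolding pf_skew_def
proof (intro allI)
  fix p q :: "real \<times> bool"
  obtain x b y c where "p = (x, b)" "q = (y, c)" by fastforce
  then show "entry (L_mat h) p q = - entry (L_mat h) q p"
    using L_mat_skew[of h x y] by (simp add: entry.simps Finite_Cartesian_Product.transpose_def)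
qed

text \<open>The column of the Cauchy matrix to which an index \<open>(y, b)\<close> with \<open>y > 0\<close> belongs.\<close>

definition col_pt :: "real \<times> bool \<Rightarrow> real" where
  "col_pt p = (if snd p \<and> fst p \<noteq> 1/2 then fst p - 1 else fst p)"

text \<open>The first copies of the points below 1 couple only with each other, through
  \<open>eps\<close>. This is what makes the Pfaffian factor.\<close>

lemma entry_prime:
  assumes x: "x < 0 \<or> x = 1/2"
  shows "y < 0 \<or> y = 1/2 \<Longrightarrow> entry (L_mat h) (x, False) (y, False) = eps x y"
    and "y < 0 \<or> y = 1/2 \<or> y \<ge> 3/2 \<Longrightarrow> entry (L_mat h) (x, False) (y, True) = 0"
    and "y \<ge> 3/2 \<Longrightarrow> entry (L_mat h) (x, False) (y, b) = 0"
proof -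
  have pos: "L_mat h (1/2) y = 0" if "y > 0" for y using that by (simp add: L_mat_def)
  have neg: "L_mat h (1/2) y = - Finite_Cartesian_Product.transpose (A_block h y (1/2))" if "y < 0" for y
    using that by (simp add: L_mat_def)
  show "entry (L_mat h) (x, False) (y, False) = eps x y" if y: "y < 0 \<or> y = 1/2"
  proof (cases "x < 0")
    case True
    then show ?thesis using y by (auto simp: entry.simps L_mat_def E_block_def A_block_def)
  next
    case False
    then have x: "x = 1/2" using x by simp
    show ?thesis
      using y unfolding x by (auto simp: entry.simps pos neg A_block_def Finite_Cartesian_Product.transpose_def eps_skew[of "1/2" y])
         (simp add: eps_def)
  qed
  show "entry (L_mat h) (x, False) (y, True) = 0" if y: "y < 0 \<or> y = 1/2 \<or> y \<ge> 3/2"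
  proof (cases "x < 0")
    case True
    then show ?thesis using y by (auto simp: entry.simps L_mat_def E_block_def A_block_def B_block_def)
  next
    case False
    then have x: "x = 1/2" using x by simp
    show ?thesis
      using y unfolding x by (auto simp: entry.simps pos neg A_block_def Finite_Cartesian_Product.transpose_def)
  qed
  show "entry (L_mat h) (x, False) (y, b) = 0" if y: "y \<ge> 3/2"
  proof (cases "x < 0")
    case True
    then show ?thesis using y by (auto simp: entry.simps L_mat_def B_block_def)
  next
    case False
    then have x: "x = 1/2" using x by simp
    show ?thesis using y unfolding x by (auto simp: entry.simps pos)
  qed
qed

text \<open>Here the Cauchy matrix appears: a point \<open>y\<close> above 1 supplies the column
  \<open>y\<close> by its first copy and the column \<open>y - 1\<close> by its second. Of the point
  \<open>1/2\<close> only the second copy is a column; its first copy belongs to the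
  \<open>eps\<close> part.\<close>

lemma entry_second:
  assumes "x < 0"
  shows "y < 0 \<Longrightarrow> entry (L_mat h) (x, True) (y, True) = 0"
    and "y \<ge> 3/2 \<or> y = 1/2 \<and> b \<Longrightarrow> entry (L_mat h) (x, True) (y, b) =
      h x * h (col_pt (y, b)) / (of_real x - of_real (col_pt (y, b)))"
  using assms
  by (auto simp: entry.simps L_mat_def E_block_def A_block_def B_block_def col_pt_def)

lemma entry_positive:
  assumes "x > 0" "y > 0"
  shows "entry (L_mat h) (x, b) (y, c) = 0"
  using assms by (auto simp: entry.simps L_mat_def)

text \<open>The increasing lists of even length on which the Pfaffian of \<open>\<epsilon>\<close> is 1; on all others it is 0.\<close>

fun alternating :: "real list \<Rightarrow> bool" where
  "alternating [] \<longleftrightarrow> True"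
| "alternating [x] \<longleftrightarrow> False"
| "alternating (x # y # zs) \<longleftrightarrow> odd_pt x \<and> even_pt y \<and> alternating zs"

text \<open>The two smallest points \<open>x < y\<close> decide. If \<open>x\<close> is even, its
  row vanishes; if both are odd, their rows agree; if \<open>x\<close> is odd and \<open>y\<close>
  is even, the row of \<open>y\<close> vanishes on everything larger and the pair splits off with
  the factor 1.\<close>

lemma pf_list_strip_primes:
  assumes "sorted_wrt (<) zs" "\<And>x. x \<in> set zs \<Longrightarrow> x \<in> half_ints \<and> (x < 0 \<or> x = 1/2)"
    and "\<And>x w. x \<in> set zs \<Longrightarrow> w \<in> set ws \<Longrightarrow> entry (L_mat h) (x, False) w = 0"
    and "even (length zs + length ws)"
  shows "pf_list (entry (L_mat h)) (map (\<lambda>x. (x, False)) zs @ ws) =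
    (if alternating zs then pf_list (entry (L_mat h)) ws else 0)"
  using assms
proof (induction zs rule: alternating.induct)
  case (2 x)
  then show ?case using pf_list_zero_row_odd[where zs = ws and x = "(x, False)", OF pf_skew_entry_L_mat] by simp
next
  case (3 x y zs)
  let ?A = "entry (L_mat h)" and ?rest = "map (\<lambda>x. (x, False)) zs @ ws"
  have hx: "x \<in> half_ints" "x < 0 \<or> x = 1/2" and hy: "y \<in> half_ints" "y < 0 \<or> y = 1/2"
    and xy: "x < y" and gt: "\<And>z. z \<in> set zs \<Longrightarrow> y < z" "\<And>z. z \<in> set zs \<Longrightarrow> x < z"
    using "3.prems"(1,2) by auto
  have hz: "z < 0 \<or> z = 1/2" if "z \<in> set zs" for z using "3.prems"(2) that by auto
  have w: "?A (x, False) w = 0" "?A (y, False) w = 0" if "w \<in> set ws" for w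
    using "3.prems"(3) that by auto
  have ev: "even (length ?rest)" using "3.prems"(4) by simp
  have IH: "pf_list ?A ?rest = (if alternating zs then pf_list ?A ws else 0)"
    by (rule "3.IH") (use "3.prems" in auto)
  note prime = entry_prime(1)[OF hx(2)] entry_prime(1)[OF hy(2)]
  have list: "map (\<lambda>x. (x, False)) (x # y # zs) @ ws = (x, False) # (y, False) # ?rest" by simp
  consider "even_pt x" | "odd_pt x" "odd_pt y" | "odd_pt x" "even_pt y"
    using half_ints_parity[OF hx(1)] half_ints_parity[OF hy(1)] by blast
  then show ?case
  proof cases
    case 1
    then have nodd: "\<not> odd_pt x" using half_ints_parity[OF hx(1)] by blast
    have "pf_list ?A ((x, False) # (y, False) # ?rest) = 0"
    proof (rule pf_list_zero_row[OF pf_skew_entry_L_mat ev])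
      fix q assume "q \<in> set ((y, False) # ?rest)"
      then consider "q = (y, False)" | z where "z \<in> set zs" "q = (z, False)" | "q \<in> set ws" by auto
      then show "?A (x, False) q = 0"
      proof cases
        case 1
        then show ?thesis using nodd xy hy by (simp add: prime eps_zero)
      next
        case (2 z)
        then show ?thesis using nodd gt(2)[OF 2(1)] hz[OF 2(1)] by (simp add: prime eps_zero)
      qed (use w in simp)
    qed
    then show ?thesis using nodd unfolding list by simp
  next
    case 2
    then have neven: "\<not> even_pt x" "\<not> even_pt y" using half_ints_parity hx(1) hy(1) by auto
    have "pf_list ?A ((x, False) # (y, False) # ?rest) = 0"
    proof (rule pf_list_equal_rows[of _ 0 1])
      fix q assume "q \<in> set ((x, False) # (y, False) # ?rest)"
      then consider "q = (x, False)" | "q = (y, False)" | z where "z \<in> set zs" "q = (z, False)" | "q \<in> set ws" by auto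
      then show "?A (((x, False) # (y, False) # ?rest) ! 0) q = ?A (((x, False) # (y, False) # ?rest) ! 1) q"
      proof cases
        case 1
        then show ?thesis using neven xy hx by (simp add: prime eps_zero)
      next
        case 2
        then show ?thesis using neven xy hy by (simp add: prime eps_zero)
      next
        case (3 z)
        then show ?thesis using \<open>odd_pt x\<close> \<open>odd_pt y\<close> gt[OF 3(1)] hz[OF 3(1)] by (simp add: prime eps_odd)
      qed (use w in simp)
    qed (use ev pf_skew_entry_L_mat in auto)
    then show ?thesis using neven unfolding list by simp
  next
    case 3
    then have nodd: "\<not> odd_pt y" using half_ints_parity[OF hy(1)] by blast
    have "pf_list ?A ((x, False) # (y, False) # ?rest) = ?A (x, False) (y, False) * pf_list ?A ?rest"
    proof (rule pf_list_peel_pair[OF pf_skew_entry_L_mat ev])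
      fix q assume "q \<in> set ?rest"
      then consider z where "z \<in> set zs" "q = (z, False)" | "q \<in> set ws" by auto
      then show "?A (y, False) q = 0"
      proof cases
        case (1 z)
        then show ?thesis using nodd gt(1)[OF 1(1)] hz[OF 1(1)] by (simp add: prime eps_zero)
      qed (use w in simp)
    qed
    moreover have "?A (x, False) (y, False) = 1"
      using 3 xy hy by (simp add: prime(1) eps_odd)
    ultimately show ?thesis using 3 IH unfolding list by simp
  qed
qed simp

text \<open>Negative points couple only with columns. Unequal numbers leave no perfect matching, a
  repeated column gives two equal rows, and in the remaining case the Pfaffian is a Cauchy
  determinant up to the sign of the unshuffling.\<close>

lemma pf_list_bipartite:
  assumes "\<And>x. x \<in> set ns \<Longrightarrow> x < 0"
    and "\<And>y b. (y, b) \<in> set vs \<Longrightarrow> y \<ge> 3/2 \<or> y = 1/2 \<and> b"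
    and "even (length ns + length vs)"
  shows "length ns \<noteq> length vs \<or> \<not> distinct (map col_pt vs) \<Longrightarrow>
      pf_list (entry (L_mat h)) (map (\<lambda>x. (x, True)) ns @ vs) = 0"
    and "length ns = length vs \<Longrightarrow> distinct (map col_pt vs) \<Longrightarrow>
      pf_list (entry (L_mat h)) (map (\<lambda>x. (x, True)) ns @ vs) =
      (-1) ^ (\<Sum>{..<length ns}) * (prod_list (map h ns) * prod_list (map (\<lambda>v. h (col_pt v)) vs) *
        cauchy (length ns) (\<lambda>i. of_real (ns ! i)) (\<lambda>i. of_real (col_pt (vs ! i))))"
proof -
  let ?A = "entry (L_mat h)" and ?us = "map (\<lambda>x. (x, True)) ns"
  have vpos: "fst v > 0" "col_pt v > 0" if "v \<in> set vs" for v
    using assms(2)[of "fst v" "snd v"] that by (auto simp: col_pt_def)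
  have uv: "?A (x, True) v = h x * h (col_pt v) / (of_real x - of_real (col_pt v))"
    if "x \<in> set ns" "v \<in> set vs" for x v
    using entry_second(2)[OF assms(1)[OF that(1)], of "fst v" "snd v" h] assms(2)[of "fst v" "snd v"] that
    by simp
  have uu: "?A (x, True) (y, True) = 0" if "x \<in> set ns" "y \<in> set ns" for x y
    using entry_second(1) assms(1) that by blast
  have vv: "?A v w = 0" if "v \<in> set vs" "w \<in> set vs" for v w
    using entry_positive[of "fst v" "fst w" h "snd v" "snd w"] vpos that by simp
  have unb: "pf_list ?A (?us @ vs) = 0" if ne: "length ns \<noteq> length vs"
  proof -
    let ?U = "\<lambda>p. fst p < (0::real)"
    \<comment> \<open>\<open>pf_list_unbalanced\<close> asks that all indices of the same kind be
      uncoupled, while \<open>entry\<close> couples first copies of negative points. Cutting the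
      entries off outside the list does not change the Pfaffian.\<close>
    let ?B = "\<lambda>p q. if p \<in> set (?us @ vs) \<and> q \<in> set (?us @ vs) then ?A p q else 0"
    have "pf_list ?A (?us @ vs) = pf_list ?B (?us @ vs)"
    proof (rule pf_list_cong)
      fix i j assume "i < length (?us @ vs)" "j < length (?us @ vs)"
      then have "(?us @ vs) ! i \<in> set (?us @ vs) \<and> (?us @ vs) ! j \<in> set (?us @ vs)"
        by (blast intro: nth_mem)
      then show "?A ((?us @ vs) ! i) ((?us @ vs) ! j) = ?B ((?us @ vs) ! i) ((?us @ vs) ! j)"
        by (rule if_P[symmetric])
    qed (rule refl)
    also have "\<dots> = 0"
    proof (rule pf_list_unbalanced[of _ _ ?U])
      show "pf_skew ?B" unfolding pf_skew_def
      proof (intro allI)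
        fix p q
        have "?A p q = - ?A q p" using pf_skew_entry_L_mat[of h] unfolding pf_skew_def by blast
        then show "?B p q = - ?B q p" by auto
      qed
      show "?B p q = 0" if "?U p = ?U q" for p q
      proof (cases "p \<in> set (?us @ vs) \<and> q \<in> set (?us @ vs)")
        case True
        moreover have "fst r < 0" if "r \<in> set ?us" for r using that assms(1) by auto
        moreover have "\<not> fst r < 0" if "r \<in> set vs" for r using vpos(1)[OF that] by simp
        ultimately have "(p \<in> set ?us \<and> q \<in> set ?us) \<or> (p \<in> set vs \<and> q \<in> set vs)"
          using that unfolding set_append by blast
        then have "?A p q = 0"
        proof (elim disjE conjE)
          assume "p \<in> set ?us" "q \<in> set ?us"
          then show ?thesis using uu by auto
        qed (rule vv)
        then show ?thesis by simp
      qed (simp only: if_False)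
      have un: "fst u < 0" if "u \<in> set ?us" for u using that assms(1) by auto
      have vn: "\<not> fst v < 0" if "v \<in> set vs" for v using vpos(1)[OF that] by simp
      have f: "filter ?U vs = []" "filter (\<lambda>p. \<not> ?U p) vs = vs" "filter ?U ?us = ?us" "filter (\<lambda>p. \<not> ?U p) ?us = []"
        unfolding filter_empty_conv filter_id_conv using vn un by blast+
      show "length (filter ?U (?us @ vs)) \<noteq> length (filter (\<lambda>p. \<not> ?U p) (?us @ vs))"
        unfolding filter_append f using ne by simp
    qed (use assms(3) in simp)
    finally show ?thesis .
  qed
  \<comment> \<open>Different indices can have the same column, for instance the first copy of
    \<open>y\<close> and the second copy of \<open>y + 1\<close>; \<open>entry\<close> then cannot
    distinguish them.\<close>
  have dup: "pf_list ?A (?us @ vs) = 0" if nd: "\<not> distinct (map col_pt vs)"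
  proof -
    obtain i j where ij: "i < length vs" "j < length vs" "i \<noteq> j" "col_pt (vs ! i) = col_pt (vs ! j)"
      using nd by (auto simp: distinct_conv_nth)
    show ?thesis
    proof (rule pf_list_equal_rows[of _ "length ?us + i" "length ?us + j"])
      fix q assume "q \<in> set (?us @ vs)"
      then consider x where "x \<in> set ns" "q = (x, True)" | "q \<in> set vs" by auto
      then have "?A (vs ! i) q = ?A (vs ! j) q"
      proof cases
        case 1
        then have "?A q (vs ! i) = ?A q (vs ! j)" using ij by (simp add: uv)
        then show ?thesis using pf_skew_entry_L_mat[of h] unfolding pf_skew_def by metis
      next
        case 2
        then show ?thesis using vv ij by simp
      qed
      then show "?A ((?us @ vs) ! (length ?us + i)) q = ?A ((?us @ vs) ! (length ?us + j)) q"
        by (simp only: nth_append_length_plus)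
    qed (use ij assms(3) pf_skew_entry_L_mat in auto)
  qed
  show "length ns \<noteq> length vs \<or> \<not> distinct (map col_pt vs) \<Longrightarrow> pf_list ?A (?us @ vs) = 0"
    using unb dup by blast
  show "pf_list ?A (?us @ vs) = (-1) ^ (\<Sum>{..<length ns}) * (prod_list (map h ns) *
      prod_list (map (\<lambda>v. h (col_pt v)) vs) *
        cauchy (length ns) (\<lambda>i. of_real (ns ! i)) (\<lambda>i. of_real (col_pt (vs ! i))))"
    if len: "length ns = length vs" and dist: "distinct (map col_pt vs)"
  proof -
    have "pf_list ?A (interleave ?us vs) = prod_list (map (\<lambda>u. h (fst u)) ?us) * prod_list (map (\<lambda>v. h (col_pt v)) vs) *
        cauchy (length vs) (\<lambda>i. of_real (fst (?us ! i))) (\<lambda>i. of_real (col_pt (vs ! i)))"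
    proof (rule pf_list_cauchy[OF pf_skew_entry_L_mat])
      show "distinct (map (\<lambda>v. complex_of_real (col_pt v)) vs)"
        using dist by (simp add: distinct_map inj_on_def)
      show "complex_of_real (fst u) \<noteq> complex_of_real (col_pt v)" if "u \<in> set ?us" "v \<in> set vs" for u v
      proof -
        have "fst u < 0" using that(1) assms(1) by auto
        then show ?thesis using vpos(2)[OF that(2)] by simp
      qed
    qed (use len uu uv in auto)
    also have "map (\<lambda>u. h (fst u)) ?us = map h ns" by simp
    also have "cauchy (length vs) (\<lambda>i. of_real (fst (?us ! i))) (\<lambda>i. of_real (col_pt (vs ! i))) =
        cauchy (length ns) (\<lambda>i. of_real (ns ! i)) (\<lambda>i. of_real (col_pt (vs ! i)))"
      unfolding len by (rule cauchy_cong) (use len in auto)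
    finally have C: "pf_list ?A (interleave ?us vs) = prod_list (map h ns) *
      prod_list (map (\<lambda>v. h (col_pt v)) vs) *
        cauchy (length ns) (\<lambda>i. of_real (ns ! i)) (\<lambda>i. of_real (col_pt (vs ! i)))" .
    have "pf_list ?A (interleave ?us vs) = (-1) ^ (\<Sum>{..<length ns}) * pf_list ?A (?us @ vs)"
      using pf_list_interleave[of ?us vs "[]" ?A] len by simp
    then have "(-1) ^ (\<Sum>{..<length ns}) * pf_list ?A (interleave ?us vs) = pf_list ?A (?us @ vs)"
      by (simp add: mult.assoc[symmetric] power_add[symmetric])
    then show ?thesis unfolding C by simp
  qed
qed

text \<open>The two copies of the points below 1 are unshuffled, and their first copies are stripped
  by the \<open>eps\<close> factor. The second copy of \<open>1/2\<close>, if present, stays behind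
  and joins the columns.\<close>

lemma pf_list_L_mat:
  assumes "sorted_wrt (<) (ns @ os)" "set (ns @ os @ ys) \<subseteq> half_ints"
    and ns: "\<And>x. x \<in> set ns \<Longrightarrow> x < 0" and os: "os = [] \<or> os = [1/2]" and ys: "\<And>y. y \<in> set ys \<Longrightarrow> y \<ge> 3/2"
  defines "vs \<equiv> map (\<lambda>x. (x, True)) os @ doubled ys"
  shows "pf_list (entry (L_mat h)) (doubled (ns @ os @ ys)) =
    (if alternating (ns @ os)
     then (-1) ^ (\<Sum>{..<length (ns @ os)}) * pf_list (entry (L_mat h)) (map (\<lambda>x. (x, True)) ns @ vs) else 0)"
proof -
  let ?A = "entry (L_mat h)" and ?zs = "ns @ os"
  have "pf_list ?A (doubled (?zs @ ys)) = (-1) ^ (\<Sum>{..<length ?zs}) *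
      pf_list ?A (map (\<lambda>x. (x, False)) ?zs @ map (\<lambda>x. (x, True)) ?zs @ doubled ys)"
    unfolding doubled_append[of ?zs]
    using pf_list_interleave[of "map (\<lambda>x. (x, False)) ?zs" "map (\<lambda>x. (x, True)) ?zs" "doubled ys" ?A]
    by (simp add: doubled_def[of ?zs] del: map_append)
  also have "pf_list ?A (map (\<lambda>x. (x, False)) ?zs @ map (\<lambda>x. (x, True)) ?zs @ doubled ys) =
    (if alternating ?zs then pf_list ?A (map (\<lambda>x. (x, True)) ?zs @ doubled ys) else 0)"
  proof (rule pf_list_strip_primes[OF assms(1)])
    show x: "x \<in> half_ints \<and> (x < 0 \<or> x = 1/2)" if "x \<in> set ?zs" for x
      using that assms(2) ns os by auto
    show "?A (x, False) w = 0" if "x \<in> set ?zs" "w \<in> set (map (\<lambda>x. (x, True)) ?zs @ doubled ys)" for x w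
    proof -
      have xs: "x < 0 \<or> x = 1/2" using x that by blast
      from that consider y where "y \<in> set ?zs" "w = (y, True)" | y b where "y \<in> set ys" "w = (y, b)" by auto
      then show ?thesis
      proof cases
        case (1 y)
        then show ?thesis using entry_prime(2)[OF xs, of y h] x[OF 1(1)] by blast
      next
        case (2 y b)
        then show ?thesis using entry_prime(3)[OF xs, of y h b] ys[OF 2(1)] by blast
      qed
    qed
  qed simp
  finally show ?thesis by (simp add: vs_def)
qed

section \<open>Hook products\<close>

lemma initial_segment:
  fixes S :: "nat set"
  assumes "finite S" "\<And>i j. j \<in> S \<Longrightarrow> i \<le> j \<Longrightarrow> i \<in> S"
  shows "S = {..<card S}"
proof (cases "S = {}")
  case False
  let ?M = "Max S"
  have "S = {..?M}"
  proof
    show "S \<subseteq> {..?M}" using assms(1) by auto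
    show "{..?M} \<subseteq> S" using assms(2)[OF Max_in[OF assms(1) False]] by auto
  qed
  then have "card S = Suc ?M" by (metis card_atMost)
  then show ?thesis using \<open>S = {..?M}\<close> by (simp add: lessThan_Suc_atMost)
qed simp

lemma nat_eq_by_less: "(\<And>k. k < a \<longleftrightarrow> k < b) \<Longrightarrow> a = (b::nat)"
  by (meson linorder_neqE_nat less_irrefl)

section \<open>Transposed and doubled diagrams\<close>

lemma row_len_antimono: "i \<le> j \<Longrightarrow> row_len \<mu> j \<le> row_len \<mu> i"
  using row_len[of \<mu>] by (auto dest: antimonoD)

lemma finite_row_len: "finite {i. j < row_len \<mu> i}"
proof -
  have "finite {i. row_len \<mu> i \<noteq> 0}" using row_len[of \<mu>] by simp
  then show ?thesis by (rule finite_subset[rotated]) auto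
qed

text \<open>Statements about column lengths follow from this equivalence by comparing which numbers
  lie below the two sides, as in \<open>nat_eq_by_less\<close>.\<close>

lemma less_transpose_young: "i < row_len (transpose_young \<mu>) j \<longleftrightarrow> j < row_len \<mu> i"
proof -
  have "{i. j < row_len \<mu> i} = {..<card {i. j < row_len \<mu> i}}"
    by (rule initial_segment[OF finite_row_len]) (auto intro: less_le_trans row_len_antimono)
  moreover have "row_len (transpose_young \<mu>) j = card {i. j < row_len \<mu> i}"
    by (simp add: transpose_young.rep_eq)
  ultimately show ?thesis by (metis lessThan_iff mem_Collect_eq)
qed

lemma young_eqI: "(\<And>i. row_len \<mu> i = row_len \<kappa> i) \<Longrightarrow> \<mu> = \<kappa>"
  by (metis ext row_len_inject)

lemma transpose_transpose_young [simp]: "transpose_young (transpose_young \<mu>) = \<mu>"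
  by (intro young_eqI nat_eq_by_less) (simp add: less_transpose_young)

lemma row_len_double_rows: "row_len (double_rows \<mu>) i = row_len \<mu> (i div 2)"
  by (simp add: double_rows.rep_eq)

lemma row_len_transpose_double_rows:
  "row_len (transpose_young (double_rows \<mu>)) j = 2 * row_len (transpose_young \<mu>) j"
proof (rule nat_eq_by_less)
  fix k
  have "k < row_len (transpose_young (double_rows \<mu>)) j \<longleftrightarrow> k div 2 < row_len (transpose_young \<mu>) j"
    by (simp add: less_transpose_young row_len_double_rows)
  then show "k < row_len (transpose_young (double_rows \<mu>)) j \<longleftrightarrow> k < 2 * row_len (transpose_young \<mu>) j"
    by (simp add: less_mult_imp_div_less div_less_iff_less_mult mult.commute)
qed

lemma row_len_eventually_0: "\<exists>N. row_len \<mu> N = 0"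
proof -
  have "row_len \<mu> (row_len (transpose_young \<mu>) 0) = 0"
    by (metis less_irrefl less_transpose_young not_gr_zero)
  then show ?thesis ..
qed

lemma boxes_Sigma:
  assumes "row_len \<mu> N = 0"
  shows "boxes \<mu> = Sigma {..<N} (\<lambda>i. {..<row_len \<mu> i})"
proof -
  have "i < N" if "j < row_len \<mu> i" for i j
    using that assms row_len_antimono[of N i \<mu>] by (cases "i < N") auto
  then show ?thesis by (auto simp: boxes_def)
qed

lemma finite_boxes [simp]: "finite (boxes \<mu>)"
  using row_len_eventually_0[of \<mu>] by (auto simp: boxes_Sigma)

lemma prod_boxes:
  assumes "row_len \<mu> N = 0"
  shows "(\<Prod>(i, j)\<in>boxes \<mu>. f i j) = (\<Prod>i<N. \<Prod>j<row_len \<mu> i. f i j)"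
  unfolding boxes_Sigma[OF assms] by (subst prod.Sigma) auto

lemma boxes_transpose: "boxes (transpose_young \<mu>) = prod.swap ` boxes \<mu>"
  by (auto simp: boxes_def less_transpose_young image_iff)

lemma prod_boxes_transpose:
  "(\<Prod>(i, j)\<in>boxes \<mu>. f i j) = (\<Prod>(j, i)\<in>boxes (transpose_young \<mu>). f i j)"
  unfolding boxes_transpose by (subst prod.reindex) (auto simp: case_prod_unfold)

lemma num_boxes_transpose: "num_boxes (transpose_young \<mu>) = num_boxes \<mu>"
  unfolding num_boxes_def boxes_transpose by (rule card_image) simp

lemma num_boxes_sum: "row_len \<mu> N = 0 \<Longrightarrow> num_boxes \<mu> = (\<Sum>i<N. row_len \<mu> i)"
  unfolding num_boxes_def by (simp add: boxes_Sigma)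

lemma prod_lessThan_double:
  fixes f :: "nat \<Rightarrow> 'a::comm_monoid_mult"
  shows "(\<Prod>i<2*n. f i) = (\<Prod>k<n. f (2 * k) * f (2 * k + 1))"
  by (induction n) (auto simp: ac_simps)

lemma prod_boxes_double_rows:
  "(\<Prod>(r, c)\<in>boxes (double_rows \<mu>). f r c) = (\<Prod>(k, c)\<in>boxes \<mu>. f (2 * k) c * f (2 * k + 1) c)"
proof -
  obtain N where N: "row_len \<mu> N = 0" using row_len_eventually_0 by blast
  have N2: "row_len (double_rows \<mu>) (2 * N) = 0" using N by (simp add: row_len_double_rows)
  show ?thesis
    unfolding prod_boxes[OF N2] prod_boxes[OF N] prod_lessThan_double
    by (simp add: row_len_double_rows prod.distrib)
qed

definition hook_product :: "young \<Rightarrow> real" where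
  "hook_product \<mu> = (\<Prod>(i, j)\<in>boxes \<mu>.
     real (row_len \<mu> i) + real (row_len (transpose_young \<mu>) j) - real i - real j - 1)"

text \<open>A box with arm \<open>a\<close> and leg \<open>l\<close> contributes \<open>4 * (a + l/2
  + 1) * (a + l/2 + 1/2) = (2 * a + l + 2) * (2 * a + l + 1)\<close>. These are the hook lengths of
  the two boxes that replace it in the doubled transposed diagram.\<close>

lemma H_hook_H'_hook_half:
  "H_hook \<mu> (1/2) * H'_hook \<mu> (1/2) * 4 ^ num_boxes \<mu> = hook_product (double_rows (transpose_young \<mu>))"
proof -
  let ?a = "\<lambda>i j. (real (row_len \<mu> i) - real (j + 1)) +
    (real (row_len (transpose_young \<mu>) j) - real (i + 1)) * (1/2)"
  have four: "4 ^ num_boxes \<mu> = (\<Prod>(i, j)\<in>boxes \<mu>. 4::real)" by (simp add: num_boxes_def case_prod_unfold)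
  have "H_hook \<mu> (1/2) * H'_hook \<mu> (1/2) * 4 ^ num_boxes \<mu> =
      (\<Prod>(i, j)\<in>boxes \<mu>. (?a i j + 1) * (?a i j + 1/2) * 4)"
    unfolding H_hook_def H'_hook_def four prod.distrib[symmetric] by (rule prod.cong) auto
  also have "\<dots> = (\<Prod>(j, i)\<in>boxes (transpose_young \<mu>). (?a i j + 1) * (?a i j + 1/2) * 4)"
    by (rule prod_boxes_transpose)
  also have "\<dots> = hook_product (double_rows (transpose_young \<mu>))"
    unfolding hook_product_def prod_boxes_double_rows
    by (intro prod.cong refl)
       (auto simp: row_len_double_rows row_len_transpose_double_rows algebra_simps add_divide_distrib)
  finally show ?thesis .
qed

lemma prod_consecutive:
  "a \<le> b \<Longrightarrow> (\<Prod>j\<in>{a..<b}. real b - real j + real s) * fact s = fact (b - a + s)"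
proof (induction a rule: inc_induct)
  case (step a)
  have "{a..<b} = insert a {Suc a..<b}" using step.hyps by auto
  moreover have "b - a + s = Suc (b - Suc a + s)" using step.hyps by simp
  ultimately show ?case using step by (simp add: mult.assoc of_nat_diff)
qed simp

text \<open>The hooks of row \<open>i\<close> to the right of column \<open>D\<close> and the differences of the shifted row lengths
  \<open>l\<^sub>i - l\<^sub>k\<close>, \<open>i < k < N\<close>, together exhaust \<open>{1..l\<^sub>i}\<close>.\<close>

lemma row_hooks:
  assumes "\<And>k. k < N \<Longrightarrow> D \<le> row_len \<mu> k" "row_len \<mu> N \<le> D" "i < N"
  shows "(\<Prod>j\<in>{D..<row_len \<mu> i}. real (row_len \<mu> i) + real (row_len (transpose_young \<mu>) j) - real i - real j - 1) *
    (\<Prod>k\<in>{i<..<N}. real (row_len \<mu> i) - real (row_len \<mu> k) + real k - real i) =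
    fact (row_len \<mu> i - D + (N - 1 - i))"
proof -
  let ?p = "row_len \<mu>"
  let ?h = "\<lambda>j. real (?p i) + real (row_len (transpose_young \<mu>) j) - real i - real j - 1"
  let ?d = "\<lambda>k. real (?p i) - real (?p k) + real k - real i"
  \<comment> \<open>Between the ends of rows \<open>Suc K\<close> and \<open>K\<close> all columns
    have length \<open>Suc K\<close>, so the hook lengths of row \<open>i\<close> run through
    consecutive integers there.\<close>
  have col: "row_len (transpose_young \<mu>) j = Suc K" if "?p (Suc K) \<le> j" "j < ?p K" for j K
  proof -
    have "K < row_len (transpose_young \<mu>) j" "\<not> Suc K < row_len (transpose_young \<mu>) j"
      using that by (auto simp: less_transpose_young)
    then show ?thesis by simp
  qed
  \<comment> \<open>Induction over the rows below \<open>i\<close>. Passing from \<open>K\<close> to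
    \<open>Suc K\<close> adds the hooks of one block of columns of equal length, and the single
    integer skipped between two blocks is the difference \<open>?d K\<close>.\<close>
  have "(\<Prod>j\<in>{max D (?p K)..<?p i}. ?h j) * (\<Prod>k\<in>{i<..<K}. ?d k) = fact (?p i - max D (?p K) + (K - 1 - i))"
    if "Suc i \<le> K" "K \<le> N" for K
    using that
  proof (induction K rule: dec_induct)
    case base
    have "{i<..<Suc i} = {}" by auto
    moreover have "max D (?p (Suc i)) \<le> ?p i" using assms(1)[OF assms(3)] row_len_antimono[of i "Suc i" \<mu>] by simp
    moreover have "(\<Prod>j\<in>{max D (?p (Suc i))..<?p i}. ?h j) = (\<Prod>j\<in>{max D (?p (Suc i))..<?p i}. real (?p i) - real j + real 0)"
      by (intro prod.cong refl) (auto simp: col)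
    ultimately show ?case using prod_consecutive[of "max D (?p (Suc i))" "?p i" 0] by simp
  next
    case (step K)
    let ?lo = "max D (?p (Suc K))" and ?s = "?p i - ?p K + (K - i)"
    have K: "D \<le> ?p K" "?p K \<le> ?p i" "i < K" "?lo \<le> ?p K"
      using step assms(1) row_len_antimono[of i K \<mu>] row_len_antimono[of K "Suc K" \<mu>] by auto
    have IH: "(\<Prod>j\<in>{?p K..<?p i}. ?h j) * (\<Prod>k\<in>{i<..<K}. ?d k) = fact (?p i - ?p K + (K - 1 - i))"
      using step.IH step.prems K(1) by simp
    have u: "{?lo..<?p i} = {?lo..<?p K} \<union> {?p K..<?p i}" "{?lo..<?p K} \<inter> {?p K..<?p i} = {}"
      using K by auto
    have seg: "(\<Prod>j\<in>{?lo..<?p K}. ?h j) * fact ?s = fact (?p K - ?lo + ?s)"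
    proof -
      have "(\<Prod>j\<in>{?lo..<?p K}. ?h j) = (\<Prod>j\<in>{?lo..<?p K}. real (?p K) - real j + real ?s)"
        using K by (intro prod.cong refl) (auto simp: col of_nat_diff)
      then show ?thesis using prod_consecutive[OF K(4), of ?s] by simp
    qed
    have fs: "fact ?s = real ?s * fact (?p i - ?p K + (K - 1 - i))"
    proof -
      have "?s = Suc (?p i - ?p K + (K - 1 - i))" using K by simp
      then show ?thesis by (metis fact_Suc)
    qed
    have ds: "?d K = real ?s" using K by (simp add: of_nat_diff)
    have i2: "{i<..<Suc K} = insert K {i<..<K}" using K by auto
    have "(\<Prod>j\<in>{?lo..<?p i}. ?h j) * (\<Prod>k\<in>{i<..<Suc K}. ?d k) =
       (\<Prod>j\<in>{?lo..<?p K}. ?h j) * (?d K * ((\<Prod>j\<in>{?p K..<?p i}. ?h j) * (\<Prod>k\<in>{i<..<K}. ?d k)))"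
      unfolding u(1) i2 by (subst prod.union_disjoint) (use u(2) in auto)
    also have "\<dots> = fact (?p K - ?lo + ?s)"
      unfolding IH ds fs[symmetric] by (rule seg)
    also have "?p K - ?lo + ?s = ?p i - ?lo + (Suc K - 1 - i)"
      using K by simp
    finally show ?case .
  qed
  from this[of N] assms show ?thesis by (simp add: max_absorb1)
qed

text \<open>With \<open>D = 0\<close> and all rows, \<open>row_hooks\<close> yields the classical
  Frobenius-Young formula in the shifted row lengths.\<close>

lemma hook_product_rows:
  assumes "row_len \<mu> N = 0"
  shows "hook_product \<mu> * (\<Prod>i<N. \<Prod>k\<in>{i<..<N}. real (row_len \<mu> i) - real (row_len \<mu> k) + real k - real i) =
    (\<Prod>i<N. fact (row_len \<mu> i + (N - 1 - i)))"
  unfolding hook_product_def prod_boxes[OF assms] prod.distrib[symmetric]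
proof (intro prod.cong refl)
  fix i assume "i \<in> {..<N}"
  then show "(\<Prod>j<row_len \<mu> i. real (row_len \<mu> i) + real (row_len (transpose_young \<mu>) j) - real i - real j - 1) *
      (\<Prod>k\<in>{i<..<N}. real (row_len \<mu> i) - real (row_len \<mu> k) + real k - real i) =
      fact (row_len \<mu> i + (N - 1 - i))"
    using row_hooks[of N 0 \<mu> i] assms by (simp add: atLeast0LessThan)
qed

section \<open>The Durfee square and Frobenius coordinates\<close>

lemma less_diag_len: "i < diag_len \<mu> \<longleftrightarrow> i < row_len \<mu> i"
proof -
  have "{i. (i, i) \<in> boxes \<mu>} = {..<card {i. (i, i) \<in> boxes \<mu>}}"
  proof (rule initial_segment)
    have "{i. (i, i) \<in> boxes \<mu>} \<subseteq> {i. 0 < row_len \<mu> i}" by (auto simp: boxes_def)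
    then show "finite {i. (i, i) \<in> boxes \<mu>}" by (rule finite_subset[OF _ finite_row_len])
    show "i \<in> {i. (i, i) \<in> boxes \<mu>}" if "j \<in> {i. (i, i) \<in> boxes \<mu>}" "i \<le> j" for i j
      using that row_len_antimono[OF that(2), of \<mu>] by (auto simp: boxes_def)
  qed
  then show ?thesis by (metis (mono_tags, lifting) boxes_def case_prod_conv diag_len_def lessThan_iff mem_Collect_eq)
qed

lemma diag_len_transpose: "diag_len (transpose_young \<mu>) = diag_len \<mu>"
  by (rule nat_eq_by_less) (simp add: less_diag_len less_transpose_young)

lemma row_len_diag_len:
  "row_len \<mu> (diag_len \<mu>) \<le> diag_len \<mu>" "k < diag_len \<mu> \<Longrightarrow> diag_len \<mu> \<le> row_len \<mu> k"
proof -
  show "row_len \<mu> (diag_len \<mu>) \<le> diag_len \<mu>" using less_diag_len[of "diag_len \<mu>" \<mu>] by simp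
  assume k: "k < diag_len \<mu>"
  then have "diag_len \<mu> - 1 < row_len \<mu> (diag_len \<mu> - 1)" using less_diag_len[of "diag_len \<mu> - 1" \<mu>] by simp
  also have "\<dots> \<le> row_len \<mu> k" using k by (intro row_len_antimono) simp
  finally show "diag_len \<mu> \<le> row_len \<mu> k" by simp
qed

lemma row_len_frob_P: "i < diag_len \<mu> \<Longrightarrow> row_len \<mu> i = frob_P \<mu> i + i + 1"
  using less_diag_len[of i \<mu>] by (simp add: frob_P_def)

lemma row_len_frob_Q: "i < diag_len \<mu> \<Longrightarrow> row_len (transpose_young \<mu>) i = frob_Q \<mu> i + i + 1"
  using less_diag_len[of i "transpose_young \<mu>"] by (simp add: frob_Q_def diag_len_transpose)

lemma frob_Q_transpose: "frob_Q (transpose_young \<mu>) = frob_P \<mu>" "frob_P (transpose_young \<mu>) = frob_Q \<mu>"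
  by (auto simp: frob_P_def frob_Q_def)

text \<open>\<open>row_hooks\<close> with both \<open>D\<close> and \<open>N\<close> equal to the
  side of the Durfee square: the differences of shifted row lengths are then those of the
  coordinates \<open>P\<close>.\<close>

lemma prod_right_of_durfee:
  "(\<Prod>i<diag_len \<mu>. \<Prod>j\<in>{diag_len \<mu>..<row_len \<mu> i}.
      real (row_len \<mu> i) + real (row_len (transpose_young \<mu>) j) - real i - real j - 1) *
    (\<Prod>i<diag_len \<mu>. \<Prod>k\<in>{i<..<diag_len \<mu>}. real (frob_P \<mu> i) - real (frob_P \<mu> k)) =
    (\<Prod>i<diag_len \<mu>. fact (frob_P \<mu> i))"
  unfolding prod.distrib[symmetric]
proof (intro prod.cong refl)
  fix i assume "i \<in> {..<diag_len \<mu>}"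
  then have i: "i < diag_len \<mu>" by simp
  have e: "row_len \<mu> i - diag_len \<mu> + (diag_len \<mu> - 1 - i) = frob_P \<mu> i"
    using i row_len_diag_len(2)[OF i] by (simp add: frob_P_def)
  have "(\<Prod>k\<in>{i<..<diag_len \<mu>}. real (row_len \<mu> i) - real (row_len \<mu> k) + real k - real i) =
     (\<Prod>k\<in>{i<..<diag_len \<mu>}. real (frob_P \<mu> i) - real (frob_P \<mu> k))"
    using i by (intro prod.cong refl) (auto simp: row_len_frob_P)
  then show "(\<Prod>j\<in>{diag_len \<mu>..<row_len \<mu> i}.
      real (row_len \<mu> i) + real (row_len (transpose_young \<mu>) j) - real i - real j - 1) *
    (\<Prod>k\<in>{i<..<diag_len \<mu>}. real (frob_P \<mu> i) - real (frob_P \<mu> k)) = fact (frob_P \<mu> i)"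
    using row_hooks[of "diag_len \<mu>" "diag_len \<mu>" \<mu> i] row_len_diag_len(1)[of \<mu>] row_len_diag_len(2)[of _ \<mu>] i e by simp
qed

lemma prod_boxes_durfee:
  fixes f :: "nat \<Rightarrow> nat \<Rightarrow> 'a::comm_monoid_mult" and \<mu> :: young
  defines "D \<equiv> diag_len \<mu>"
  shows "(\<Prod>(i, j)\<in>boxes \<mu>. f i j) = (\<Prod>i<D. \<Prod>j<D. f i j) *
    (\<Prod>i<D. \<Prod>j\<in>{D..<row_len \<mu> i}. f i j) *
    (\<Prod>j<D. \<Prod>i\<in>{D..<row_len (transpose_young \<mu>) j}. f i j)"
proof -
  let ?S = "Sigma {..<D} (\<lambda>i. {..<row_len \<mu> i})"
  let ?T = "Sigma {..<D} (\<lambda>j. {D..<row_len (transpose_young \<mu>) j})"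
  have box: "j < D" if "j < row_len \<mu> i" "D \<le> i" for i j
    using that row_len_antimono[OF that(2), of \<mu>] row_len_diag_len(1)[of \<mu>] by (simp add: D_def)
  have un: "boxes \<mu> = ?S \<union> prod.swap ` ?T"
    by (auto simp: boxes_def less_transpose_young image_iff dest: box) (meson box not_less)
  have "?S \<inter> prod.swap ` ?T = {}" by auto
  then have "(\<Prod>(i, j)\<in>boxes \<mu>. f i j) = (\<Prod>(i, j)\<in>?S. f i j) * (\<Prod>(i, j)\<in>prod.swap ` ?T. f i j)"
    unfolding un by (intro prod.union_disjoint) auto
  also have "(\<Prod>(i, j)\<in>prod.swap ` ?T. f i j) = (\<Prod>(j, i)\<in>?T. f i j)"
    by (subst prod.reindex) (auto simp: case_prod_unfold)
  also have "\<dots> = (\<Prod>j<D. \<Prod>i\<in>{D..<row_len (transpose_young \<mu>) j}. f i j)"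
    by (subst prod.Sigma) auto
  also have "(\<Prod>(i, j)\<in>?S. f i j) = (\<Prod>i<D. \<Prod>j<row_len \<mu> i. f i j)"
    by (subst prod.Sigma) auto
  also have "\<dots> = (\<Prod>i<D. (\<Prod>j<D. f i j) * (\<Prod>j\<in>{D..<row_len \<mu> i}. f i j))"
  proof (intro prod.cong refl)
    fix i assume "i \<in> {..<D}"
    then have un: "{..<row_len \<mu> i} = {..<D} \<union> {D..<row_len \<mu> i}"
      using row_len_diag_len(2)[of i \<mu>] by (auto simp: D_def)
    show "(\<Prod>j<row_len \<mu> i. f i j) = (\<Prod>j<D. f i j) * (\<Prod>j\<in>{D..<row_len \<mu> i}. f i j)"
      unfolding un by (rule prod.union_disjoint) auto
  qed
  finally show ?thesis by (simp add: prod.distrib)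
qed

text \<open>A box \<open>(i, j)\<close> of the Durfee square has hook length
  \<open>P i + Q j + 1\<close>, the denominator of the Cauchy determinant. The parts to the right
  and below are exchanged by transposition and give the factorials over the differences.\<close>

lemma hook_product_frobenius:
  fixes \<mu> :: young
  defines "D \<equiv> diag_len \<mu>" and "P \<equiv> frob_P \<mu>" and "Q \<equiv> frob_Q \<mu>"
  shows "hook_product \<mu> * ((\<Prod>i<D. \<Prod>k\<in>{i<..<D}. real (P i) - real (P k)) * (\<Prod>i<D. \<Prod>k\<in>{i<..<D}. real (Q i) - real (Q k))) =
    (\<Prod>i<D. fact (P i)) * (\<Prod>i<D. fact (Q i)) * (\<Prod>i<D. \<Prod>j<D. real (P i) + real (Q j) + 1)"
proof -
  let ?h = "\<lambda>i j. real (row_len \<mu> i) + real (row_len (transpose_young \<mu>) j) - real i - real j - 1"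
  have square: "(\<Prod>i<D. \<Prod>j<D. ?h i j) = (\<Prod>i<D. \<Prod>j<D. real (P i) + real (Q j) + 1)"
    by (intro prod.cong refl) (auto simp: row_len_frob_P row_len_frob_Q D_def P_def Q_def)
  have right: "(\<Prod>i<D. \<Prod>j\<in>{D..<row_len \<mu> i}. ?h i j) * (\<Prod>i<D. \<Prod>k\<in>{i<..<D}. real (P i) - real (P k)) =
      (\<Prod>i<D. fact (P i))"
    unfolding D_def P_def by (rule prod_right_of_durfee)
  have "(\<Prod>j<D. \<Prod>i\<in>{D..<row_len (transpose_young \<mu>) j}. ?h i j) =
      (\<Prod>j<D. \<Prod>i\<in>{D..<row_len (transpose_young \<mu>) j}.
        real (row_len (transpose_young \<mu>) j) + real (row_len \<mu> i) - real j - real i - 1)"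
    by (intro prod.cong refl) simp
  then have below: "(\<Prod>j<D. \<Prod>i\<in>{D..<row_len (transpose_young \<mu>) j}. ?h i j) * (\<Prod>i<D. \<Prod>k\<in>{i<..<D}. real (Q i) - real (Q k)) =
      (\<Prod>i<D. fact (Q i))"
    using prod_right_of_durfee[of "transpose_young \<mu>"]
    by (simp only: D_def Q_def diag_len_transpose frob_Q_transpose transpose_transpose_young)
  show ?thesis
    unfolding hook_product_def prod_boxes_durfee D_def[symmetric] square
    unfolding right[symmetric] below[symmetric] by (simp only: mult_ac)
qed

lemma frob_strict:
  assumes "i < j" "j < diag_len \<mu>"
  shows "frob_P \<mu> j < frob_P \<mu> i" "frob_Q \<mu> j < frob_Q \<mu> i"
  using assms row_len_antimono[of i j \<mu>] row_len_antimono[of i j "transpose_young \<mu>"]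
    row_len_frob_P[of i \<mu>] row_len_frob_P[of j \<mu>] row_len_frob_Q[of i \<mu>] row_len_frob_Q[of j \<mu>]
  by auto

text \<open>The \<open>P\<close> fix the first \<open>D\<close> rows. All boxes below these lie in
  the first \<open>D\<close> columns, which the \<open>Q\<close> fix.\<close>

lemma frobenius_inject:
  assumes D: "diag_len \<mu> = diag_len \<kappa>"
    and P: "\<And>i. i < diag_len \<mu> \<Longrightarrow> frob_P \<mu> i = frob_P \<kappa> i"
    and Q: "\<And>i. i < diag_len \<mu> \<Longrightarrow> frob_Q \<mu> i = frob_Q \<kappa> i"
  shows "\<mu> = \<kappa>"
proof (intro young_eqI nat_eq_by_less)
  fix i j
  show "j < row_len \<mu> i \<longleftrightarrow> j < row_len \<kappa> i"
  proof (cases "i < diag_len \<mu>")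
    case True
    then show ?thesis using P[OF True] D by (simp add: row_len_frob_P)
  next
    case False
    have small: "j < diag_len \<tau>" if "j < row_len \<tau> i" "\<not> i < diag_len \<tau>" for \<tau>
      using that row_len_antimono[of "diag_len \<tau>" i \<tau>] row_len_diag_len(1)[of \<tau>] by simp
    show ?thesis
    proof (cases "j < diag_len \<mu>")
      case True
      then have "row_len (transpose_young \<mu>) j = row_len (transpose_young \<kappa>) j"
        using Q[OF True] D by (simp add: row_len_frob_Q)
      then show ?thesis by (metis less_transpose_young)
    next
      case jD: False
      then show ?thesis using small[of \<mu>] small[of \<kappa>] False D by auto
    qed
  qed
qed

text \<open>The Frobenius coordinates, numbered from 0, of the diagrams in which every row occurs twice.\<close>

definition doubled_frobenius :: "nat \<Rightarrow> (nat \<Rightarrow> nat) \<Rightarrow> (nat \<Rightarrow> nat) \<Rightarrow> bool" where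
  "doubled_frobenius D P Q \<longleftrightarrow>
    (\<forall>i j. i < j \<and> j < D \<longrightarrow> P j < P i) \<and> (\<forall>i j. i < j \<and> j < D \<longrightarrow> Q j < Q i) \<and>
    (\<forall>i<D. even (Q i) \<longleftrightarrow> odd i) \<and> (\<forall>i. even i \<and> i + 1 < D \<longrightarrow> P i = Suc (P (i + 1))) \<and>
    (odd D \<longrightarrow> P (D - 1) = 0)"

lemma doubled_frobeniusD:
  assumes "doubled_frobenius D P Q"
  shows "i < j \<Longrightarrow> j < D \<Longrightarrow> P j < P i" and "i < j \<Longrightarrow> j < D \<Longrightarrow> Q j < Q i"
    and "i < D \<Longrightarrow> even (Q i) \<longleftrightarrow> odd i"
    and "even i \<Longrightarrow> i + 1 < D \<Longrightarrow> P i = Suc (P (i + 1))" and "odd D \<Longrightarrow> P (D - 1) = 0"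
proof -
  note df = assms[unfolded doubled_frobenius_def]
  show "P j < P i" if "i < j" "j < D"
    using df[THEN conjunct1] that by blast
  show "Q j < Q i" if "i < j" "j < D"
    using df[THEN conjunct2, THEN conjunct1] that by blast
  show "even (Q i) \<longleftrightarrow> odd i" if "i < D"
    using df[THEN conjunct2, THEN conjunct2, THEN conjunct1] that by blast
  show "P i = Suc (P (i + 1))" if "even i" "i + 1 < D"
    using df[THEN conjunct2, THEN conjunct2, THEN conjunct2, THEN conjunct1] that by blast
  show "P (D - 1) = 0" if "odd D"
    using df[THEN conjunct2, THEN conjunct2, THEN conjunct2, THEN conjunct2] that by blast
qed

text \<open>The column lengths \<open>Q i + i + 1\<close> are even, and paired rows are equal. For
  odd \<open>D\<close> the rows \<open>D - 1\<close> and \<open>D\<close> form a pair; the second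
  has length at most \<open>D\<close>, so the first ends on the diagonal.\<close>

lemma doubled_frobenius_double_rows:
  "doubled_frobenius (diag_len (double_rows m)) (frob_P (double_rows m)) (frob_Q (double_rows m))"
proof -
  let ?\<nu> = "double_rows m"
  let ?D = "diag_len ?\<nu>"
  have "even (frob_Q ?\<nu> i) \<longleftrightarrow> odd i" if "i < ?D" for i
  proof -
    have "2 * row_len (transpose_young m) i = frob_Q ?\<nu> i + i + 1"
      using row_len_frob_Q[OF that] by (simp add: row_len_transpose_double_rows)
    then show ?thesis by presburger
  qed
  moreover have "frob_P ?\<nu> i = Suc (frob_P ?\<nu> (i + 1))" if "even i" "i + 1 < ?D" for i
  proof -
    have "row_len ?\<nu> i = row_len ?\<nu> (i + 1)" using that(1) by (simp add: row_len_double_rows)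
    then show ?thesis using row_len_frob_P[of i ?\<nu>] row_len_frob_P[of "i + 1" ?\<nu>] that by simp
  qed
  moreover have "frob_P ?\<nu> (?D - 1) = 0" if "odd ?D"
  proof -
    have D0: "?D - 1 < ?D" using that by (cases ?D) auto
    have "(?D - 1) div 2 = ?D div 2" using that by presburger
    then have "row_len ?\<nu> (?D - 1) = row_len ?\<nu> ?D" by (simp add: row_len_double_rows)
    then show ?thesis using row_len_diag_len(1)[of ?\<nu>] by (simp add: frob_P_def)
  qed
  ultimately show ?thesis
    unfolding doubled_frobenius_def using frob_strict[of _ _ ?\<nu>] by auto
qed

lemma strict_decreasing_plus:
  fixes Q :: "nat \<Rightarrow> nat"
  assumes "\<And>i j. i < j \<Longrightarrow> j < D \<Longrightarrow> Q j < Q i"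
  shows "i \<le> j \<Longrightarrow> j < D \<Longrightarrow> Q j + j \<le> Q i + i"
proof (induction j rule: dec_induct)
  case (step j)
  then show ?case using assms[of j "Suc j"] by simp
qed simp

text \<open>The first \<open>D\<close> rows are read off from \<open>P\<close>; each lower row
  counts the columns that reach it, whose lengths are given by \<open>Q\<close>. It remains to see
  that the rows of this diagram agree in pairs.\<close>

lemma doubled_frobenius_realized:
  assumes "doubled_frobenius D P Q"
  obtains m where "diag_len (double_rows m) = D"
    "\<And>i. i < D \<Longrightarrow> frob_P (double_rows m) i = P i" "\<And>i. i < D \<Longrightarrow> frob_Q (double_rows m) i = Q i"
proof -
  note Pdec = doubled_frobeniusD(1)[OF assms] and Qdec = doubled_frobeniusD(2)[OF assms]
    and Qpar = doubled_frobeniusD(3)[OF assms] and Ppair = doubled_frobeniusD(4)[OF assms]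
    and Plast = doubled_frobeniusD(5)[OF assms]
  define C where "C = (\<lambda>i. {c. c < D \<and> i < Q c + c + 1})"
  define f where "f = (\<lambda>i. if i < D then P i + i + 1 else card (C i))"
  have Pplus: "P j + j \<le> P i + i" if "i \<le> j" "j < D" for i j
    by (rule strict_decreasing_plus[OF _ that]) (rule Pdec)
  have Qplus: "Q j + j \<le> Q i + i" if "i \<le> j" "j < D" for i j
    by (rule strict_decreasing_plus[OF _ that]) (rule Qdec)
  have Pge: "D \<le> P i + i + 1" if "i < D" for i
  proof -
    have "i \<le> D - 1" "D - 1 < D" using that by auto
    from Pplus[OF this] show ?thesis by linarith
  qed
  have Qge: "D \<le> Q i + i + 1" if "i < D" for i
  proof -
    have "i \<le> D - 1" "D - 1 < D" using that by auto
    from Qplus[OF this] show ?thesis by linarith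
  qed
  have finC: "finite (C i)" for i by (rule finite_subset[of _ "{..<D}"]) (auto simp: C_def)
  have Cseg: "C i = {..<card (C i)}" for i
  proof (rule initial_segment[OF finC])
    show "c \<in> C i" if "d \<in> C i" "c \<le> d" for c d
      using that Qplus[of c d] by (auto simp: C_def)
  qed
  have Ccard: "c < card (C i) \<longleftrightarrow> c < D \<and> i < Q c + c + 1" for c i
    using Cseg[of i] by (metis (mono_tags, lifting) C_def lessThan_iff mem_Collect_eq)
  have CD: "card (C i) \<le> D" for i
    using card_mono[of "{..<D}" "C i"] by (auto simp: C_def)
  have fD: "f i \<ge> D" if "i < D" for i
    using Pge[OF that] that by (simp add: f_def)
  have anti: "antimono f"
  proof (rule antimonoI)
    fix i j :: nat assume ij: "i \<le> j"
    show "f j \<le> f i"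
    proof (cases "j < D")
      case True
      then show ?thesis using Pplus[OF ij True] ij by (simp add: f_def)
    next
      case jD: False
      show ?thesis
      proof (cases "i < D")
        case True
        have "f j \<le> D" using jD CD by (simp add: f_def)
        then show ?thesis using fD[OF True] by simp
      next
        case False
        have "C j \<subseteq> C i" using ij by (auto simp: C_def)
        then show ?thesis using False jD finC by (simp add: f_def card_mono)
      qed
    qed
  qed
  have zero: "f i = 0" if "i \<ge> D" "i \<ge> Q 0 + 1" for i
  proof -
    have "C i = {}" using that Qplus[of 0] by (fastforce simp: C_def)
    then show ?thesis using that by (simp add: f_def)
  qed
  have pair: "f (2 * k) = f (2 * k + 1)" for k
  proof -
    consider "2 * k + 1 < D" | "D = 2 * k + 1" | "D \<le> 2 * k" by linarith
    then show ?thesis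
    proof cases
      case 1
      then show ?thesis using Ppair[of "2 * k"] by (simp add: f_def)
    next
      case 2
      \<comment> \<open>This pair straddles the border of the Durfee square. The column length is at
        least \<open>D\<close> and even, while \<open>D\<close> is odd, so every column reaches the
        row below the square.\<close>
      have "D < Q c + c + 1" if c: "c < D" for c
      proof -
        have "D \<le> Q c + c + 1" by (rule Qge[OF c])
        moreover have "odd (Q c + c)" using Qpar[OF c] by simp
        ultimately show ?thesis using 2 by presburger
      qed
      then have "C D = {..<D}" by (auto simp: C_def)
      then show ?thesis using 2 Plast by (simp add: f_def)
    next
      case 3
      \<comment> \<open>The column length is even, so it cannot end between the rows
        \<open>2 * k\<close> and \<open>2 * k + 1\<close>.\<close>
      have "2 * k < Q c + c + 1 \<longleftrightarrow> 2 * k + 1 < Q c + c + 1" if c: "c < D" for c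
        using Qpar[OF c] by presburger
      then have "C (2 * k) = C (2 * k + 1)" by (auto simp: C_def)
      then show ?thesis using 3 by (simp add: f_def)
    qed
  qed
  have "antimono (\<lambda>k. f (2 * k)) \<and> finite {k. f (2 * k) \<noteq> 0}"
  proof
    show "antimono (\<lambda>k. f (2 * k))" using anti by (auto simp: antimono_def)
    have "{k. f (2 * k) \<noteq> 0} \<subseteq> {..max D (Q 0 + 1)}"
    proof
      fix k assume "k \<in> {k. f (2 * k) \<noteq> 0}"
      then have "\<not> (2 * k \<ge> D \<and> 2 * k \<ge> Q 0 + 1)" using zero[of "2 * k"] by auto
      then show "k \<in> {..max D (Q 0 + 1)}" by auto
    qed
    then show "finite {k. f (2 * k) \<noteq> 0}" by (rule finite_subset) simp
  qed
  then obtain m where m: "row_len m = (\<lambda>k. f (2 * k))"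
    using Abs_young_inverse[of "\<lambda>k. f (2 * k)"] by auto
  let ?\<nu> = "double_rows m"
  have rl: "row_len ?\<nu> i = f i" for i
  proof -
    have "i = 2 * (i div 2) \<or> i = 2 * (i div 2) + 1" by presburger
    then show ?thesis using pair[of "i div 2"] by (auto simp: row_len_double_rows m)
  qed
  have D: "diag_len ?\<nu> = D"
  proof (rule nat_eq_by_less)
    fix k
    show "k < diag_len ?\<nu> \<longleftrightarrow> k < D"
      unfolding less_diag_len rl using CD[of k] by (auto simp: f_def)
  qed
  have tr: "row_len (transpose_young ?\<nu>) j = Q j + j + 1" if j: "j < D" for j
  proof (rule nat_eq_by_less)
    fix i
    show "i < row_len (transpose_young ?\<nu>) j \<longleftrightarrow> i < Q j + j + 1"
    proof (cases "i < D")
      case True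
      then show ?thesis unfolding less_transpose_young rl
        using fD[OF True] j Qge[OF j] True by auto
    next
      case False
      then show ?thesis unfolding less_transpose_young rl using j by (simp add: f_def Ccard)
    qed
  qed
  show ?thesis
  proof (rule that[OF D])
    show "frob_P ?\<nu> i = P i" if "i < D" for i using that by (simp add: frob_P_def rl f_def)
    show "frob_Q ?\<nu> i = Q i" if "i < D" for i using tr[OF that] by (simp add: frob_Q_def)
  qed
qed

section \<open>Adding boxes\<close>

lemma hook_product_pos: "hook_product \<mu> > 0"
  unfolding hook_product_def
proof (rule prod_pos, clarify)
  fix i j assume "(i, j) \<in> boxes \<mu>"
  then have "j < row_len \<mu> i" "i < row_len (transpose_young \<mu>) j"
    by (auto simp: boxes_def less_transpose_young)
  then show "0 < real (row_len \<mu> i) + real (row_len (transpose_young \<mu>) j) - real i - real j - 1"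
    by linarith
qed

text \<open>The step 2 is due to the doubling: for \<open>2 * N\<close> rows the ordinary shifted
  row lengths of \<open>double_rows \<mu>\<close> are \<open>shifted_row N \<mu> k + 1\<close> and
  \<open>shifted_row N \<mu> k\<close>.\<close>

definition shifted_row :: "nat \<Rightarrow> young \<Rightarrow> nat \<Rightarrow> nat" where
  "shifted_row N \<mu> k = row_len \<mu> k + 2 * (N - 1 - k)"

lemma shifted_row_gap:
  assumes "i < j" "j < N"
  shows "shifted_row N \<mu> j + 2 \<le> shifted_row N \<mu> i"
  using assms row_len_antimono[of i j \<mu>] by (simp add: shifted_row_def)

lemma shifted_row_gap_real:
  assumes "i \<noteq> j" "i < N" "j < N"
  shows "2 \<le> \<bar>real (shifted_row N \<mu> i) - real (shifted_row N \<mu> j)\<bar>"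
proof (cases "i < j")
  case True
  then show ?thesis using shifted_row_gap[of i j N \<mu>] assms by linarith
next
  case False
  then show ?thesis using shifted_row_gap[of j i N \<mu>] assms by linarith
qed

lemma inj_on_shifted_row: "inj_on (\<lambda>k. real (shifted_row N \<mu> k)) {..<N}"
proof (rule inj_onI, rule ccontr)
  fix i j assume "i \<in> {..<N}" "j \<in> {..<N}" "real (shifted_row N \<mu> i) = real (shifted_row N \<mu> j)" "i \<noteq> j"
  then show False using shifted_row_gap_real[of i j N \<mu>] by simp
qed

text \<open>The factors of \<open>(r, s)\<close> and \<open>(s, r)\<close> multiply to \<open>d\<^sup>2 (d\<^sup>2 - 1)\<close> with \<open>d = a r - a s\<close>.\<close>

definition pair_product :: "nat set \<Rightarrow> (nat \<Rightarrow> real) \<Rightarrow> real" where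
  "pair_product K a = (\<Prod>r\<in>K. \<Prod>s\<in>K-{r}. (a r - a s) * (a r - a s + 1))"

lemma prod_ordered_pairs:
  fixes g :: "nat \<Rightarrow> nat \<Rightarrow> 'a::comm_monoid_mult"
  shows "(\<Prod>r<N. \<Prod>s\<in>{..<N}-{r}. g r s) = (\<Prod>r<N. \<Prod>s\<in>{r<..<N}. g r s * g s r)"
proof (induction N)
  case (Suc N)
  have "(\<Prod>s\<in>{..<Suc N}-{r}. g r s) = g r N * (\<Prod>s\<in>{..<N}-{r}. g r s)" if "r < N" for r
  proof -
    have "{..<Suc N}-{r} = insert N ({..<N}-{r})" using that by auto
    then show ?thesis by simp
  qed
  moreover have "{..<Suc N}-{N} = {..<N}" by auto
  ultimately have "(\<Prod>r<Suc N. \<Prod>s\<in>{..<Suc N}-{r}. g r s) =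
      (\<Prod>r<N. g r N * (\<Prod>s\<in>{..<N}-{r}. g r s)) * (\<Prod>s<N. g N s)"
    by simp
  also have "\<dots> = (\<Prod>r<N. \<Prod>s\<in>{r<..<N}. g r s * g s r) * (\<Prod>r<N. g r N * g N r)"
    by (simp add: prod.distrib Suc.IH[unfolded prod.distrib] ac_simps)
  also have "\<dots> = (\<Prod>r<N. \<Prod>s\<in>{r<..<Suc N}. g r s * g s r)"
    unfolding prod.distrib[symmetric]
  proof (intro prod.cong refl)
    fix r assume "r \<in> {..<N}"
    then have "{r<..<Suc N} = insert N {r<..<N}" by auto
    then show "(\<Prod>s\<in>{r<..<N}. g r s * g s r) * (g r N * g N r) = (\<Prod>s\<in>{r<..<Suc N}. g r s * g s r)"
      by (simp add: ac_simps)
  qed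
  also have "\<dots> = (\<Prod>r<Suc N. \<Prod>s\<in>{r<..<Suc N}. g r s * g s r)"
  proof -
    have "{N<..<Suc N} = {}" by auto
    then show ?thesis by simp
  qed
  finally show ?case .
qed simp

lemma pair_product_remove:
  assumes "finite K" "k \<in> K"
  shows "pair_product K a = (\<Prod>s\<in>K-{k}. (a k - a s)^2 * ((a k - a s)^2 - 1)) * pair_product (K-{k}) a"
proof -
  let ?g = "\<lambda>r s. (a r - a s) * (a r - a s + 1)"
  have "pair_product K a = (\<Prod>s\<in>K-{k}. ?g k s) * (\<Prod>r\<in>K-{k}. \<Prod>s\<in>K-{r}. ?g r s)"
    unfolding pair_product_def using assms by (subst prod.remove[of K k]) auto
  also have "(\<Prod>r\<in>K-{k}. \<Prod>s\<in>K-{r}. ?g r s) = (\<Prod>r\<in>K-{k}. ?g r k * (\<Prod>s\<in>K-{k}-{r}. ?g r s))"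
  proof (intro prod.cong refl)
    fix r assume r: "r \<in> K - {k}"
    have "K - {r} - {k} = K - {k} - {r}" by auto
    then show "(\<Prod>s\<in>K-{r}. ?g r s) = ?g r k * (\<Prod>s\<in>K-{k}-{r}. ?g r s)"
      using assms r by (subst prod.remove[of _ k]) auto
  qed
  also have "(\<Prod>s\<in>K-{k}. ?g k s) * \<dots> = (\<Prod>s\<in>K-{k}. ?g k s * ?g s k) * pair_product (K-{k}) a"
    by (simp add: prod.distrib pair_product_def mult.assoc)
  also have "(\<Prod>s\<in>K-{k}. ?g k s * ?g s k) = (\<Prod>s\<in>K-{k}. (a k - a s)^2 * ((a k - a s)^2 - 1))"
    by (intro prod.cong refl) (simp add: algebra_simps power2_eq_square)
  finally show ?thesis .
qed

lemma prod_atLeastLessThan_double: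
  fixes g :: "nat \<Rightarrow> 'a::comm_monoid_mult"
  assumes "r \<le> N"
  shows "(\<Prod>k\<in>{2 * r..<2 * N}. g k) = (\<Prod>s\<in>{r..<N}. g (2 * s) * g (2 * s+1))"
  using assms
proof (induction N rule: dec_induct)
  case (step N)
  have "{2 * r..<2 * Suc N} = insert (2 * N+1) (insert (2 * N) {2 * r..<2 * N})" "{r..<Suc N} = insert N {r..<N}"
    using step.hyps by auto
  then show ?case using step.IH by (simp add: ac_simps)
qed simp

text \<open>For two rows \<open>r < s\<close> at distance \<open>d\<close>, the four differences
  between their copies are \<open>d\<close>, \<open>d + 1\<close>, \<open>d - 1\<close>,
  \<open>d\<close>, with product \<open>d^2 * (d^2 - 1)\<close>. Inside one pair the difference is 1
  and drops out.\<close>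

lemma hook_product_double_rows:
  assumes "row_len m N = 0"
  shows "hook_product (double_rows m) * pair_product {..<N} (\<lambda>k. real (shifted_row N m k)) =
    (\<Prod>k<N. fact (shifted_row N m k) * fact (Suc (shifted_row N m k)))"
proof -
  let ?\<nu> = "double_rows m" and ?a = "shifted_row N m"
  let ?l = "\<lambda>i k. real (row_len ?\<nu> i) - real (row_len ?\<nu> k) + real k - real i"
  have N2: "row_len ?\<nu> (2 * N) = 0" using assms by (simp add: row_len_double_rows)
  have l: "?l (2 * r) (2 * s) = real (?a r) - real (?a s)"
      "?l (2 * r) (2 * s+1) = real (?a r) - real (?a s) + 1"
      "?l (2 * r+1) (2 * s) = real (?a r) - real (?a s) - 1"
      "?l (2 * r+1) (2 * s+1) = real (?a r) - real (?a s)" if "r < N" "s < N" for r s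
    using that by (auto simp: row_len_double_rows shifted_row_def of_nat_diff)
  have rows: "(\<Prod>k\<in>{2 * r<..<2 * N}. ?l (2 * r) k) * (\<Prod>k\<in>{2 * r+1<..<2 * N}. ?l (2 * r+1) k) =
      (\<Prod>s\<in>{r<..<N}. (real (?a r) - real (?a s))^2 * ((real (?a r) - real (?a s))^2 - 1))" if r: "r < N" for r
  proof -
    have sets: "{2 * r<..<2 * N} = insert (2 * r+1) {2 * Suc r..<2 * N}" "{2 * r+1<..<2 * N} = {2 * Suc r..<2 * N}"
      "{r<..<N} = {Suc r..<N}"
      using r by auto
    have "?l (2 * r) (2 * r+1) = 1" using l(2)[OF r r] by simp
    then have "(\<Prod>k\<in>{2 * r<..<2 * N}. ?l (2 * r) k) * (\<Prod>k\<in>{2 * r+1<..<2 * N}. ?l (2 * r+1) k) =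
        (\<Prod>k\<in>{2 * Suc r..<2 * N}. ?l (2 * r) k * ?l (2 * r+1) k)"
      unfolding sets(1,2) prod.distrib by simp
    also have "\<dots> = (\<Prod>s\<in>{Suc r..<N}. (?l (2 * r) (2 * s) * ?l (2 * r+1) (2 * s)) * (?l (2 * r) (2 * s+1) * ?l (2 * r+1) (2 * s+1)))"
      using r by (intro prod_atLeastLessThan_double) simp
    also have "\<dots> = (\<Prod>s\<in>{Suc r..<N}. (real (?a r) - real (?a s))^2 * ((real (?a r) - real (?a s))^2 - 1))"
    proof (intro prod.cong refl)
      fix s assume "s \<in> {Suc r..<N}"
      then have "s < N" by simp
      then show "(?l (2 * r) (2 * s) * ?l (2 * r+1) (2 * s)) * (?l (2 * r) (2 * s+1) * ?l (2 * r+1) (2 * s+1)) =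
          (real (?a r) - real (?a s))^2 * ((real (?a r) - real (?a s))^2 - 1)"
        unfolding l[OF r \<open>s < N\<close>] by (simp add: algebra_simps power2_eq_square)
    qed
    finally show ?thesis unfolding sets(3) .
  qed
  have "(\<Prod>i<2 * N. \<Prod>k\<in>{i<..<2 * N}. ?l i k) =
      (\<Prod>r<N. \<Prod>s\<in>{r<..<N}. (real (?a r) - real (?a s))^2 * ((real (?a r) - real (?a s))^2 - 1))"
    unfolding prod_lessThan_double by (intro prod.cong refl rows) simp
  also have "\<dots> = (\<Prod>r<N. \<Prod>s\<in>{r<..<N}. ((real (?a r) - real (?a s)) * (real (?a r) - real (?a s) + 1)) *
      ((real (?a s) - real (?a r)) * (real (?a s) - real (?a r) + 1)))"
    by (intro prod.cong refl) (simp add: algebra_simps power2_eq_square)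
  also have "\<dots> = pair_product {..<N} (\<lambda>k. real (?a k))"
    unfolding pair_product_def prod_ordered_pairs ..
  finally have pp: "(\<Prod>i<2 * N. \<Prod>k\<in>{i<..<2 * N}. ?l i k) = pair_product {..<N} (\<lambda>k. real (?a k))" .
  have "(\<Prod>i<2 * N. fact (row_len ?\<nu> i + (2 * N - 1 - i))) = (\<Prod>k<N. fact (?a k) * fact (Suc (?a k)) :: real)"
    unfolding prod_lessThan_double
  proof (intro prod.cong refl)
    fix k assume "k \<in> {..<N}"
    then have "row_len ?\<nu> (2 * k) + (2 * N - 1 - 2 * k) = Suc (?a k)" "row_len ?\<nu> (2 * k+1) + (2 * N - 1 - (2 * k+1)) = ?a k"
      by (auto simp: row_len_double_rows shifted_row_def)
    then show "fact (row_len ?\<nu> (2 * k) + (2 * N - 1 - 2 * k)) * fact (row_len ?\<nu> (2 * k+1) + (2 * N - 1 - (2 * k+1))) =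
        (fact (?a k) * fact (Suc (?a k)) :: real)" by (simp only: mult.commute)
  qed
  then show ?thesis using hook_product_rows[OF N2] unfolding pp by simp
qed

text \<open>The Jack-Plancherel transition probability from \<open>m\<close> to the diagram with one more box in row \<open>k\<close>. It
  vanishes if no box can be added there. New rows below row \<open>N - 1\<close> are not accounted for, so
  \<open>row_len m (N - 1) = 0\<close> is needed for the total probability to be 1.\<close>

definition up_weight :: "nat \<Rightarrow> young \<Rightarrow> nat \<Rightarrow> real" where
  "up_weight N m k = 2 / (real (shifted_row N m k) + 2) * (\<Prod>j\<in>{..<N}-{k}.
     (real (shifted_row N m k) - real (shifted_row N m j) + 2) / (real (shifted_row N m k) - real (shifted_row N m j)))"

text \<open>The counterpart of \<open>up_weight\<close> for removing a box from row
  \<open>k\<close>; it is normalised so that its sum is the number of boxes instead of 1.\<close>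

definition down_weight :: "nat \<Rightarrow> young \<Rightarrow> nat \<Rightarrow> real" where
  "down_weight N m k = real (shifted_row N m k) * (\<Prod>j\<in>{..<N}-{k}.
     (real (shifted_row N m k) - real (shifted_row N m j) - 2) / (real (shifted_row N m k) - real (shifted_row N m j)))"

lemma sum_shifted_row:
  assumes "row_len m N = 0"
  shows "(\<Sum>k<N. real (shifted_row N m k)) = real (num_boxes m) + real N * (real N - 1)"
proof -
  have "(\<Sum>k<N. 2 * (N - 1 - k)) = (\<Sum>k<N. 2 * k)"
    by (rule sum.reindex_bij_witness[of _ "\<lambda>k. N - 1 - k" "\<lambda>k. N - 1 - k"]) auto
  also have "real \<dots> = real N * (real N - 1)"
    by (induction N) (auto simp: algebra_simps)
  finally have "(\<Sum>k<N. real (2 * (N - 1 - k))) = real N * (real N - 1)" by simp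
  then show ?thesis
    unfolding num_boxes_sum[OF assms] shifted_row_def of_nat_add sum.distrib by simp
qed

text \<open>Write \<open>a k\<close> for the shifted row length. Then \<open>up_weight\<close> is
  \<open>C k / (a k + 2)\<close>, where the \<open>C k\<close> are the residues of the product of
  \<open>(v - a k + 2) / (v - a k)\<close>. The content is \<open>a k + 2 - 2 * N\<close>, so each
  multiplication by it lowers a moment to one of the \<open>C k\<close>, known from
  \<open>partial_fractions_moments\<close>.\<close>

lemma up_weight_moments:
  assumes "row_len m (N - 1) = 0" "N > 0"
  defines "c \<equiv> \<lambda>k. real (row_len m k) - 2 * real k"
  shows "(\<Sum>k<N. up_weight N m k) = 1" "(\<Sum>k<N. up_weight N m k * c k) = 0"
    "(\<Sum>k<N. up_weight N m k * (c k)^2) = 2 * real (num_boxes m)"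
proof -
  let ?a = "\<lambda>k. real (shifted_row N m k)"
  define C where "C = (\<lambda>k. 2 * (\<Prod>j\<in>{..<N}-{k}. (?a k - ?a j + 2) / (?a k - ?a j)))"
  have mN: "row_len m N = 0" using assms(1) row_len_antimono[of "N - 1" N m] by simp
  have pos: "?a k + 2 > 0" for k by (simp add: add_pos_pos add_nonneg_pos)
  have up: "up_weight N m k * (?a k + 2) = C k" "up_weight N m k = C k / (?a k + 2)" for k
    using pos[of k] by (auto simp: up_weight_def C_def)
  have cN: "c k = ?a k + 2 - 2 * real N" if "k < N" for k
    using that by (simp add: c_def shifted_row_def of_nat_diff)
  \<comment> \<open>The evaluation point -2 is a zero of the product: the last row is empty and its
    shifted length is 0. This gives total probability 1.\<close>
  have "-2 \<notin> ?a ` {..<N}" by auto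
  from partial_fractions[OF _ inj_on_shifted_row this, of "\<lambda>k. ?a k - 2"]
  have "(\<Prod>k<N. (- 2 - (?a k - 2)) / (- 2 - ?a k)) = 1 + (\<Sum>k<N. C k / (- 2 - ?a k))"
    by (simp add: C_def algebra_simps)
  moreover have "(\<Prod>k<N. (- 2 - (?a k - 2)) / (- 2 - ?a k)) = 0"
    using assms(1,2) by (intro prod_zero bexI[of _ "N - 1"]) (auto simp: shifted_row_def)
  moreover have "C k / (- 2 - ?a k) = - up_weight N m k" for k
  proof -
    have neg: "- 2 - x = - (x + 2)" for x :: real by simp
    show ?thesis unfolding up(2) neg minus_divide_right ..
  qed
  ultimately show S0: "(\<Sum>k<N. up_weight N m k) = 1"
    by (simp add: sum_negf)
  have m0: "(\<Sum>k<N. C k) = 2 * real N" and m1: "2 * (\<Sum>k<N. C k * ?a k) = 4 * (\<Sum>k<N. ?a k) + 4 * real N * (real N - 1)"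
    using partial_fractions_moments[OF finite_lessThan inj_on_shifted_row, of 2 N m] unfolding C_def by auto
  have "(\<Sum>k<N. up_weight N m k * c k) = (\<Sum>k<N. C k - 2 * real N * up_weight N m k)"
    unfolding up(1)[symmetric] by (intro sum.cong refl) (simp add: cN algebra_simps)
  also have "\<dots> = 0"
    using m0 S0 by (simp add: sum_subtractf sum_distrib_left[symmetric])
  finally show "(\<Sum>k<N. up_weight N m k * c k) = 0" .
  have "(\<Sum>k<N. up_weight N m k * (c k)^2) =
      (\<Sum>k<N. C k * ?a k + (2 - 4 * real N) * C k + 4 * (real N)^2 * up_weight N m k)"
    unfolding up(1)[symmetric] by (intro sum.cong refl) (simp add: cN algebra_simps power2_eq_square)
  also have "\<dots> = (\<Sum>k<N. C k * ?a k) + (2 - 4 * real N) * (2 * real N) + 4 * (real N)^2"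
    unfolding sum.distrib sum_distrib_left[symmetric] m0 S0 by simp
  also have "\<dots> = 2 * real (num_boxes m)"
    using m1 sum_shifted_row[OF mN] by (simp add: algebra_simps power2_eq_square)
  finally show "(\<Sum>k<N. up_weight N m k * (c k)^2) = 2 * real (num_boxes m)" .
qed

text \<open>The first moment for \<beta> = -2, because \<open>- 2 * down_weight\<close> is the
  residue times the shifted row length. The quadratic term in \<open>N\<close> cancels against the
  staircase contained in the shifted rows.\<close>

lemma sum_down_weight:
  assumes "row_len m N = 0"
  shows "(\<Sum>k<N. down_weight N m k) = real (num_boxes m)"
proof -
  let ?a = "\<lambda>k. real (shifted_row N m k)"
  let ?C = "\<lambda>k. - 2 * (\<Prod>j\<in>{..<N}-{k}. (?a k - ?a j + - 2) / (?a k - ?a j))"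
  have "2 * (\<Sum>k<N. ?C k * ?a k) = - 4 * (\<Sum>k<N. ?a k) + 4 * real N * (real N - 1)"
    using partial_fractions_moments(2)[OF finite_lessThan inj_on_shifted_row, of "- 2" N m] by simp
  moreover have "(\<Sum>k<N. ?C k * ?a k) = (\<Sum>k<N. - 2 * down_weight N m k)"
    by (intro sum.cong refl) (simp add: down_weight_def)
  ultimately show ?thesis
    using sum_shifted_row[OF assms] by (simp add: sum_distrib_left[symmetric] sum_negf algebra_simps)
qed

text \<open>Detailed balance along the edge from \<open>m'\<close> to \<open>m\<close>. Only the
  shifted length of row \<open>k\<close> changes, by 1, so the quotient of the hook products is a
  product over the other rows; against the down weight its factors \<open>d - 1\<close> and
  \<open>d + 1\<close> cancel.\<close>

lemma hook_product_add_box: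
  assumes m: "row_len m = (row_len m')(k := Suc (row_len m' k))" and k: "k < N" and N: "row_len m N = 0"
  shows "up_weight N m' k / hook_product (double_rows m') = 2 * down_weight N m k / hook_product (double_rows m)"
proof -
  let ?a = "\<lambda>j. real (shifted_row N m' j)" and ?b = "\<lambda>j. real (shifted_row N m j)"
  let ?K = "{..<N} - {k}"
  let ?d = "\<lambda>j. ?a k - ?a j"
  have N': "row_len m' N = 0" using N k by (simp add: m)
  have b: "?b k = ?a k + 1" "\<And>j. j \<noteq> k \<Longrightarrow> ?b j = ?a j"
    by (auto simp: shifted_row_def m)
  have d: "?d j \<noteq> 0" "?d j \<noteq> 1" "?d j \<noteq> - 1" if "j \<in> ?K" for j
    using shifted_row_gap_real[of k j N m'] that k by auto
  let ?F = "\<lambda>m. \<Prod>j<N. fact (shifted_row N m j) * fact (Suc (shifted_row N m j)) :: real"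
  have F: "?F m = ?F m' * ((?a k + 1) * (?a k + 2))"
  proof -
    have "?F m = (fact (shifted_row N m k) * fact (Suc (shifted_row N m k))) * (\<Prod>j\<in>?K. fact (shifted_row N m j) * fact (Suc (shifted_row N m j)))"
      using k by (subst prod.remove[of _ k]) auto
    also have "(\<Prod>j\<in>?K. fact (shifted_row N m j) * fact (Suc (shifted_row N m j)) :: real) =
        (\<Prod>j\<in>?K. fact (shifted_row N m' j) * fact (Suc (shifted_row N m' j)))"
      by (intro prod.cong refl) (auto simp: shifted_row_def m)
    also have "shifted_row N m k = Suc (shifted_row N m' k)" by (simp add: shifted_row_def m)
    finally have 1: "?F m = (fact (Suc (shifted_row N m' k)) * fact (Suc (Suc (shifted_row N m' k)))) * (\<Prod>j\<in>?K. fact (shifted_row N m' j) * fact (Suc (shifted_row N m' j)))" .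
    have "?F m' = (fact (shifted_row N m' k) * fact (Suc (shifted_row N m' k))) * (\<Prod>j\<in>?K. fact (shifted_row N m' j) * fact (Suc (shifted_row N m' j)))"
      using k by (subst prod.remove[of _ k]) auto
    then show ?thesis unfolding 1 by (simp add: algebra_simps)
  qed
  \<comment> \<open>Every distance \<open>d\<close> to row \<open>k\<close> becomes
    \<open>d + 1\<close>, and \<open>(d + 1)^2 * ((d + 1)^2 - 1)\<close> arises from
    \<open>d^2 * (d^2 - 1)\<close> by the factor \<open>(d + 1) * (d + 2) / (d * (d - 1))\<close>.
    Distances have absolute value at least 2, so no denominator vanishes.\<close>
  have V: "pair_product {..<N} ?b = pair_product {..<N} ?a * (\<Prod>j\<in>?K. (?d j + 1) * (?d j + 2) / (?d j * (?d j - 1)))"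
  proof -
    have eq: "pair_product ?K ?b = pair_product ?K ?a"
      unfolding pair_product_def by (intro prod.cong refl) (auto simp: b)
    have "(\<Prod>j\<in>?K. (?b k - ?b j)^2 * ((?b k - ?b j)^2 - 1)) =
        (\<Prod>j\<in>?K. (?d j ^2 * (?d j ^2 - 1)) * ((?d j + 1) * (?d j + 2) / (?d j * (?d j - 1))))"
    proof (intro prod.cong refl)
      fix j assume j: "j \<in> ?K"
      have aux: "(x + 1)^2 * ((x + 1)^2 - 1) = (x^2 * (x^2 - 1)) * ((x + 1) * (x + 2) / (x * (x - 1)))"
        if "x \<noteq> 0" "x \<noteq> 1" for x :: real
      proof -
        have "(x^2 * (x^2 - 1)) * ((x + 1) * (x + 2) / (x * (x - 1))) =
          (x * (x - 1)) * (x * (x + 1)) * ((x + 1) * (x + 2)) / (x * (x - 1))"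
          by (simp add: algebra_simps power2_eq_square)
        also have "\<dots> = (x * (x + 1)) * ((x + 1) * (x + 2))" using that by simp
        finally show ?thesis by (simp add: algebra_simps power2_eq_square)
      qed
      have "?b k - ?b j = ?d j + 1" using b j by simp
      then show "(?b k - ?b j)^2 * ((?b k - ?b j)^2 - 1) =
          (?d j ^2 * (?d j ^2 - 1)) * ((?d j + 1) * (?d j + 2) / (?d j * (?d j - 1)))"
        using aux[OF d(1,2)[OF j]] by simp
    qed
    then show ?thesis
      unfolding pair_product_remove[OF finite_lessThan lessThan_iff[THEN iffD2, OF k], of ?a]
        pair_product_remove[OF finite_lessThan lessThan_iff[THEN iffD2, OF k], of ?b] eq
      by (simp only: prod.distrib mult_ac)
  qed
  have W: "1 / hook_product (double_rows \<mu>) = pair_product {..<N} (\<lambda>k. real (shifted_row N \<mu> k)) / ?F \<mu>"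
    if "row_len \<mu> N = 0" for \<mu>
  proof -
    have "?F \<mu> \<noteq> 0" by simp
    then show ?thesis using hook_product_double_rows[OF that] hook_product_pos[of "double_rows \<mu>"] by (simp add: field_simps)
  qed
  have dw: "down_weight N m k = (?a k + 1) * (\<Prod>j\<in>?K. (?d j - 1) / (?d j + 1))"
  proof -
    have "(\<Prod>j\<in>?K. (?b k - ?b j - 2) / (?b k - ?b j)) = (\<Prod>j\<in>?K. (?d j - 1) / (?d j + 1))"
      by (intro prod.cong refl) (auto simp: b algebra_simps)
    then show ?thesis unfolding down_weight_def b(1) by simp
  qed
  have pr: "(\<Prod>j\<in>?K. (?d j + 1) * (?d j + 2) / (?d j * (?d j - 1))) * (\<Prod>j\<in>?K. (?d j - 1) / (?d j + 1)) =
      (\<Prod>j\<in>?K. (?d j + 2) / ?d j)"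
    unfolding prod.distrib[symmetric]
  proof (intro prod.cong refl)
    fix j assume j: "j \<in> ?K"
    have "?d j - 1 \<noteq> 0" "?d j + 1 \<noteq> 0" using d[OF j] by linarith+
    then show "(?d j + 1) * (?d j + 2) / (?d j * (?d j - 1)) * ((?d j - 1) / (?d j + 1)) = (?d j + 2) / ?d j"
      by simp
  qed
  have "2 * down_weight N m k / hook_product (double_rows m) =
      2 * ((?a k + 1) * (\<Prod>j\<in>?K. (?d j - 1) / (?d j + 1))) * (1 / hook_product (double_rows m))"
    unfolding dw by simp
  also have "\<dots> = 2 * (?a k + 1) * (pair_product {..<N} ?a * ((\<Prod>j\<in>?K. (?d j + 1) * (?d j + 2) / (?d j * (?d j - 1))) * (\<Prod>j\<in>?K. (?d j - 1) / (?d j + 1)))) /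
      (?F m' * ((?a k + 1) * (?a k + 2)))"
  proof -
    have "2 * (y * B) * (V * A / G) = 2 * y * (V * (A * B)) / G" for y A B V G :: real
      by (simp add: mult_ac)
    then show ?thesis unfolding W[OF N] V F .
  qed
  also have "\<dots> = 2 / (?a k + 2) * (\<Prod>j\<in>?K. (?d j + 2) / ?d j) * (pair_product {..<N} ?a / ?F m')"
  proof -
    have "2 * y * (V * R) / (F * (y * x)) = 2 / x * R * (V / F)" if "y \<noteq> 0" for x y V R F :: real
      using that by (simp add: mult_ac)
    moreover have "?a k + 1 \<noteq> 0" by linarith
    ultimately show ?thesis unfolding pr by blast
  qed
  also have "\<dots> = up_weight N m' k * (1 / hook_product (double_rows m'))"
    unfolding W[OF N'] up_weight_def ..
  finally show ?thesis by simp
qed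

text \<open>Here \<open>m\<close> is the transpose of the diagram of interest: \<open>k\<close> numbers its columns and \<open>i\<close> its rows, and
  \<open>k - i/2\<close> is the content for \<open>\<theta> = 1/2\<close>.\<close>

definition content_product :: "(real \<Rightarrow> complex) \<Rightarrow> young \<Rightarrow> complex" where
  "content_product f m = (\<Prod>(k, i)\<in>boxes m. f (real i - 2 * real k))"

section \<open>Diagrams with a given number of boxes and the edges between them\<close>

definition level :: "nat \<Rightarrow> young set" where
  "level n = {m. num_boxes m = n}"

lemma row_len_num_boxes:
  "row_len m i \<le> num_boxes m" "num_boxes m \<le> i \<Longrightarrow> row_len m i = 0"
proof -
  obtain N where N: "row_len m N = 0" using row_len_eventually_0 by blast
  show le: "row_len m i \<le> num_boxes m" for i
  proof (cases "i < N")
    case True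
    then show ?thesis unfolding num_boxes_sum[OF N] by (intro member_le_sum) auto
  next
    case False
    then show ?thesis using row_len_antimono[of N i m] N by simp
  qed
  assume "num_boxes m \<le> i"
  moreover have "i < row_len (transpose_young m) 0 \<longleftrightarrow> 0 < row_len m i" by (rule less_transpose_young)
  moreover have "row_len (transpose_young m) 0 \<le> num_boxes m"
  proof -
    obtain M where M: "row_len (transpose_young m) M = 0" using row_len_eventually_0 by blast
    show ?thesis
    proof (cases "M = 0")
      case False
      then show ?thesis unfolding num_boxes_transpose[of m, symmetric] num_boxes_sum[OF M]
        by (intro member_le_sum) auto
    qed (use M in simp)
  qed
  ultimately show "row_len m i = 0" by simp
qed

lemma finite_level: "finite (level n)"
proof (rule finite_imageD)
  have "row_len ` level n \<subseteq> {f. \<forall>i. (i \<in> {..<n} \<longrightarrow> f i \<in> {..n}) \<and> (i \<notin> {..<n} \<longrightarrow> f i = 0)}"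
    using row_len_num_boxes by (auto simp: level_def)
  then show "finite (row_len ` level n)"
    by (rule finite_subset) (intro finite_set_of_finite_funs; simp)
  show "inj_on row_len (level n)" by (auto simp: inj_on_def row_len_inject)
qed

text \<open>Meaningful only for rows that can be lengthened; otherwise \<open>Abs_young\<close> is
  applied to a sequence that is not a diagram and the value is unspecified. The same applies to
  \<open>remove_box\<close>.\<close>

definition add_box :: "nat \<Rightarrow> young \<Rightarrow> young" where
  "add_box k m = Abs_young ((row_len m)(k := Suc (row_len m k)))"

definition remove_box :: "nat \<Rightarrow> young \<Rightarrow> young" where
  "remove_box k m = Abs_young ((row_len m)(k := row_len m k - 1))"

lemma row_len_upd:
  assumes "antimono ((row_len m)(k := x))"
  shows "row_len (Abs_young ((row_len m)(k := x))) = (row_len m)(k := x)"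
proof -
  have "{i. ((row_len m)(k := x)) i \<noteq> 0} \<subseteq> insert k {i. row_len m i \<noteq> 0}" by auto
  moreover have "finite {i. row_len m i \<noteq> 0}" using row_len[of m] by simp
  ultimately have "finite {i. ((row_len m)(k := x)) i \<noteq> 0}" by (meson finite_insert finite_subset)
  then show ?thesis using assms by (intro Abs_young_inverse) simp
qed

lemma row_len_add_box:
  assumes "k = 0 \<or> row_len m k < row_len m (k - 1)"
  shows "row_len (add_box k m) = (row_len m)(k := Suc (row_len m k))"
  unfolding add_box_def
proof (rule row_len_upd, rule antimonoI)
  fix i j :: nat assume ij: "i \<le> j"
  show "((row_len m)(k := Suc (row_len m k))) j \<le> ((row_len m)(k := Suc (row_len m k))) i"
  proof (cases "j = k \<and> i \<noteq> k")
    case True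
    then have "row_len m (k - 1) \<le> row_len m i" using ij by (intro row_len_antimono) auto
    then show ?thesis using True assms ij by auto
  qed (use row_len_antimono[OF ij, of m] in auto)
qed

lemma row_len_remove_box:
  assumes "row_len m (Suc k) < row_len m k"
  shows "row_len (remove_box k m) = (row_len m)(k := row_len m k - 1)"
  unfolding remove_box_def
proof (rule row_len_upd, rule antimonoI)
  fix i j :: nat assume ij: "i \<le> j"
  show "((row_len m)(k := row_len m k - 1)) j \<le> ((row_len m)(k := row_len m k - 1)) i"
  proof (cases "i = k \<and> j \<noteq> k")
    case True
    then have "row_len m j \<le> row_len m (Suc k)" using ij by (intro row_len_antimono) auto
    then show ?thesis using True assms ij by auto
  qed (use row_len_antimono[OF ij, of m] in auto)
qed

text \<open>A row of the same length directly above lies at distance exactly 2, which makes one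
  factor of the product vanish.\<close>

lemma up_weight_zero:
  assumes "\<not> (k = 0 \<or> row_len m k < row_len m (k - 1))" "k < N"
  shows "up_weight N m k = 0"
proof -
  have "row_len m (k - 1) = row_len m k"
    using assms(1) row_len_antimono[of "k - 1" k m] by simp
  then have "real (shifted_row N m k) - real (shifted_row N m (k - 1)) + 2 = 0"
    using assms by (simp add: shifted_row_def of_nat_diff)
  then have "(\<Prod>j\<in>{..<N}-{k}. (real (shifted_row N m k) - real (shifted_row N m j) + 2) /
      (real (shifted_row N m k) - real (shifted_row N m j))) = 0"
    using assms by (intro prod_zero bexI[of _ "k - 1"]) auto
  then show ?thesis by (simp add: up_weight_def)
qed

text \<open>As before, with the row directly below. The last row has none, but it is empty and its
  shifted length, the leading factor, is 0.\<close>

lemma down_weight_zero: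
  assumes "\<not> row_len m (Suc k) < row_len m k" "k < N" "row_len m (N - 1) = 0"
  shows "down_weight N m k = 0"
proof (cases "k = N - 1")
  case True
  then show ?thesis using assms by (simp add: down_weight_def shifted_row_def)
next
  case False
  have "row_len m (Suc k) = row_len m k"
    using assms(1) row_len_antimono[of k "Suc k" m] by simp
  then have "real (shifted_row N m k) - real (shifted_row N m (Suc k)) - 2 = 0"
    using assms False by (simp add: shifted_row_def of_nat_diff)
  then have "(\<Prod>j\<in>{..<N}-{k}. (real (shifted_row N m k) - real (shifted_row N m j) - 2) /
      (real (shifted_row N m k) - real (shifted_row N m j))) = 0"
    using assms False by (intro prod_zero bexI[of _ "Suc k"]) auto
  then show ?thesis by (simp add: down_weight_def)
qed

lemma content_product_add_box:
  assumes m: "row_len m = (row_len m')(k := Suc (row_len m' k))" and k: "k < N" and N: "row_len m N = 0"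
  shows "content_product f m = content_product f m' * f (real (row_len m' k) - 2 * real k)"
    and "num_boxes m = Suc (num_boxes m')"
proof -
  have N': "row_len m' N = 0" using N k by (simp add: m)
  let ?g = "\<lambda>r i. f (real i - 2 * real r)"
  have "content_product f \<mu> = (\<Prod>i<row_len \<mu> k. ?g k i) * (\<Prod>r\<in>{..<N}-{k}. \<Prod>i<row_len \<mu> r. ?g r i)"
    if "row_len \<mu> N = 0" for \<mu>
    unfolding content_product_def prod_boxes[OF that] using k by (subst prod.remove[of _ k]) auto
  note cp = this[OF N] this[OF N']
  have "(\<Prod>r\<in>{..<N}-{k}. \<Prod>i<row_len m r. ?g r i) = (\<Prod>r\<in>{..<N}-{k}. \<Prod>i<row_len m' r. ?g r i)"
    by (intro prod.cong refl) (auto simp: m)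
  then show "content_product f m = content_product f m' * ?g k (row_len m' k)"
    unfolding cp by (simp add: m mult_ac)
  have "num_boxes \<mu> = row_len \<mu> k + (\<Sum>r\<in>{..<N}-{k}. row_len \<mu> r)" if "row_len \<mu> N = 0" for \<mu>
    unfolding num_boxes_sum[OF that] using k by (subst sum.remove[of _ k]) auto
  note nb = this[OF N] this[OF N']
  have "(\<Sum>r\<in>{..<N}-{k}. row_len m r) = (\<Sum>r\<in>{..<N}-{k}. row_len m' r)"
    by (intro sum.cong refl) (auto simp: m)
  then show "num_boxes m = Suc (num_boxes m')" unfolding nb by (simp add: m)
qed

section \<open>Recursion for the weight of a level\<close>

definition level_sum :: "(real \<Rightarrow> complex) \<Rightarrow> nat \<Rightarrow> complex" where
  "level_sum f n = (\<Sum>m\<in>level n. content_product f m / of_real (hook_product (double_rows m)))"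

text \<open>Double counting of the edges between two levels. Summed from the larger diagram, the
  down weights give its number of boxes; summed from the smaller one, the up weights against the
  factor of the new box give \<kappa>. Detailed balance identifies the two sums edge by
  edge.\<close>

lemma level_sum_Suc:
  assumes \<kappa>: "\<And>m. m \<in> level n \<Longrightarrow>
    (\<Sum>k<n+2. of_real (up_weight (n+2) m k) * f (real (row_len m k) - 2 * real k)) = \<kappa>"
  shows "2 * of_nat (Suc n) * level_sum f (Suc n) = \<kappa> * level_sum f n"
proof -
  \<comment> \<open>Large enough that row \<open>?N - 1\<close> is empty for all diagrams with
    \<open>n\<close> or \<open>n + 1\<close> boxes, so no edge uses a row beyond the first
    \<open>?N\<close>.\<close>
  let ?N = "n + 2"
  let ?w = "\<lambda>m. content_product f m / of_real (hook_product (double_rows m))"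
  let ?E = "{(m', k). m' \<in> level n \<and> k < ?N \<and> (k = 0 \<or> row_len m' k < row_len m' (k - 1))}"
  let ?E' = "{(m, k). m \<in> level (Suc n) \<and> k < ?N \<and> row_len m (Suc k) < row_len m k}"
  let ?up = "\<lambda>(m', k). ?w m' * (of_real (up_weight ?N m' k) * f (real (row_len m' k) - 2 * real k))"
  let ?down = "\<lambda>(m, k). ?w m * (2 * of_real (down_weight ?N m k))"
  have z: "row_len m (?N - 1) = 0" "row_len m ?N = 0" "row_len m (Suc n) = 0" if "m \<in> level n \<or> m \<in> level (Suc n)" for m
    using that row_len_num_boxes(2)[of m] by (auto simp: level_def)
  have grow: "row_len m ?N = 0 \<and> m \<in> level (Suc n) \<and> row_len m (Suc k) < row_len m k \<and> ?down (m, k) = ?up (m', k)"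
    if m': "m' \<in> level n" and k: "k < ?N" and m: "row_len m = (row_len m')(k := Suc (row_len m' k))" for m m' k
  proof -
    have N: "row_len m ?N = 0" using z(2)[of m'] m' k by (simp add: m)
    note cp = content_product_add_box[OF m k N]
    have ratio: "of_real (up_weight ?N m' k) / of_real (hook_product (double_rows m')) =
        (2 * of_real (down_weight ?N m k) / of_real (hook_product (double_rows m)) :: complex)"
      using arg_cong[OF hook_product_add_box[OF m k N], of complex_of_real] by simp
    have "c * v / H * (2 * d) = c / H' * (u * v)" if "u / H' = 2 * d / H" for c v H H' d u :: complex
    proof -
      have "c * v / H * (2 * d) = c * v * (2 * d / H)" by simp
      then show ?thesis unfolding that[symmetric] by simp
    qed
    from this[OF ratio] have "?down (m, k) = ?up (m', k)"
      by (simp only: case_prod_conv cp(1))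
    moreover have "row_len m (Suc k) < row_len m k"
      using row_len_antimono[of k "Suc k" m'] by (simp add: m)
    ultimately show ?thesis using N cp(2) m' by (simp add: level_def)
  qed
  have "2 * of_nat (Suc n) * level_sum f (Suc n) = (\<Sum>m\<in>level (Suc n). \<Sum>k<?N. ?down (m, k))"
    unfolding level_sum_def sum_distrib_left
  proof (intro sum.cong refl)
    fix m assume m: "m \<in> level (Suc n)"
    have "(\<Sum>k<?N. ?down (m, k)) = ?w m * (2 * of_real (\<Sum>k<?N. down_weight ?N m k))"
      by (simp only: case_prod_conv sum_distrib_left of_real_sum)
    also have "(\<Sum>k<?N. down_weight ?N m k) = real (Suc n)"
      using sum_down_weight[OF z(2), of m] m by (simp add: level_def)
    finally show "2 * of_nat (Suc n) * ?w m = (\<Sum>k<?N. ?down (m, k))"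
      by (simp only: of_real_of_nat_eq mult_ac)
  qed
  also have "\<dots> = (\<Sum>q\<in>level (Suc n) \<times> {..<?N}. ?down q)"
    by (subst sum.Sigma) (auto simp: finite_level intro!: sum.cong)
  \<comment> \<open>The weights vanish on pairs that are not edges, so the full rectangle of
    diagrams and rows may be cut down to edges here and enlarged again on the other level.\<close>
  also have "\<dots> = (\<Sum>q\<in>?E'. ?down q)"
    by (rule sum.mono_neutral_right) (auto simp: finite_level z intro!: down_weight_zero)
  also have "\<dots> = (\<Sum>q\<in>?E. ?up q)"
  proof (rule sum.reindex_bij_witness[of _ "\<lambda>(m', k). (add_box k m', k)" "\<lambda>(m, k). (remove_box k m, k)"])
    fix q assume "q \<in> ?E'"
    then obtain m k where q: "q = (m, k)"
      and *: "m \<in> level (Suc n)" "k < ?N" "row_len m (Suc k) < row_len m k" by blast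
    note r = row_len_remove_box[OF *(3)]
    have m: "row_len m = (row_len (remove_box k m))(k := Suc (row_len (remove_box k m) k))"
      using *(3) by (auto simp: r fun_eq_iff)
    have ok: "k = 0 \<or> row_len (remove_box k m) k < row_len (remove_box k m) (k - 1)"
      using *(3) row_len_antimono[of "k - 1" k m] by (auto simp: r)
    have "row_len (add_box k (remove_box k m)) = row_len m"
      unfolding row_len_add_box[OF ok] by (rule m[symmetric])
    then have add: "add_box k (remove_box k m) = m" by (simp only: row_len_inject)
    then show "(case case q of (m, k) \<Rightarrow> (remove_box k m, k) of (m', k) \<Rightarrow> (add_box k m', k)) = q"
      by (simp add: q)
    have "num_boxes m = Suc (num_boxes (remove_box k m))"
      by (rule content_product_add_box(2)[OF m *(2)]) (use z(2)[of m] *(1) in simp)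
    then have lev: "remove_box k m \<in> level n" using *(1) by (simp add: level_def)
    then show "(case q of (m, k) \<Rightarrow> (remove_box k m, k)) \<in> ?E" using * ok by (simp add: q)
    show "?up (case q of (m, k) \<Rightarrow> (remove_box k m, k)) = ?down q"
      unfolding q using grow[OF lev *(2) m, THEN conjunct2, THEN conjunct2, THEN conjunct2]
      by (simp only: case_prod_conv)
  next
    fix q assume qE: "q \<in> ?E"
    obtain m' k where q: "q = (m', k)" by (cases q)
    note conj = qE[unfolded q mem_Collect_eq case_prod_conv]
    note * = conj[THEN conjunct1] conj[THEN conjunct2, THEN conjunct1] conj[THEN conjunct2, THEN conjunct2]
    note r = row_len_add_box[OF *(3)]
    have g: "add_box k m' \<in> level (Suc n)" "row_len (add_box k m') (Suc k) < row_len (add_box k m') k"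
      using grow[OF *(1,2) r] by blast+
    then show "(case q of (m', k) \<Rightarrow> (add_box k m', k)) \<in> ?E'" using * by (simp add: q)
    have "row_len (remove_box k (add_box k m')) = row_len m'"
      unfolding row_len_remove_box[OF g(2)] r by (auto simp: fun_eq_iff)
    then have "remove_box k (add_box k m') = m'" by (simp only: row_len_inject)
    then show "(case case q of (m', k) \<Rightarrow> (add_box k m', k) of (m, k) \<Rightarrow> (remove_box k m, k)) = q"
      by (simp add: q)
  qed
  also have "\<dots> = (\<Sum>q\<in>level n \<times> {..<?N}. ?up q)"
    by (rule sum.mono_neutral_left) (auto simp: finite_level intro!: up_weight_zero)
  also have "\<dots> = (\<Sum>m'\<in>level n. \<Sum>k<?N. ?up (m', k))"
    by (subst sum.Sigma) (auto simp: finite_level intro!: sum.cong)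
  also have "\<dots> = \<kappa> * level_sum f n"
    unfolding level_sum_def sum_distrib_left[of \<kappa>]
  proof (intro sum.cong refl)
    fix m' assume m': "m' \<in> level n"
    have "(\<Sum>k<?N. ?up (m', k)) = ?w m' * (\<Sum>k<?N. of_real (up_weight ?N m' k) * f (real (row_len m' k) - 2 * real k))"
      by (simp only: case_prod_conv sum_distrib_left)
    then show "(\<Sum>k<?N. ?up (m', k)) = \<kappa> * ?w m'"
      unfolding \<kappa>[OF m'] by simp
  qed
  finally show ?thesis .
qed

lemma level_sum_0: "level_sum f 0 = 1"
proof -
  have b: "boxes m = {}" if "m \<in> level 0" for m
    using that by (simp add: level_def num_boxes_def)
  have one: "content_product f m / of_real (hook_product (double_rows m)) = 1" if "m \<in> level 0" for m
    using b[OF that] unfolding hook_product_def prod_boxes_double_rows content_product_def by simp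
  have "level 0 = {Abs_young (\<lambda>_. 0)}"
  proof -
    have z: "row_len (Abs_young (\<lambda>_. 0)) = (\<lambda>_. 0)"
      by (rule Abs_young_inverse) (auto simp: antimono_def)
    have unique: "m = Abs_young (\<lambda>_. 0)" if "m \<in> level 0" for m
      using row_len_num_boxes(2)[of m] that by (intro young_eqI) (simp add: level_def z)
    have mem: "Abs_young (\<lambda>_. 0) \<in> level 0"
      using num_boxes_sum[of "Abs_young (\<lambda>_. 0)" 0] by (simp add: level_def z)
    show ?thesis
    proof (intro equalityI subsetI)
      fix m assume "m \<in> level 0"
      then show "m \<in> {Abs_young (\<lambda>_. 0)}" unfolding singleton_iff by (rule unique)
    next
      fix m assume "m \<in> {Abs_young (\<lambda>_. 0)}"
      then show "m \<in> level 0" unfolding singleton_iff using mem by (rule ssubst)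
    qed
  qed
  then show ?thesis unfolding level_sum_def using one by simp
qed

text \<open>Total transition probability 1 gives \<kappa> = 1, and hence the terms of the
  exponential series.\<close>

lemma level_sum_const: "level_sum (\<lambda>_. 1) n = 1 / (2 ^ n * fact n)"
proof (induction n)
  case (Suc n)
  have "2 * of_nat (Suc n) * level_sum (\<lambda>_. 1) (Suc n) = 1 * level_sum (\<lambda>_. 1) n"
  proof (rule level_sum_Suc)
    fix m assume "m \<in> level n"
    then have "(\<Sum>k<n+2. up_weight (n+2) m k) = 1"
      using row_len_num_boxes(2)[of m "n + 1"] by (intro up_weight_moments) (auto simp: level_def)
    then show "(\<Sum>k<n+2. of_real (up_weight (n+2) m k) * (1::complex)) = 1"
      by (simp del: sum.lessThan_Suc add: of_real_sum[symmetric])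
  qed
  then have "level_sum (\<lambda>_. 1) (Suc n) = level_sum (\<lambda>_. 1) n / (2 * of_nat (Suc n))"
    by (simp add: field_simps del: of_nat_Suc)
  then show ?case unfolding Suc.IH by (simp del: of_nat_Suc add: of_nat_mult)
qed (simp add: level_sum_0)

text \<open>The factor is quadratic in the content, and the moments of order 0, 1, 2 are 1, 0,
  \<open>2 * n\<close>. Hence \<kappa> is \<open>4 * z * z' + 2 * n\<close>, independent of the
  diagram, and the recursion is that of the Pochhammer symbol.\<close>

lemma level_sum_mixed:
  "level_sum (\<lambda>c. (2 * z - of_real c) * (2 * z' - of_real c)) n = pochhammer (2 * z * z') n / fact n"
proof (induction n)
  case (Suc n)
  let ?f = "\<lambda>c. (2 * z - of_real c) * (2 * z' - of_real c) :: complex"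
  have "2 * of_nat (Suc n) * level_sum ?f (Suc n) = (2 * (2 * z * z' + of_nat n)) * level_sum ?f n"
  proof (rule level_sum_Suc)
    fix m assume m: "m \<in> level n"
    then have z: "row_len m (n + 2 - 1) = 0"
      using row_len_num_boxes(2)[of m "n + 1"] by (simp add: level_def)
    let ?p = "\<lambda>k. complex_of_real (up_weight (n+2) m k)" and ?c = "\<lambda>k. real (row_len m k) - 2 * real k"
    have "n + 2 > 0" by simp
    note mom = up_weight_moments[OF z this]
    have s0: "(\<Sum>k<n+2. ?p k) = 1"
      unfolding of_real_sum[symmetric] mom(1) by simp
    have s1: "(\<Sum>k<n+2. ?p k * of_real (?c k)) = 0"
      unfolding of_real_mult[symmetric] of_real_sum[symmetric] mom(2) by simp
    have s2: "(\<Sum>k<n+2. ?p k * of_real ((?c k)^2)) = 2 * of_nat n"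
      unfolding of_real_mult[symmetric] of_real_sum[symmetric] mom(3) using m by (simp add: level_def)
    have "(\<Sum>k<n+2. ?p k * ?f (?c k)) =
        (\<Sum>k<n+2. 4 * z * z' * ?p k + (- 2 * (z + z')) * (?p k * of_real (?c k)) + ?p k * of_real ((?c k)^2))"
      by (intro sum.cong refl) (simp only: of_real_power power2_eq_square ring_distribs, simp add: algebra_simps)
    also have "\<dots> = 2 * (2 * z * z' + of_nat n)"
      unfolding sum.distrib sum_distrib_left[symmetric] s0 s1 s2 by (simp add: algebra_simps)
    finally show "(\<Sum>k<n+2. ?p k * ?f (?c k)) = 2 * (2 * z * z' + of_nat n)" .
  qed
  note rec = this
  have solve: "T' = w * T / s" if "2 * s * T' = (2 * w) * T" "s \<noteq> 0" for s w T T' :: complex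
  proof -
    have "2 * (s * T') = 2 * (w * T)" using that(1) by (simp only: mult.assoc)
    then have "s * T' = w * T" by (simp only: mult_cancel_left) simp
    then show ?thesis using that(2) by (simp add: nonzero_eq_divide_eq mult.commute)
  qed
  have "level_sum ?f (Suc n) = (2 * z * z' + of_nat n) * level_sum ?f n / of_nat (Suc n)"
    by (rule solve[OF rec of_nat_neq_0])
  then show ?case unfolding Suc.IH by (simp add: pochhammer_Suc mult_ac)
qed (simp add: level_sum_0)

section \<open>Pfaffian minors on the image of the embedding\<close>

definition frob_set :: "nat \<Rightarrow> (nat \<Rightarrow> nat) \<Rightarrow> (nat \<Rightarrow> nat) \<Rightarrow> real set" where
  "frob_set D P Q = (\<lambda>i. - real (Q i) - 1/2) ` {..<D} \<union>
    ((if odd D then {1/2} else {}) \<union> (\<lambda>i. real (P i) + 1/2) ` {i. even i \<and> i + 1 < D})"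

definition neg_list :: "nat \<Rightarrow> (nat \<Rightarrow> nat) \<Rightarrow> real list" where
  "neg_list D Q = map (\<lambda>i. - real (Q i) - 1/2) [0..<D]"

definition half_list :: "nat \<Rightarrow> real list" where
  "half_list D = (if odd D then [1/2] else [])"

definition pos_list :: "nat \<Rightarrow> (nat \<Rightarrow> nat) \<Rightarrow> real list" where
  "pos_list k P = map (\<lambda>r. real (P (2 * r)) + 1/2) (rev [0..<k])"

text \<open>In each pair \<open>y', y''\<close> the order is reversed, which makes the values of \<^const>\<open>col_pt\<close> increasing.\<close>

definition col_list :: "nat \<Rightarrow> (nat \<Rightarrow> nat) \<Rightarrow> (real \<times> bool) list" where
  "col_list D P = map (\<lambda>x. (x, True)) (half_list D) @
    interleave (map (\<lambda>y. (y, True)) (pos_list (D div 2) P)) (map (\<lambda>y. (y, False)) (pos_list (D div 2) P))"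

lemma X_embed_frob_set:
  "X_embed \<mu> = frob_set (diag_len (double_rows (transpose_young \<mu>)))
    (frob_P (double_rows (transpose_young \<mu>))) (frob_Q (double_rows (transpose_young \<mu>)))"
  unfolding X_embed_def X_minus_def X_plus_def Let_def frob_set_def
  by (intro arg_cong2[where f = "(\<union>)"]) (auto simp: image_iff)

lemma set_frob_lists: "set (neg_list D Q @ half_list D @ pos_list (D div 2) P) = frob_set D P Q"
proof -
  have img: "(\<lambda>r. real (P (2 * r)) + 1/2) ` {0..<D div 2} = (\<lambda>i. real (P i) + 1/2) ` {i. even i \<and> i + 1 < D}"
  proof (intro equalityI subsetI)
    fix x assume "x \<in> (\<lambda>r. real (P (2 * r)) + 1/2) ` {0..<D div 2}"
    then obtain r where "r < D div 2" "x = real (P (2 * r)) + 1/2" by auto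
    then show "x \<in> (\<lambda>i. real (P i) + 1/2) ` {i. even i \<and> i + 1 < D}"
      by (intro image_eqI[of _ _ "2 * r"]) auto
  next
    fix x assume "x \<in> (\<lambda>i. real (P i) + 1/2) ` {i. even i \<and> i + 1 < D}"
    then obtain i where "even i" "i + 1 < D" "x = real (P i) + 1/2" by auto
    then show "x \<in> (\<lambda>r. real (P (2 * r)) + 1/2) ` {0..<D div 2}"
      by (intro image_eqI[of _ _ "i div 2"]) auto
  qed
  show ?thesis
    unfolding frob_set_def img[symmetric]
    by (auto simp: neg_list_def half_list_def pos_list_def)
qed

lemma abs_half_parity:
  "odd_pt (- real q - 1/2) \<longleftrightarrow> odd q" "even_pt (- real q - 1/2) \<longleftrightarrow> even q"
proof -
  have abs: "\<bar>- real q - 1/2\<bar> = real q + 1/2" by simp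
  have odd: "real q + 1/2 = 2 * real k + 3/2 \<longleftrightarrow> q = 2 * k + 1" for k
  proof -
    have "real q + 1/2 = 2 * real k + 3/2 \<longleftrightarrow> real q = real (2 * k + 1)" by (rule iffI; simp)
    then show ?thesis by (simp only: of_nat_eq_iff)
  qed
  show "odd_pt (- real q - 1/2) \<longleftrightarrow> odd q" unfolding odd_pt_def abs odd by (auto elim: oddE)
  have even: "real q + 1/2 = 2 * real k + 1/2 \<longleftrightarrow> q = 2 * k" for k
  proof -
    have "real q + 1/2 = 2 * real k + 1/2 \<longleftrightarrow> real q = real (2 * k)" by (rule iffI; simp)
    then show ?thesis by (simp only: of_nat_eq_iff)
  qed
  show "even_pt (- real q - 1/2) \<longleftrightarrow> even q" unfolding even_pt_def abs even dvd_def ..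
qed

lemma even_pt_half: "even_pt (1/2)"
  unfolding even_pt_def by (rule exI[of _ 0]) simp

lemma alternating_nth:
  "alternating zs \<longleftrightarrow> even (length zs) \<and> (\<forall>i<length zs. if even i then odd_pt (zs ! i) else even_pt (zs ! i))"
  by (induction zs rule: alternating.induct) (auto simp: All_less_Suc2)

text \<open>The point of coordinate \<open>Q i\<close> has the parity of \<open>Q i\<close>, and
  position \<open>i\<close> asks for an odd point if \<open>i\<close> is even. For odd
  \<open>D\<close> the even point \<open>1/2\<close> fills the last position and makes the length
  even.\<close>

lemma alternating_neg_list:
  "alternating (neg_list D Q @ half_list D) \<longleftrightarrow> (\<forall>i<D. even (Q i) \<longleftrightarrow> odd i)"
proof -
  have len: "length (neg_list D Q @ half_list D) = (if odd D then Suc D else D)"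
    by (simp add: neg_list_def half_list_def)
  have nth: "(neg_list D Q @ half_list D) ! i = - real (Q i) - 1/2" if "i < D" for i
    using that by (simp add: neg_list_def nth_append)
  have last: "even_pt ((neg_list D Q @ half_list D) ! D)" if "odd D"
    using that even_pt_half by (simp add: neg_list_def half_list_def nth_append)
  have par: "(if even i then odd_pt ((neg_list D Q @ half_list D) ! i) else even_pt ((neg_list D Q @ half_list D) ! i))
      \<longleftrightarrow> (even (Q i) \<longleftrightarrow> odd i)" if "i < D" for i
    unfolding nth[OF that] abs_half_parity by auto
  show ?thesis
  proof (cases "odd D")
    case True
    then show ?thesis
      unfolding alternating_nth len using par last by (auto simp: All_less_Suc)
  next
    case False
    then show ?thesis unfolding alternating_nth len using par by auto
  qed
qed

text \<open>The first copy of the point of \<open>P (2 * r)\<close> is the column of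
  \<open>P (2 * r)\<close>; its second copy, shifted down by 1, is the column of
  \<open>P (2 * r + 1)\<close>.\<close>

lemma map_col_pt_pairs:
  assumes "\<And>r. r < k \<Longrightarrow> P (2 * r) = Suc (P (2 * r + 1))"
  shows "map col_pt (interleave (map (\<lambda>y. (y, True)) (pos_list k P)) (map (\<lambda>y. (y, False)) (pos_list k P))) =
    rev (map (\<lambda>i. real (P i) + 1/2) [0..<2 * k])"
  using assms
proof (induction k)
  case (Suc k)
  have "P (2 * k) = Suc (P (2 * k + 1))" using Suc.prems by simp
  moreover have "[0..<2 * Suc k] = [0..<2 * k] @ [2 * k, 2 * k + 1]" by simp
  ultimately show ?case using Suc by (simp add: pos_list_def col_pt_def)
qed (simp add: pos_list_def)

lemma map_col_pt_col_list:
  assumes "\<And>i. even i \<Longrightarrow> i + 1 < D \<Longrightarrow> P i = Suc (P (i + 1))" "odd D \<Longrightarrow> P (D - 1) = 0"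
  shows "map col_pt (col_list D P) = rev (map (\<lambda>i. real (P i) + 1/2) [0..<D])"
proof -
  have pairs: "map col_pt (interleave (map (\<lambda>y. (y, True)) (pos_list (D div 2) P)) (map (\<lambda>y. (y, False)) (pos_list (D div 2) P))) =
    rev (map (\<lambda>i. real (P i) + 1/2) [0..<2 * (D div 2)])"
  proof (rule map_col_pt_pairs)
    show "P (2 * r) = Suc (P (2 * r + 1))" if "r < D div 2" for r
      using assms(1)[of "2 * r"] that by simp
  qed
  show ?thesis
  proof (cases "odd D")
    case True
    then obtain k where D: "D = 2 * k + 1" by (auto elim: oddE)
    then have k: "D div 2 = k" by simp
    have "map col_pt (map (\<lambda>x. (x, True)) (half_list D)) = [1/2]"
      using True by (simp add: half_list_def col_pt_def)
    then show ?thesis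
      unfolding col_list_def map_append pairs unfolding k using assms(2)[OF True] by (simp add: D)
  next
    case False
    then obtain k where D: "D = 2 * k" by (auto elim: evenE)
    then have k: "D div 2 = k" by simp
    have "map col_pt (map (\<lambda>x. (x, True)) (half_list D)) = []"
      using False by (simp add: half_list_def)
    then show ?thesis
      unfolding col_list_def map_append pairs unfolding k by (simp add: D)
  qed
qed

lemma prod_triangle_swap:
  fixes g :: "nat \<Rightarrow> nat \<Rightarrow> 'a::comm_monoid_mult"
  shows "(\<Prod>j<D. \<Prod>i<j. g i j) = (\<Prod>i<D. \<Prod>j\<in>{i<..<D}. g i j)"
proof (induction D)
  case (Suc D)
  have "(\<Prod>i<D. \<Prod>j\<in>{i<..<Suc D}. g i j) = (\<Prod>i<D. g i D * (\<Prod>j\<in>{i<..<D}. g i j))"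
  proof (intro prod.cong refl)
    fix i assume "i \<in> {..<D}"
    then have "{i<..<Suc D} = insert D {i<..<D}" by auto
    then show "(\<Prod>j\<in>{i<..<Suc D}. g i j) = g i D * (\<Prod>j\<in>{i<..<D}. g i j)" by simp
  qed
  moreover have "{D<..<Suc D} = {}" by auto
  ultimately show ?case using Suc.IH by (simp add: prod.distrib mult.commute)
qed simp

lemma prod_triangle_reverse:
  fixes g :: "nat \<Rightarrow> nat \<Rightarrow> 'a::comm_monoid_mult"
  shows "(\<Prod>j<D. \<Prod>i<j. g (D - 1 - j) (D - 1 - i)) = (\<Prod>i<D. \<Prod>j\<in>{i<..<D}. g i j)"
proof -
  have "(\<Prod>j<D. \<Prod>i<j. g (D - 1 - j) (D - 1 - i)) = (\<Prod>a<D. \<Prod>i<D - 1 - a. g a (D - 1 - i))"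
    by (rule prod.reindex_bij_witness[of _ "\<lambda>a. D - 1 - a" "\<lambda>a. D - 1 - a"]) auto
  also have "\<dots> = (\<Prod>a<D. \<Prod>b\<in>{a<..<D}. g a b)"
  proof (rule prod.cong[OF refl])
    fix a assume "a \<in> {..<D}"
    then show "(\<Prod>i<D - 1 - a. g a (D - 1 - i)) = (\<Prod>b\<in>{a<..<D}. g a b)"
      by (intro prod.reindex_bij_witness[of _ "\<lambda>b. D - 1 - b" "\<lambda>i. D - 1 - i"]) auto
  qed
  finally show ?thesis .
qed

text \<open>Both families of nodes increase, the \<open>Q\<close> by negation and the
  \<open>P\<close> by reversal, which turns the Vandermonde products into those of decreasing
  coordinates. The denominators are \<open>- (P + Q + 1)\<close>; there are \<open>D * D\<close> of
  them, with total sign \<open>(-1) ^ D\<close>.\<close>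

lemma cauchy_frobenius:
  "cauchy D (\<lambda>i. of_real (- real (Q i) - 1/2)) (\<lambda>i. of_real (real (P (D - 1 - i)) + 1/2)) =
    (-1) ^ (\<Sum>{..<D}) * (-1) ^ D * of_real ((\<Prod>i<D. \<Prod>k\<in>{i<..<D}. real (P i) - real (P k)) *
      (\<Prod>i<D. \<Prod>k\<in>{i<..<D}. real (Q i) - real (Q k)) / (\<Prod>i<D. \<Prod>j<D. real (P i) + real (Q j) + 1))"
proof -
  have VQ: "vandermonde D (\<lambda>i. of_real (- real (Q i) - 1/2)) = of_real (\<Prod>i<D. \<Prod>k\<in>{i<..<D}. real (Q i) - real (Q k))"
    unfolding vandermonde_def prod_triangle_swap[symmetric] of_real_prod by (intro prod.cong refl) simp
  have VP: "vandermonde D (\<lambda>i. of_real (real (P (D - 1 - i)) + 1/2)) = of_real (\<Prod>i<D. \<Prod>k\<in>{i<..<D}. real (P i) - real (P k))"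
    unfolding vandermonde_def prod_triangle_reverse[symmetric] of_real_prod by (intro prod.cong refl) simp
  have "(\<Prod>i<D. \<Prod>j<D. complex_of_real (- real (Q i) - 1/2) - of_real (real (P (D - 1 - j)) + 1/2)) =
      (\<Prod>i<D. (-1) ^ D * of_real (\<Prod>j<D. real (P j) + real (Q i) + 1))"
  proof (intro prod.cong refl)
    fix i
    have "(\<Prod>j<D. complex_of_real (- real (Q i) - 1/2) - of_real (real (P (D - 1 - j)) + 1/2)) =
        (\<Prod>j<D. - 1 * of_real (real (P (D - 1 - j)) + real (Q i) + 1))"
      by (intro prod.cong refl) simp
    also have "\<dots> = (-1) ^ D * (\<Prod>j<D. of_real (real (P (D - 1 - j)) + real (Q i) + 1))"
      unfolding prod.distrib by simp
    also have "(\<Prod>j<D. complex_of_real (real (P (D - 1 - j)) + real (Q i) + 1)) = (\<Prod>j<D. of_real (real (P j) + real (Q i) + 1))"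
      by (rule prod.reindex_bij_witness[of _ "\<lambda>j. D - 1 - j" "\<lambda>j. D - 1 - j"]) auto
    finally show "(\<Prod>j<D. complex_of_real (- real (Q i) - 1/2) - of_real (real (P (D - 1 - j)) + 1/2)) =
        (-1) ^ D * of_real (\<Prod>j<D. real (P j) + real (Q i) + 1)" by simp
  qed
  also have "\<dots> = ((-1) ^ D) ^ D * of_real (\<Prod>i<D. \<Prod>j<D. real (P j) + real (Q i) + 1)"
    unfolding prod.distrib by simp
  also have "((-1) ^ D) ^ D = ((-1) ^ D :: complex)"
    by (cases "even D") auto
  also have "(\<Prod>i<D. \<Prod>j<D. real (P j) + real (Q i) + 1) = (\<Prod>i<D. \<Prod>j<D. real (P i) + real (Q j) + 1)"
    by (rule prod.swap)
  finally have R: "(\<Prod>i<D. \<Prod>j<D. complex_of_real (- real (Q i) - 1/2) - of_real (real (P (D - 1 - j)) + 1/2)) =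
      (-1) ^ D * of_real (\<Prod>i<D. \<Prod>j<D. real (P i) + real (Q j) + 1)" .
  have "s * q * p / (e * r) = s * e * (p * q / r)" if "e * e = 1" for s q p e r :: complex
  proof -
    have "e \<noteq> 0" using that by auto
    then have "s * q * p / (e * r) = s * ((e * e) * (q * p)) / (e * r)" using that by simp
    also have "\<dots> = s * e * (p * q / r)" using \<open>e \<noteq> 0\<close> by (simp add: mult_ac)
    finally show ?thesis .
  qed
  from this[of "(-1) ^ D"] show ?thesis
    unfolding cauchy_def VQ VP R by (simp add: power_mult_distrib[symmetric])
qed

text \<open>The exponent is \<open>k * (2 * k - 1)\<close>, which has the parity of
  \<open>k\<close>.\<close>

lemma sign_sum_lessThan_double: "(-1) ^ (\<Sum>{..<2 * k}) = ((-1) ^ k :: complex)"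
proof (induction k)
  case (Suc k)
  have "\<Sum>{..<2 * Suc k} = \<Sum>{..<2 * k} + (2 * (2 * k) + 1)" by simp
  then show ?case using Suc.IH by (simp add: power_add)
qed simp

lemma frob_lists:
  assumes df: "doubled_frobenius D P Q"
  shows "sorted_wrt (<) (neg_list D Q @ half_list D @ pos_list (D div 2) P)"
    and "\<And>y. y \<in> set (pos_list (D div 2) P) \<Longrightarrow> y \<ge> 3/2"
    and "sorted_list_of_set (frob_set D P Q) = neg_list D Q @ half_list D @ pos_list (D div 2) P"
    and "distinct (map col_pt (col_list D P))"
    and "map col_pt (col_list D P) = rev (map (\<lambda>i. real (P i) + 1/2) [0..<D])"
proof -
  note Pdec = doubled_frobeniusD(1)[OF df] and Qdec = doubled_frobeniusD(2)[OF df]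
    and pair = doubled_frobeniusD(4)[OF df] and last = doubled_frobeniusD(5)[OF df]
  show ys: "y \<ge> 3/2" if y: "y \<in> set (pos_list (D div 2) P)" for y
  proof -
    obtain r where r: "r < D div 2" "y = real (P (2 * r)) + 1/2" using y by (auto simp: pos_list_def)
    then show ?thesis using pair[of "2 * r"] by simp
  qed
  have s1: "sorted_wrt (<) (neg_list D Q)"
    by (auto simp: neg_list_def sorted_wrt_iff_nth_less Qdec)
  have s3: "sorted_wrt (<) (pos_list (D div 2) P)"
    by (auto simp: pos_list_def sorted_wrt_iff_nth_less rev_nth intro!: Pdec)
  have s2: "sorted_wrt (<) (half_list D)" by (simp add: half_list_def)
  have n: "x < 0" if "x \<in> set (neg_list D Q)" for x using that by (auto simp: neg_list_def)
  have h: "x = 1/2" if "x \<in> set (half_list D)" for x using that by (auto simp: half_list_def split: if_splits)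
  show srt: "sorted_wrt (<) (neg_list D Q @ half_list D @ pos_list (D div 2) P)"
    unfolding sorted_wrt_append using s1 s2 s3 n h ys by (fastforce simp: set_append)
  show "sorted_list_of_set (frob_set D P Q) = neg_list D Q @ half_list D @ pos_list (D div 2) P"
    unfolding set_frob_lists[symmetric]
    by (rule sorted_list_of_set.idem_if_sorted_distinct)
       (use srt in \<open>auto simp: strict_sorted_iff simp del: sorted_wrt_append sorted_append distinct_append\<close>)
  show m: "map col_pt (col_list D P) = rev (map (\<lambda>i. real (P i) + 1/2) [0..<D])"
    by (rule map_col_pt_col_list) (rule pair last; assumption)+
  have "inj_on (\<lambda>i. real (P i) + 1/2) {0..<D}"
  proof (rule inj_onI)
    fix i j assume "i \<in> {0..<D}" "j \<in> {0..<D}" "real (P i) + 1/2 = real (P j) + 1/2"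
    then show "i = j" using Pdec[of i j] Pdec[of j i] by (cases i j rule: linorder_cases) auto
  qed
  then show "distinct (map col_pt (col_list D P))"
    unfolding m by (simp add: distinct_map)
qed

lemma half_ints_frob_lists:
  "set (neg_list D Q @ half_list D @ pos_list k P) \<subseteq> half_ints"
proof
  fix x assume "x \<in> set (neg_list D Q @ half_list D @ pos_list k P)"
  then consider i where "x = - real (Q i) - 1/2" | "x = 1/2" | i where "x = real (P i) + 1/2"
    by (auto simp: neg_list_def half_list_def pos_list_def split: if_splits)
  then show "x \<in> half_ints"
  proof cases
    case (1 i)
    then show ?thesis unfolding half_ints_def by (intro CollectI exI[of _ "- int (Q i) - 1"]) simp
  next
    case 2
    then show ?thesis unfolding half_ints_def by (intro CollectI exI[of _ 0]) simp
  next
    case (3 i)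
    then show ?thesis unfolding half_ints_def by (intro CollectI exI[of _ "int (P i)"]) simp
  qed
qed

text \<open>Two signs are combined: with \<open>k = D div 2\<close>, unshuffling the points below 1
  gives \<open>(-1) ^ k\<close> for even \<open>D\<close> and \<open>(-1) ^ Suc k\<close> for odd
  \<open>D\<close>, while reversing the order inside the \<open>k\<close> pairs of columns gives
  \<open>(-1) ^ k\<close>.\<close>

lemma pf_list_frob_lists:
  fixes h :: "real \<Rightarrow> complex"
  assumes "sorted_wrt (<) (neg_list D Q @ half_list D)" "\<And>y. y \<in> set (pos_list (D div 2) P) \<Longrightarrow> y \<ge> 3/2"
  shows "pf_list (entry (L_mat h)) (doubled (neg_list D Q @ half_list D @ pos_list (D div 2) P)) =
    (if alternating (neg_list D Q @ half_list D)
     then (-1) ^ D * pf_list (entry (L_mat h)) (map (\<lambda>x. (x, True)) (neg_list D Q) @ col_list D P) else 0)"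
proof -
  let ?A = "entry (L_mat h)" and ?ns = "neg_list D Q" and ?os = "half_list D" and ?ys = "pos_list (D div 2) P"
  let ?T = "map (\<lambda>x. (x, True))"
  have "(-1) ^ (\<Sum>{..<length (?ns @ ?os)}) * (-1) ^ length ?ys = ((-1) ^ D :: complex)"
  proof (cases "odd D")
    case True
    then obtain k where D: "D = 2 * k + 1" by (auto elim: oddE)
    have len: "length (?ns @ ?os) = 2 * Suc k" "length ?ys = k"
      by (auto simp: neg_list_def half_list_def pos_list_def D)
    have "(-1) ^ (\<Sum>{..<length (?ns @ ?os)}) = ((-1) ^ Suc k :: complex)"
      unfolding len(1) by (rule sign_sum_lessThan_double)
    moreover have "(-1) ^ Suc k * (-1) ^ k = ((-1) ^ D :: complex)"
      unfolding D by (simp add: power_mult_distrib[symmetric])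
    ultimately show ?thesis unfolding len(2) by (simp only:)
  next
    case False
    then obtain k where D: "D = 2 * k" by (auto elim: evenE)
    have len: "length (?ns @ ?os) = 2 * k" "length ?ys = k"
      by (auto simp: neg_list_def half_list_def pos_list_def D)
    have "(-1) ^ (\<Sum>{..<length (?ns @ ?os)}) = ((-1) ^ k :: complex)"
      unfolding len(1) by (rule sign_sum_lessThan_double)
    moreover have "(-1) ^ k * (-1) ^ k = ((-1) ^ D :: complex)"
      unfolding D by (simp add: power_mult_distrib[symmetric])
    ultimately show ?thesis unfolding len(2) by (simp only:)
  qed
  moreover have "pf_list ?A (?T ?ns @ ?T ?os @ doubled ?ys) = (-1) ^ length ?ys * pf_list ?A (?T ?ns @ col_list D P)"
    using pf_list_interleave_flip[of "map (\<lambda>x. (x, False)) ?ys" "?T ?ys" "?T ?ns @ ?T ?os" ?A]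
    by (simp add: doubled_def col_list_def neg_list_def half_list_def)
  moreover have "pf_list ?A (doubled (?ns @ ?os @ ?ys)) =
    (if alternating (?ns @ ?os)
     then (-1) ^ (\<Sum>{..<length (?ns @ ?os)}) * pf_list ?A (?T ?ns @ ?T ?os @ doubled ?ys) else 0)"
    by (rule pf_list_L_mat[OF assms(1) half_ints_frob_lists _ _ assms(2)])
       (auto simp: neg_list_def half_list_def)
  ultimately show ?thesis by (simp add: mult.assoc[symmetric] del: length_append)
qed

lemma col_list_mem: "(\<And>y. y \<in> set (pos_list (D div 2) P) \<Longrightarrow> y \<ge> 3/2) \<Longrightarrow>
    (y, b) \<in> set (col_list D P) \<Longrightarrow> y \<ge> 3/2 \<or> y = 1/2 \<and> b"
  by (auto simp: col_list_def set_interleave half_list_def split: if_splits)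

lemma length_col_list [simp]: "length (col_list D P) = D"
  by (auto simp: col_list_def half_list_def pos_list_def)

lemma length_neg_list [simp]: "length (neg_list D Q) = D"
  by (simp add: neg_list_def)

lemma Pf_minor_L_mat_frob_set:
  assumes df: "doubled_frobenius D P Q"
  shows "Pf_minor (L_mat h) (frob_set D P Q) = (\<Prod>i<D. h (- real (Q i) - 1/2)) * (\<Prod>i<D. h (real (P i) + 1/2)) *
    of_real ((\<Prod>i<D. \<Prod>k\<in>{i<..<D}. real (P i) - real (P k)) *
      (\<Prod>i<D. \<Prod>k\<in>{i<..<D}. real (Q i) - real (Q k)) / (\<Prod>i<D. \<Prod>j<D. real (P i) + real (Q j) + 1))"
proof -
  let ?A = "entry (L_mat h)" and ?cs = "col_list D P"
  note lists = frob_lists[OF df]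
  have srt: "sorted_wrt (<) (neg_list D Q @ half_list D)"
    using lists(1) by (simp add: sorted_wrt_append)
  have alt: "alternating (neg_list D Q @ half_list D)"
    unfolding alternating_neg_list using doubled_frobeniusD(3)[OF df] by blast
  have ph: "prod_list (map h (neg_list D Q)) = (\<Prod>i<D. h (- real (Q i) - 1/2))"
    using prod.distinct_set_conv_list[of "[0..<D]" "\<lambda>i. h (- real (Q i) - 1/2)"]
    by (simp add: neg_list_def o_def atLeast0LessThan)
  have "prod_list (map (\<lambda>v. h (col_pt v)) ?cs) = prod_list (map h (map col_pt ?cs))"
    by (simp add: o_def)
  also have "\<dots> = prod_list (map (\<lambda>i. h (real (P i) + 1/2)) (rev [0..<D]))"
    unfolding lists(5) by (simp add: rev_map o_def)
  also have "\<dots> = (\<Prod>i<D. h (real (P i) + 1/2))"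
    using prod.distinct_set_conv_list[of "rev [0..<D]" "\<lambda>i. h (real (P i) + 1/2)"]
    by (simp add: atLeast0LessThan)
  finally have pc: "prod_list (map (\<lambda>v. h (col_pt v)) ?cs) = (\<Prod>i<D. h (real (P i) + 1/2))" .
  have col: "col_pt (?cs ! i) = real (P (D - 1 - i)) + 1/2" if "i < D" for i
  proof -
    have "map col_pt ?cs ! i = rev (map (\<lambda>i. real (P i) + 1/2) [0..<D]) ! i" unfolding lists(5) ..
    then show ?thesis using that by (simp add: rev_nth)
  qed
  have "cauchy D (\<lambda>i. of_real (neg_list D Q ! i)) (\<lambda>i. of_real (col_pt (?cs ! i))) =
      cauchy D (\<lambda>i. of_real (- real (Q i) - 1/2)) (\<lambda>i. of_real (real (P (D - 1 - i)) + 1/2))"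
    by (rule cauchy_cong) (auto simp: neg_list_def col)
  note C = this[unfolded cauchy_frobenius]
  have neg: "x < 0" if "x \<in> set (neg_list D Q)" for x
    using that by (auto simp: neg_list_def)
  have mem: "y \<ge> 3/2 \<or> y = 1/2 \<and> b" if "(y, b) \<in> set ?cs" for y b
    by (rule col_list_mem[OF lists(2) that])
  have "pf_list ?A (map (\<lambda>x. (x, True)) (neg_list D Q) @ ?cs) = (-1) ^ (\<Sum>{..<length (neg_list D Q)}) *
     (prod_list (map h (neg_list D Q)) * prod_list (map (\<lambda>v. h (col_pt v)) ?cs) *
      cauchy (length (neg_list D Q)) (\<lambda>i. of_real (neg_list D Q ! i)) (\<lambda>i. of_real (col_pt (?cs ! i))))"
    by (rule pf_list_bipartite(2)[OF neg mem _ _ lists(4)]) simp_all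
  then have "pf_list ?A (map (\<lambda>x. (x, True)) (neg_list D Q) @ ?cs) = (-1) ^ (\<Sum>{..<D}) *
     ((\<Prod>i<D. h (- real (Q i) - 1/2)) * (\<Prod>i<D. h (real (P i) + 1/2)) *
      cauchy D (\<lambda>i. of_real (neg_list D Q ! i)) (\<lambda>i. of_real (col_pt (?cs ! i))))"
    unfolding ph pc length_neg_list .
  moreover have "pf_list ?A (doubled (neg_list D Q @ half_list D @ pos_list (D div 2) P)) =
    (if alternating (neg_list D Q @ half_list D)
     then (-1) ^ D * pf_list ?A (map (\<lambda>x. (x, True)) (neg_list D Q) @ ?cs) else 0)"
    by (rule pf_list_frob_lists[OF srt]) (rule lists(2))
  then have "Pf_minor (L_mat h) (frob_set D P Q) = (-1) ^ D * pf_list ?A (map (\<lambda>x. (x, True)) (neg_list D Q) @ ?cs)"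
    unfolding Pf_minor_pf_list lists(3) if_P[OF alt] .
  \<comment> \<open>The signs of the list order and of the bipartite unshuffling each meet their
    equals from the Cauchy determinant, so the minor is a plain product.\<close>
  moreover have cancel: "e * (s * (a * b * (s * e * x))) = a * b * x" if "e * e = 1" "s * s = 1" for e s a b x :: complex
  proof -
    have "e * (s * (a * b * (s * e * x))) = (e * e) * (s * s) * (a * b * x)" by (simp only: mult_ac)
    then show ?thesis using that by simp
  qed
  have sq: "(-1) ^ n * (-1) ^ n = (1::complex)" for n by (simp add: power_mult_distrib[symmetric])
  ultimately show ?thesis unfolding C by (simp only: cancel[OF sq sq])
qed

text \<open>Nonvanishing of the two factors encodes the conditions on the coordinates: the
  \<open>eps\<close> factor gives the parities of \<open>Q\<close>, and the Cauchy factor forces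
  equally many negative points and columns, with distinct columns.\<close>

lemma Pf_minor_L_mat_nonzero:
  assumes X: "finite X" "X \<subseteq> half_ints" and nz: "Pf_minor (L_mat h) X \<noteq> 0"
  obtains D P Q where "doubled_frobenius D P Q" "X = frob_set D P Q"
proof -
  define ns where "ns = sorted_list_of_set (X \<inter> {..<0})"
  define os where "os = (if 1/2 \<in> X then [1/2 :: real] else [])"
  define ys where "ys = sorted_list_of_set (X \<inter> {1..})"
  define D where "D = length ns"
  define k where "k = length ys"
  let ?A = "entry (L_mat h)"
  have "set (if a \<in> X then [a] else []) = X \<inter> {a}" for a by auto
  then have "set os = X \<inter> {1/2}" unfolding os_def .
  then have sets: "set ns = X \<inter> {..<0}" "set ys = X \<inter> {1..}" "set os = X \<inter> {1/2}"
    using X(1) by (simp_all add: ns_def ys_def)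
  have srt: "sorted_wrt (<) ns" "sorted_wrt (<) ys"
    unfolding ns_def ys_def by (rule strict_sorted_list_of_set)+
  have ys: "y \<ge> 3/2" if "y \<in> set ys" for y
  proof -
    have "y \<in> half_ints" "y \<ge> 1" using that X(2) sets by auto
    then show ?thesis by (cases rule: half_ints_cases) auto
  qed
  have ns: "x < 0" if "x \<in> set ns" for x using that sets by auto
  have sX: "set (ns @ os @ ys) = X"
  proof -
    have cover: "x < 0 \<or> x = 1/2 \<or> x \<ge> 1" if "x \<in> X" for x
    proof -
      have "x \<in> half_ints" using that X(2) by blast
      then show ?thesis by (cases rule: half_ints_cases) simp_all
    qed
    show ?thesis
      unfolding set_append sets using cover by (auto simp only: Int_iff Un_iff lessThan_iff atLeast_iff singleton_iff)
  qed
  have srt_no: "sorted_wrt (<) (ns @ os)"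
    unfolding sorted_wrt_append by (cases "1/2 \<in> X") (auto simp: os_def srt dest!: ns)
  have srt_all: "sorted_wrt (<) (ns @ os @ ys)"
    unfolding sorted_wrt_append by (cases "1/2 \<in> X") (auto simp: os_def srt dest!: ns ys)
  have list: "sorted_list_of_set X = ns @ os @ ys"
    unfolding sX[symmetric]
    by (rule sorted_list_of_set.idem_if_sorted_distinct)
       (use srt_all in \<open>auto simp: strict_sorted_iff simp del: sorted_wrt_append sorted_append distinct_append\<close>)
  let ?vs = "map (\<lambda>x. (x, True)) os @ doubled ys"
  have pf: "Pf_minor (L_mat h) X = (if alternating (ns @ os)
     then (-1) ^ (\<Sum>{..<length (ns @ os)}) * pf_list ?A (map (\<lambda>x. (x, True)) ns @ ?vs) else 0)"
    unfolding Pf_minor_pf_list list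
    by (rule pf_list_L_mat[OF srt_no]) (use sX X(2) ns ys in \<open>auto simp: os_def\<close>)
  have alt: "alternating (ns @ os)" and nz2: "pf_list ?A (map (\<lambda>x. (x, True)) ns @ ?vs) \<noteq> 0"
    using nz unfolding pf by (auto split: if_splits)
  have ev: "even (length ns + length ?vs)"
    using alt unfolding alternating_nth by simp
  have mem: "y \<ge> 3/2 \<or> y = 1/2 \<and> b" if "(y, b) \<in> set ?vs" for y b
    using that ys by (auto simp: os_def split: if_splits)
  have vanish: "pf_list ?A (map (\<lambda>x. (x, True)) ns @ ?vs) = 0"
    if "length ns \<noteq> length ?vs \<or> \<not> distinct (map col_pt ?vs)"
    by (rule pf_list_bipartite(1)[OF _ _ ev that]) (rule ns mem; assumption)+
  have len: "length ns = length ?vs" and dist: "distinct (map col_pt ?vs)"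
    using vanish nz2 by blast+
  have D: "D = length os + 2 * k" using len by (simp add: D_def k_def)
  have odd_D: "odd D \<longleftrightarrow> 1/2 \<in> X" unfolding D by (simp add: os_def)
  have Dk: "D div 2 = k" unfolding D by (simp add: os_def)
  have os: "os = half_list D" unfolding half_list_def odd_D os_def ..
  define Q where "Q = (\<lambda>i. nat \<lfloor>- (ns ! i) - 1/2\<rfloor>)"
  define p where "p = (\<lambda>r. nat \<lfloor>ys ! (k - 1 - r) - 1/2\<rfloor>)"
  \<comment> \<open>Each point above 1, taken in decreasing order, yields two consecutive values.
    The value 0 beyond them is the last coordinate when \<open>D\<close> is odd.\<close>
  define P where "P = (\<lambda>i. if i < 2 * k then p (i div 2) - i mod 2 else 0)"
  have Qn: "ns ! i = - real (Q i) - 1/2" if "i < D" for i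
  proof -
    have "ns ! i \<in> set ns" using that by (simp add: D_def)
    then have "ns ! i < 0" "ns ! i \<in> half_ints" using ns sets X(2) by auto
    then obtain j :: int where j: "ns ! i = of_int j + 1/2" by (auto simp: half_ints_def)
    then have "j < 0" using \<open>ns ! i < 0\<close> by linarith
    have "- (ns ! i) - 1/2 = of_int (- j - 1)" using j by simp
    then have "Q i = nat (- j - 1)" unfolding Q_def by (simp only: floor_of_int)
    then show ?thesis using j \<open>j < 0\<close> by simp
  qed
  have pn: "ys ! (k - 1 - r) = real (p r) + 1/2 \<and> p r \<ge> 1" if "r < k" for r
  proof -
    have "ys ! (k - 1 - r) \<in> set ys" using that by (simp add: k_def)
    then have y: "ys ! (k - 1 - r) \<ge> 3/2" "ys ! (k - 1 - r) \<in> half_ints" using ys sets X(2) by auto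
    then obtain j :: int where j: "ys ! (k - 1 - r) = of_int j + 1/2" by (auto simp: half_ints_def)
    then have "j \<ge> 1" using y(1) by linarith
    have "ys ! (k - 1 - r) - 1/2 = of_int j" using j by simp
    then have "p r = nat j" unfolding p_def by (simp only: floor_of_int)
    then show ?thesis using j \<open>j \<ge> 1\<close> by simp
  qed
  have P2: "P (2 * r) = p r" "P (2 * r + 1) = p r - 1" if "r < k" for r
    using that by (auto simp: P_def)
  have nsl: "ns = neg_list D Q"
    by (rule nth_equalityI) (auto simp: D_def[symmetric] neg_list_def Qn)
  have ysl: "ys = pos_list (D div 2) P"
  proof (rule nth_equalityI)
    show "length ys = length (pos_list (D div 2) P)" unfolding Dk by (simp add: pos_list_def k_def)
    fix i assume "i < length ys"
    then have i: "i < k" by (simp add: k_def)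
    have "ys ! i = ys ! (k - 1 - (k - 1 - i))" using i by simp
    also have "\<dots> = real (p (k - 1 - i)) + 1/2" using pn[of "k - 1 - i"] i by simp
    also have "\<dots> = pos_list (D div 2) P ! i"
      unfolding Dk using i P2(1)[of "k - 1 - i"] by (simp add: pos_list_def rev_nth)
    finally show "ys ! i = pos_list (D div 2) P ! i" .
  qed
  have pair: "P i = Suc (P (i + 1))" if "even i" "i + 1 < D" for i
  proof -
    have "i div 2 < k" "i = 2 * (i div 2)" using that Dk by auto
    then show ?thesis using P2[of "i div 2"] pn[of "i div 2"] by simp
  qed
  have last: "P (D - 1) = 0" if "odd D"
  proof -
    have "D = 2 * k + 1" using that Dk by presburger
    then show ?thesis by (simp add: P_def)
  qed
  \<comment> \<open>\<open>col_list\<close> only reorders the columns of the minor, so their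
    distinctness carries over; it turns the weak decrease of \<open>P\<close>, which the order of
    the points provides, into a strict one.\<close>
  have "mset (col_list D P) = mset ?vs"
  proof -
    have "mset (interleave as bs) = mset as + mset bs" if "length as = length bs" for as bs :: "(real \<times> bool) list"
      using that by (induction as bs rule: list_induct2) auto
    then show ?thesis
      unfolding col_list_def doubled_def ysl[symmetric] os[symmetric] by simp
  qed
  then have "mset (map col_pt (col_list D P)) = mset (map col_pt ?vs)" by (simp only: mset_map)
  then have "distinct (map col_pt (col_list D P))"
    using dist mset_eq_imp_distinct_iff by blast
  moreover have mcl: "map col_pt (col_list D P) = rev (map (\<lambda>i. real (P i) + 1/2) [0..<D])"
    by (rule map_col_pt_col_list) (rule pair last; assumption)+
  ultimately have inj: "inj_on (\<lambda>i. real (P i) + 1/2) {0..<D}"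
    by (simp add: mcl distinct_map)
  have step: "P (Suc i) \<le> P i" if i: "Suc i < D" for i
  proof (cases "even i")
    case True
    then show ?thesis using pair[of i] i by simp
  next
    case False
    then obtain r where r: "i = 2 * r + 1" by (auto elim: oddE)
    show ?thesis
    proof (cases "Suc r < k")
      case True
      have "ys ! (k - 1 - Suc r) < ys ! (k - 1 - r)"
        using srt(2) True unfolding sorted_wrt_iff_nth_less k_def by auto
      then have "p (Suc r) < p r" using pn[of r] pn[of "Suc r"] True by simp
      moreover have "Suc i = 2 * Suc r" using r by simp
      ultimately show ?thesis using P2[of r] P2[of "Suc r"] True r by simp
    next
      case False
      then have "P (Suc i) = 0" using r by (simp add: P_def)
      then show ?thesis by simp
    qed
  qed
  have anti: "P j \<le> P i" if "i \<le> j" "j < D" for i j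
    using that
  proof (induction j rule: dec_induct)
    case (step j)
    then show ?case using \<open>\<And>i. Suc i < D \<Longrightarrow> P (Suc i) \<le> P i\<close>[of j] by simp
  qed simp
  have Pdec: "P j < P i" if "i < j" "j < D" for i j
  proof -
    have "P j \<noteq> P i" using inj_onD[OF inj, of i j] that by auto
    then show ?thesis using anti[of i j] that by simp
  qed
  have Qdec: "Q j < Q i" if "i < j" "j < D" for i j
  proof -
    have "ns ! i < ns ! j" using srt(1) that unfolding sorted_wrt_iff_nth_less D_def by auto
    then show ?thesis using Qn[of i] Qn[of j] that by simp
  qed
  have "\<forall>i<D. even (Q i) \<longleftrightarrow> odd i"
    using alt unfolding nsl os alternating_neg_list .
  then have "doubled_frobenius D P Q"
    unfolding doubled_frobenius_def by (intro conjI allI impI) (elim conjE Pdec Qdec pair last | simp)+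
  moreover have "X = frob_set D P Q"
    using sX unfolding nsl os ysl set_frob_lists by simp
  ultimately show ?thesis by (rule that)
qed

section \<open>The image of the embedding and the minors on it\<close>

lemma frob_set_subset: "finite (frob_set D P Q) \<and> frob_set D P Q \<subseteq> half_ints"
  using half_ints_frob_lists[of D Q "D div 2" P] finite_set[of "neg_list D Q @ half_list D @ pos_list (D div 2) P"]
  unfolding set_frob_lists by blast

text \<open>The number of negative points is \<open>D\<close>, and these points give
  \<open>Q\<close>. Of \<open>P\<close> only the coordinates of paired even index are visible; the
  others follow from the pairing and from the vanishing last coordinate for odd
  \<open>D\<close>.\<close>

lemma frob_set_inject:
  assumes 1: "doubled_frobenius D P Q" and 2: "doubled_frobenius D' P' Q'" and eq: "frob_set D P Q = frob_set D' P' Q'"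
  shows "D = D' \<and> (\<forall>i<D. P i = P' i \<and> Q i = Q' i)"
proof -
  let ?neg = "filter (\<lambda>x::real. x < 0)" and ?pos = "filter (\<lambda>x::real. x \<ge> 3/2)"
  have neg: "?neg (sorted_list_of_set (frob_set D P Q)) = neg_list D Q"
    and pos: "?pos (sorted_list_of_set (frob_set D P Q)) = pos_list (D div 2) P"
    if "doubled_frobenius D P Q" for D P Q
  proof -
    note l = frob_lists[OF that]
    have "?neg (neg_list D Q) = neg_list D Q" "?pos (neg_list D Q) = []"
      by (auto simp: neg_list_def filter_id_conv filter_empty_conv)
    moreover have "?neg (half_list D) = []" "?pos (half_list D) = []"
      by (auto simp: half_list_def)
    moreover have "?neg (pos_list (D div 2) P) = []" "?pos (pos_list (D div 2) P) = pos_list (D div 2) P"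
      using l(2) by (fastforce simp: filter_id_conv filter_empty_conv)+
    ultimately show "?neg (sorted_list_of_set (frob_set D P Q)) = neg_list D Q"
      "?pos (sorted_list_of_set (frob_set D P Q)) = pos_list (D div 2) P"
      unfolding l(3) by simp_all
  qed
  have n: "neg_list D Q = neg_list D' Q'" using neg[OF 1] neg[OF 2] eq by simp
  have p: "pos_list (D div 2) P = pos_list (D' div 2) P'" using pos[OF 1] pos[OF 2] eq by simp
  have D: "D = D'" using arg_cong[OF n, of length] by simp
  have Q: "Q i = Q' i" if "i < D" for i
    using arg_cong[OF n, of "\<lambda>l. l ! i"] that D by (simp add: neg_list_def)
  have Pe: "P (2 * r) = P' (2 * r)" if "r < D div 2" for r
    using p that D by (auto simp: pos_list_def)
  have "P i = P' i" if i: "i < D" for i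
  proof -
    note pair = doubled_frobeniusD(4)[OF 1] doubled_frobeniusD(4)[OF 2]
      and last = doubled_frobeniusD(5)[OF 1] doubled_frobeniusD(5)[OF 2]
    consider r where "i = 2 * r" "r < D div 2" | r where "i = 2 * r + 1" "r < D div 2" | "odd D" "i = D - 1"
    proof (cases "even i")
      case True
      then obtain b where b: "i = 2 * b" by (auto elim: evenE)
      show ?thesis
      proof (cases "i + 1 < D")
        case True
        then show ?thesis using b by (intro that(1)[of b]) auto
      next
        case False
        then have "D = Suc (2 * b)" using i b by simp
        then show ?thesis using b by (intro that(3)) auto
      qed
    next
      case False
      then obtain b where "i = 2 * b + 1" by (auto elim: oddE)
      then show ?thesis using i by (intro that(2)[of b]) auto
    qed
    then show ?thesis
    proof cases
      case (1 r)
      then show ?thesis using Pe by simp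
    next
      case (2 r)
      have "P (2 * r) = Suc (P (2 * r + 1))" "P' (2 * r) = Suc (P' (2 * r + 1))"
        using pair[of "2 * r"] \<open>i = 2 * r + 1\<close> D i by auto
      then show ?thesis using Pe[OF 2(2)] 2(1) by simp
    next
      case 3
      then show ?thesis using last D by auto
    qed
  qed
  then show ?thesis using D Q by blast
qed

lemma inj_X_embed: "inj X_embed"
proof (rule injI)
  fix \<mu> \<kappa> assume "X_embed \<mu> = X_embed \<kappa>"
  let ?m = "double_rows (transpose_young \<mu>)" and ?k = "double_rows (transpose_young \<kappa>)"
  have "diag_len ?m = diag_len ?k \<and> (\<forall>i<diag_len ?m. frob_P ?m i = frob_P ?k i \<and> frob_Q ?m i = frob_Q ?k i)"
    by (rule frob_set_inject[OF doubled_frobenius_double_rows doubled_frobenius_double_rows])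
       (use \<open>X_embed \<mu> = X_embed \<kappa>\<close> in \<open>simp only: X_embed_frob_set\<close>)
  then have "?m = ?k" by (intro frobenius_inject) blast+
  then have "row_len (transpose_young \<mu>) i = row_len (transpose_young \<kappa>) i" for i
    using row_len_double_rows[of "transpose_young \<mu>" "2 * i"] row_len_double_rows[of "transpose_young \<kappa>" "2 * i"] by simp
  then have "transpose_young \<mu> = transpose_young \<kappa>" by (rule young_eqI)
  then show "\<mu> = \<kappa>" by (metis transpose_transpose_young)
qed

lemma Pf_minor_L_mat_outside:
  assumes "finite X" "X \<subseteq> half_ints" "X \<notin> range X_embed"
  shows "Pf_minor (L_mat h) X = 0"
proof (rule ccontr)
  assume "Pf_minor (L_mat h) X \<noteq> 0"
  then obtain D P Q where df: "doubled_frobenius D P Q" and X: "X = frob_set D P Q"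
    using Pf_minor_L_mat_nonzero assms by blast
  obtain m where m: "diag_len (double_rows m) = D"
    "\<And>i. i < D \<Longrightarrow> frob_P (double_rows m) i = P i" "\<And>i. i < D \<Longrightarrow> frob_Q (double_rows m) i = Q i"
    using doubled_frobenius_realized[OF df] by blast
  have "X_embed (transpose_young m) = X"
    unfolding X_embed_frob_set X transpose_transpose_young m(1) frob_set_def
    by (intro arg_cong2[where f = "(\<union>)"] image_cong refl) (auto simp: m)
  then show False using assms(3) by blast
qed

text \<open>The Cauchy factor is expressed through the hook product. The factorials are grouped with
  \<open>h\<close> because they cancel the Gamma functions in its denominators.\<close>

lemma Pf_minor_L_mat_X_embed:
  fixes \<mu> :: young and h :: "real \<Rightarrow> complex"
  defines "\<nu> \<equiv> double_rows (transpose_young \<mu>)"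
  shows "Pf_minor (L_mat h) (X_embed \<mu>) =
    (\<Prod>i<diag_len \<nu>. h (- real (frob_Q \<nu> i) - 1/2) * fact (frob_Q \<nu> i)) *
    (\<Prod>i<diag_len \<nu>. h (real (frob_P \<nu> i) + 1/2) * fact (frob_P \<nu> i)) / of_real (hook_product \<nu>)"
proof -
  let ?D = "diag_len \<nu>"
  let ?V = "(\<Prod>i<?D. \<Prod>k\<in>{i<..<?D}. real (frob_P \<nu> i) - real (frob_P \<nu> k)) *
      (\<Prod>i<?D. \<Prod>k\<in>{i<..<?D}. real (frob_Q \<nu> i) - real (frob_Q \<nu> k))"
  let ?R = "\<Prod>i<?D. \<Prod>j<?D. real (frob_P \<nu> i) + real (frob_Q \<nu> j) + 1"
  let ?F = "(\<Prod>i<?D. fact (frob_P \<nu> i)) * (\<Prod>i<?D. fact (frob_Q \<nu> i)) :: real"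
  have R: "?R > 0" by (intro prod_pos ballI) linarith
  have hp: "hook_product \<nu> > 0" by (rule hook_product_pos)
  have "?V / ?R = ?F / hook_product \<nu>"
    using hook_product_frobenius[of \<nu>] R hp by (simp add: field_simps)
  then have "Pf_minor (L_mat h) (X_embed \<mu>) = (\<Prod>i<?D. h (- real (frob_Q \<nu> i) - 1/2)) * (\<Prod>i<?D. h (real (frob_P \<nu> i) + 1/2)) *
      of_real (?F / hook_product \<nu>)"
    using Pf_minor_L_mat_frob_set[OF doubled_frobenius_double_rows, of h "transpose_young \<mu>"]
    unfolding X_embed_frob_set \<nu>_def[symmetric] by (simp only:)
  then show ?thesis by (simp add: prod.distrib)
qed

section \<open>From weights to ensembles\<close>

lemma pmf_of_has_sum:
  fixes g :: "'a \<Rightarrow> real"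
  assumes "\<And>x. g x \<ge> 0" "(g has_sum s) UNIV" "s > 0"
  obtains M where "\<And>x. pmf M x = g x / s"
proof -
  have g1: "((\<lambda>x. g x / s) has_sum 1) UNIV"
    using has_sum_cmult_left[OF assms(2), of "1 / s"] assms(3) by simp
  have nonneg: "g x / s \<ge> 0" for x using assms(1,3) by simp
  have "norm (g x / s) = g x / s" for x using nonneg[of x] by (simp only: real_norm_def abs_of_nonneg)
  then have "(\<lambda>x. norm (g x / s)) summable_on UNIV"
    using has_sum_imp_summable[OF g1] by (simp only:)
  then have abs: "Infinite_Set_Sum.abs_summable_on (\<lambda>x. g x / s) UNIV"
    unfolding abs_summable_equivalent .
  have "(\<integral>\<^sup>+ x. ennreal (g x / s) \<partial>count_space UNIV) = ennreal (infsetsum (\<lambda>x. g x / s) UNIV)"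
    by (rule nn_integral_conv_infsetsum[OF abs nonneg])
  also have "\<dots> = 1"
    unfolding infsetsum_infsum[OF abs] infsumI[OF g1] by simp
  finally have "pmf (embed_pmf (\<lambda>x. g x / s)) x = g x / s" for x
    by (intro pmf_embed_pmf nonneg)
  then show ?thesis by (rule that)
qed

text \<open>The common last step of both measures: minors vanish off the image, so a nonnegative
  weight on diagrams that equals the minors and has a known positive sum determines everything, and
  that sum is \<open>Pf (J + L)\<close>.\<close>

lemma Pfaffian_ensemble_of_weights:
  fixes h :: "real \<Rightarrow> complex" and g :: "young \<Rightarrow> real"
  assumes g: "\<And>\<mu>. g \<mu> \<ge> 0" "(g has_sum s) UNIV" "s > 0"
    and Pf: "\<And>\<mu>. Pf_minor (L_mat h) (X_embed \<mu>) = of_real (g \<mu>)"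
  shows "Pf_J_plus half_ints (L_mat h) = of_real s"
    and "\<exists>M. (\<forall>\<mu>. pmf M \<mu> = g \<mu> / s) \<and> is_Pfaffian_L_ensemble half_ints (L_mat h) (map_pmf X_embed M)"
proof -
  let ?F = "{X. finite X \<and> X \<subseteq> half_ints}"
  have sub: "range X_embed \<subseteq> ?F"
  proof
    fix X assume "X \<in> range X_embed"
    then obtain \<mu> where "X = X_embed \<mu>" by blast
    then show "X \<in> ?F" unfolding X_embed_frob_set using frob_set_subset by simp
  qed
  have out: "Pf_minor (L_mat h) X = 0" if "X \<in> ?F" "X \<notin> range X_embed" for X
    using Pf_minor_L_mat_outside that by simp
  have "((\<lambda>\<mu>. Pf_minor (L_mat h) (X_embed \<mu>)) has_sum of_real s) UNIV"
    unfolding Pf by (rule has_sum_of_real[OF g(2)])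
  then have "(Pf_minor (L_mat h) has_sum of_real s) (range X_embed)"
    by (simp add: has_sum_reindex[OF inj_X_embed] o_def)
  then have hs: "(Pf_minor (L_mat h) has_sum of_real s) ?F"
    using sub out by (subst has_sum_cong_neutral[where T = "range X_embed" and g = "Pf_minor (L_mat h)"]) auto
  show J: "Pf_J_plus half_ints (L_mat h) = of_real s"
    unfolding Pf_J_plus_def by (rule infsumI[OF hs])
  obtain M where M: "\<And>\<mu>. pmf M \<mu> = g \<mu> / s"
    using pmf_of_has_sum[OF g] by blast
  let ?N = "map_pmf X_embed M"
  have "is_Pfaffian_L_ensemble half_ints (L_mat h) ?N"
    unfolding is_Pfaffian_L_ensemble_def
  proof (intro conjI allI impI)
    show "skew_on half_ints (L_mat h)" by (rule skew_on_L_mat)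
    show "Pf_minor (L_mat h) summable_on ?F" using hs by (auto simp: summable_on_def)
    show "set_pmf ?N \<subseteq> ?F" using sub by auto
    fix X assume X: "finite X \<and> X \<subseteq> half_ints"
    have cases: "Pf_minor (L_mat h) X \<in> \<real>\<^sub>\<ge>\<^sub>0 \<and> complex_of_real (pmf ?N X) = Pf_minor (L_mat h) X / Pf_J_plus half_ints (L_mat h)"
    proof (cases "X \<in> range X_embed")
      case True
      then obtain \<mu> where \<mu>: "X = X_embed \<mu>" by blast
      have "pmf ?N X = g \<mu> / s" unfolding \<mu> pmf_map_inj'[OF inj_X_embed] by (rule M)
      then show ?thesis using g(1) by (simp add: J \<mu> Pf)
    next
      case False
      then have "pmf ?N X = 0" by (intro pmf_map_outside) blast
      then show ?thesis using out[of X] False X by simp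
    qed
    then show "Pf_minor (L_mat h) X \<in> \<real>\<^sub>\<ge>\<^sub>0" by blast
    show "complex_of_real (pmf ?N X) = Pf_minor (L_mat h) X / Pf_J_plus half_ints (L_mat h)"
      using cases by blast
  qed
  then show "\<exists>M. (\<forall>\<mu>. pmf M \<mu> = g \<mu> / s) \<and> is_Pfaffian_L_ensemble half_ints (L_mat h) (map_pmf X_embed M)"
    using M by blast
qed

text \<open>Nonnegativity allows the unordered sum over all diagrams to be taken level by level. The
  transpose enters because the level sums run over transposed diagrams.\<close>

lemma has_sum_levels:
  fixes V :: "young \<Rightarrow> real"
  assumes V: "\<And>m. V m \<ge> 0" and x: "x \<ge> 0" and s: "(\<lambda>n. x ^ n * (\<Sum>m\<in>level n. V m)) sums s"
  shows "((\<lambda>\<mu>. x ^ num_boxes \<mu> * V (transpose_young \<mu>)) has_sum s) UNIV"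
proof -
  let ?f = "\<lambda>(n, m). x ^ n * V m"
  have inner: "((\<lambda>m. ?f (n, m)) has_sum (x ^ n * (\<Sum>m\<in>level n. V m))) (level n)" for n
    using has_sum_finite[OF finite_level[of n], of "\<lambda>m. x ^ n * V m"] by (simp add: sum_distrib_left)
  have outer: "((\<lambda>n. x ^ n * (\<Sum>m\<in>level n. V m)) has_sum s) UNIV"
    using s by (rule sums_nonneg_imp_has_sum) (use V x in \<open>auto intro!: mult_nonneg_nonneg sum_nonneg\<close>)
  have "?f summable_on Sigma UNIV level"
  proof (rule summable_on_SigmaI[OF inner])
    show "(\<lambda>n. x ^ n * (\<Sum>m\<in>level n. V m)) summable_on UNIV" using outer by (auto simp: summable_on_def)
  qed (use V x in auto)
  from has_sum_SigmaI[OF inner outer this] have hs: "(?f has_sum s) (Sigma UNIV level)" .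
  have "bij_betw (\<lambda>\<mu>. (num_boxes \<mu>, transpose_young \<mu>)) UNIV (Sigma UNIV level)"
    by (rule bij_betwI[of _ _ _ "\<lambda>(n, m). transpose_young m"]) (auto simp: level_def num_boxes_transpose)
  from has_sum_reindex_bij_betw[OF this, of ?f s] hs show ?thesis by simp
qed

text \<open>The boxes are grouped into the principal hooks. The diagonal box is counted with the
  row, so the row interval contains \<open>i\<close> and the column interval does not.\<close>

lemma prod_boxes_hooks:
  fixes f :: "nat \<Rightarrow> nat \<Rightarrow> 'a::comm_monoid_mult"
  shows "(\<Prod>(i, j)\<in>boxes \<mu>. f i j) = (\<Prod>i<diag_len \<mu>. (\<Prod>j\<in>{i..<i + frob_P \<mu> i + 1}. f i j) *
    (\<Prod>j\<in>{i<..<i + frob_Q \<mu> i + 1}. f j i))"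
proof -
  let ?D = "diag_len \<mu>"
  let ?S = "Sigma {..<?D} (\<lambda>i. {i..<row_len \<mu> i})"
  let ?T = "Sigma {..<?D} (\<lambda>j. {j<..<row_len (transpose_young \<mu>) j})"
  have un: "boxes \<mu> = ?S \<union> prod.swap ` ?T"
  proof (intro equalityI subsetI)
    fix q assume q: "q \<in> boxes \<mu>"
    obtain i j where ij: "q = (i, j)" by (cases q)
    then have b: "j < row_len \<mu> i" using q by (simp add: boxes_def)
    show "q \<in> ?S \<union> prod.swap ` ?T"
    proof (cases "i \<le> j")
      case True
      then have "i < ?D" using b by (simp add: less_diag_len)
      then have "q \<in> ?S" using True b by (simp add: ij)
      then show ?thesis ..
    next
      case False
      then have "j < ?D" using b row_len_antimono[of j i \<mu>] by (simp add: less_diag_len)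
      then have "(j, i) \<in> ?T" using False b by (simp add: less_transpose_young)
      then have "q \<in> prod.swap ` ?T" unfolding ij by force
      then show ?thesis ..
    qed
  next
    fix q assume "q \<in> ?S \<union> prod.swap ` ?T"
    then show "q \<in> boxes \<mu>" by (auto simp: boxes_def less_transpose_young)
  qed
  have "(\<Prod>(i, j)\<in>boxes \<mu>. f i j) = (\<Prod>(i, j)\<in>?S. f i j) * (\<Prod>(i, j)\<in>prod.swap ` ?T. f i j)"
    unfolding un by (rule prod.union_disjoint) auto
  also have "(\<Prod>(i, j)\<in>prod.swap ` ?T. f i j) = (\<Prod>(j, i)\<in>?T. f i j)"
    by (subst prod.reindex) (auto simp: case_prod_unfold)
  also have "\<dots> = (\<Prod>j<?D. \<Prod>i\<in>{j<..<row_len (transpose_young \<mu>) j}. f i j)"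
    by (subst prod.Sigma) auto
  also have "(\<Prod>(i, j)\<in>?S. f i j) = (\<Prod>i<?D. \<Prod>j\<in>{i..<row_len \<mu> i}. f i j)"
    by (subst prod.Sigma) auto
  finally have "(\<Prod>(i, j)\<in>boxes \<mu>. f i j) = (\<Prod>i<?D. (\<Prod>j\<in>{i..<row_len \<mu> i}. f i j) *
      (\<Prod>j\<in>{i<..<row_len (transpose_young \<mu>) i}. f j i))"
    unfolding prod.distrib .
  also have "\<dots> = (\<Prod>i<?D. (\<Prod>j\<in>{i..<i + frob_P \<mu> i + 1}. f i j) * (\<Prod>j\<in>{i<..<i + frob_Q \<mu> i + 1}. f j i))"
    by (rule prod.cong[OF refl]) (simp add: row_len_frob_P row_len_frob_Q add.commute)
  finally show ?thesis .
qed

text \<open>The principal hooks have \<open>P + Q + 1\<close> boxes and exhaust a diagram with twice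
  as many boxes as \<open>m\<close>. It is applied with \<open>x\<close> the square root of the
  parameter, since \<open>h\<close> contains half powers.\<close>

lemma prod_frobenius_power:
  fixes x :: "'a::comm_monoid_mult"
  defines "\<nu> \<equiv> \<lambda>m. double_rows m"
  shows "(\<Prod>i<diag_len (\<nu> m). x ^ (frob_P (\<nu> m) i + frob_Q (\<nu> m) i + 1)) = (x * x) ^ num_boxes m"
proof -
  have "(\<Prod>i<diag_len (\<nu> m). x ^ (frob_P (\<nu> m) i + frob_Q (\<nu> m) i + 1)) = (\<Prod>(r, c)\<in>boxes (\<nu> m). x)"
    unfolding prod_boxes_hooks by (rule prod.cong[OF refl]) (simp add: power_add[symmetric] power_Suc[symmetric] del: power_Suc)
  also have "\<dots> = (\<Prod>(k, c)\<in>boxes m. x * x)" unfolding \<nu>_def by (rule prod_boxes_double_rows)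
  also have "\<dots> = (x * x) ^ num_boxes m" by (simp add: num_boxes_def case_prod_unfold)
  finally show ?thesis .
qed

section \<open>The poissonized Plancherel measure\<close>

lemma powr_half_product:
  assumes "x > 0"
  shows "x powr ((real a + 1/2) / 2) * x powr ((real b + 1/2) / 2) = sqrt x ^ (b + a + 1)"
proof -
  have "x powr ((real a + 1/2) / 2) * x powr ((real b + 1/2) / 2) = x powr (1/2 * real (b + a + 1))"
    unfolding powr_add[symmetric] by (rule arg_cong2[where f = "(powr)"]) (simp_all add: field_simps)
  also have "\<dots> = (x powr (1/2)) powr real (b + a + 1)" by (rule powr_powr[symmetric])
  also have "\<dots> = (x powr (1/2)) ^ (b + a + 1)" using assms by (intro powr_realpow) simp
  finally show ?thesis using assms by (simp add: powr_half_sqrt)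
qed

lemma Gamma_half_shift: "Gamma (real q + 1/2 + 1/2) = fact q" "Gamma (1/2 + real q + 1/2) = fact q"
proof -
  have "real q + 1/2 + 1/2 = 1 + real q" "1/2 + real q + 1/2 = 1 + real q" by simp_all
  then show "Gamma (real q + 1/2 + 1/2) = fact q" "Gamma (1/2 + real q + 1/2) = fact q"
    by (simp_all only: Gamma_fact)
qed

lemma Pf_minor_Plancherel:
  assumes "\<eta> > 0"
  shows "Pf_minor (L_mat (h_Plancherel \<eta>)) (X_embed \<mu>) =
    of_real ((2 * \<eta>) ^ num_boxes \<mu> / hook_product (double_rows (transpose_young \<mu>)))"
proof -
  let ?\<nu> = "double_rows (transpose_young \<mu>)"
  let ?D = "diag_len ?\<nu>" and ?P = "frob_P ?\<nu>" and ?Q = "frob_Q ?\<nu>"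
  have hQ: "h_Plancherel \<eta> (- real q - 1/2) * fact q = of_real ((2 * \<eta>) powr ((real q + 1/2) / 2))" for q
  proof -
    have "\<bar>- real q - 1/2\<bar> = real q + 1/2" by simp
    then show ?thesis unfolding h_Plancherel_def by (simp only: Gamma_half_shift) simp
  qed
  have hP: "h_Plancherel \<eta> (real q + 1/2) * fact q = of_real ((2 * \<eta>) powr ((real q + 1/2) / 2))" for q
  proof -
    have "\<bar>real q + 1/2\<bar> = real q + 1/2" by simp
    then show ?thesis unfolding h_Plancherel_def by (simp only: Gamma_half_shift) simp
  qed
  have "(\<Prod>i<?D. (2 * \<eta>) powr ((real (?Q i) + 1/2) / 2) * (2 * \<eta>) powr ((real (?P i) + 1/2) / 2)) =
      (\<Prod>i<?D. sqrt (2 * \<eta>) ^ (?P i + ?Q i + 1))"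
    by (rule prod.cong[OF refl], rule powr_half_product) (use assms in simp)
  also have "\<dots> = (2 * \<eta>) ^ num_boxes \<mu>"
    unfolding prod_frobenius_power num_boxes_transpose using assms by simp
  finally have p: "(\<Prod>i<?D. (2 * \<eta>) powr ((real (?Q i) + 1/2) / 2)) * (\<Prod>i<?D. (2 * \<eta>) powr ((real (?P i) + 1/2) / 2)) =
      (2 * \<eta>) ^ num_boxes \<mu>" unfolding prod.distrib .
  show ?thesis
    unfolding Pf_minor_L_mat_X_embed hQ hP of_real_divide p[symmetric] of_real_mult of_real_prod ..
qed

lemma poissonized_Plancherel_ensemble:
  assumes \<eta>: "\<eta> > 0"
  shows "\<exists>M. is_poissonized_Plancherel \<eta> (1/2) M \<and>
    is_Pfaffian_L_ensemble half_ints (L_mat (h_Plancherel \<eta>)) (map_pmf X_embed M)"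
proof -
  let ?V = "\<lambda>m. 1 / hook_product (double_rows m)"
  let ?g = "\<lambda>\<mu>. (2 * \<eta>) ^ num_boxes \<mu> * ?V (transpose_young \<mu>)"
  have V: "?V m \<ge> 0" for m using hook_product_pos[of "double_rows m"] by simp
  have lev: "(\<Sum>m\<in>level n. ?V m) = 1 / (2 ^ n * fact n)" for n
  proof -
    have "complex_of_real (\<Sum>m\<in>level n. ?V m) = complex_of_real (1 / (2 ^ n * fact n))"
      using level_sum_const[of n] by (simp add: level_sum_def content_product_def)
    then show ?thesis by (simp only: of_real_eq_iff)
  qed
  have "\<eta> ^ n /\<^sub>R fact n = (2 * \<eta>) ^ n * (\<Sum>m\<in>level n. ?V m)" for n
    unfolding lev by (simp add: power_mult_distrib divide_simps)
  then have "(\<lambda>n. (2 * \<eta>) ^ n * (\<Sum>m\<in>level n. ?V m)) sums exp \<eta>"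
    using exp_converges[of \<eta>] by (simp only:)
  from has_sum_levels[OF V _ this] have hs: "(?g has_sum exp \<eta>) UNIV" using \<eta> by simp
  have g: "?g \<mu> \<ge> 0" for \<mu> using V \<eta> by simp
  obtain M where M: "\<And>\<mu>. pmf M \<mu> = ?g \<mu> / exp \<eta>"
    "is_Pfaffian_L_ensemble half_ints (L_mat (h_Plancherel \<eta>)) (map_pmf X_embed M)"
    using Pfaffian_ensemble_of_weights(2)[of ?g "exp \<eta>" "h_Plancherel \<eta>"] g hs Pf_minor_Plancherel[OF \<eta>] by auto
  have "is_poissonized_Plancherel \<eta> (1/2) M"
    unfolding is_poissonized_Plancherel_def
  proof
    fix \<mu>
    let ?n = "num_boxes \<mu>" and ?H = "H_hook \<mu> (1/2) * H'_hook \<mu> (1/2)"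
    have H: "hook_product (double_rows (transpose_young \<mu>)) = ?H * 4 ^ ?n"
      by (rule H_hook_H'_hook_half[symmetric])
    have "pmf M \<mu> = exp (- \<eta>) * ((2 * \<eta>) ^ ?n / (?H * 4 ^ ?n))"
      unfolding M(1) H by (simp add: exp_minus divide_simps)
    \<comment> \<open>Per box, \<open>2 * \<eta> / 4\<close> is \<eta> times \<theta> = 1/2: the 2
      comes from \<open>h\<close>, the 4 from passing to the doubled diagram.\<close>
    also have "(2 * \<eta>) ^ ?n / (?H * 4 ^ ?n) = \<eta> ^ ?n * ((1/2) ^ ?n / ?H)"
    proof -
      have "(2 * \<eta>) ^ ?n / (h * 4 ^ ?n) = \<eta> ^ ?n * ((1/2) ^ ?n / h)" for h :: real
      proof -
        have "(2 * \<eta>) ^ ?n / 4 ^ ?n = (\<eta> * (1/2)) ^ ?n"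
          unfolding power_divide[symmetric] by simp
        also have "\<dots> = \<eta> ^ ?n * (1/2) ^ ?n" by (rule power_mult_distrib)
        finally have e: "(2 * \<eta>) ^ ?n / 4 ^ ?n = \<eta> ^ ?n * (1/2) ^ ?n" .
        have "(2 * \<eta>) ^ ?n / (h * 4 ^ ?n) = (2 * \<eta>) ^ ?n / 4 ^ ?n / h" by (simp add: mult.commute)
        then show ?thesis unfolding e by simp
      qed
      then show ?thesis .
    qed
    finally show "pmf M \<mu> = exp (- \<eta>) * \<eta> ^ ?n * ((1/2) ^ ?n / ?H)" by (simp only: mult.assoc)
  qed
  then show ?thesis using M(2) by blast
qed

section \<open>The mixed z-measure\<close>

text \<open>Consecutive brackets collect the factors of the Pochhammer symbol at even and at odd
  distances. They occur together because the coordinates \<open>P\<close> come in pairs of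
  consecutive numbers.\<close>

lemma bracket_Suc_mult: "bracket a (Suc n) * bracket a n = pochhammer a (Suc n)"
proof (cases "even n")
  case True
  then obtain j where n: "n = 2 * j" by (auto elim: evenE)
  have "pochhammer a (Suc n) = (\<Prod>k<2 * j. a + of_nat k) * (a + of_nat (2 * j))"
    by (simp add: pochhammer_prod n atLeast0LessThan)
  also have "(\<Prod>k<2 * j. a + of_nat k) = (\<Prod>k<j. a + 2 * of_nat k) * (\<Prod>k<j. a + 2 * of_nat k + 1)"
    unfolding prod_lessThan_double prod.distrib[symmetric] by (rule prod.cong[OF refl]) (simp add: algebra_simps)
  finally show ?thesis by (simp add: bracket_def n mult_ac)
next
  case False
  then obtain j where n: "n = 2 * j + 1" by (auto elim: oddE)
  have "pochhammer a (Suc n) = (\<Prod>k<2 * Suc j. a + of_nat k)"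
    by (simp only: pochhammer_prod n atLeast0LessThan) simp
  also have "\<dots> = (\<Prod>k<Suc j. a + 2 * of_nat k) * (\<Prod>k<Suc j. a + 2 * of_nat k + 1)"
    unfolding prod_lessThan_double prod.distrib[symmetric] by (rule prod.cong[OF refl]) (simp add: algebra_simps)
  finally show ?thesis by (simp add: bracket_def n mult.commute del: prod.lessThan_Suc)
qed

lemma prod_bracket_pairs:
  assumes df: "doubled_frobenius D P Q"
  shows "(\<Prod>i<D. bracket a (P i)) = (\<Prod>i<D. if even i then pochhammer a (P i) else 1)"
proof -
  have pairs: "(\<Prod>i<2 * k. bracket a (P i)) = (\<Prod>i<2 * k. if even i then pochhammer a (P i) else 1)" if "2 * k \<le> D" for k
    unfolding prod_lessThan_double
  proof (rule prod.cong[OF refl])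
    fix r assume "r \<in> {..<k}"
    then have "2 * r + 1 < D" using that by simp
    then have "P (2 * r) = Suc (P (2 * r + 1))" using doubled_frobeniusD(4)[OF df, of "2 * r"] by simp
    then show "bracket a (P (2 * r)) * bracket a (P (2 * r + 1)) =
        (if even (2 * r) then pochhammer a (P (2 * r)) else 1) * (if even (2 * r + 1) then pochhammer a (P (2 * r + 1)) else 1)"
      by (simp add: bracket_Suc_mult del: pochhammer_Suc)
  qed
  show ?thesis
  proof (cases "even D")
    case True
    then obtain k where "D = 2 * k" by (auto elim: evenE)
    then show ?thesis using pairs[of k] by simp
  next
    case False
    then obtain k where D: "D = Suc (2 * k)" by (auto elim: oddE)
    have "P (2 * k) = 0" using doubled_frobeniusD(5)[OF df False] D by simp
    then show ?thesis using pairs[of k] D by (simp add: bracket_def)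
  qed
qed

text \<open>Every second row carries a factor. The parity condition on \<open>q\<close> is exactly
  what selects the right one of the two cases in the definition of the bracket.\<close>

lemma prod_column_contents:
  assumes "even q \<longleftrightarrow> odd i"
  shows "(\<Prod>r\<in>{i..<i + q + 1}. if even r then w + (of_nat r - of_nat i) else 1) = bracket w q"
proof -
  have "(\<Prod>r\<in>{i..<i + q + 1}. if even r then w + (of_nat r - of_nat i) else 1) =
      (\<Prod>p<q + 1. if even (i + p) then w + of_nat p else 1)"
    by (rule prod.reindex_bij_witness[of _ "\<lambda>p. i + p" "\<lambda>r. r - i"]) auto
  also have "\<dots> = bracket w q"
  proof (cases "even i")
    case True
    then have "odd q" using assms by simp
    then obtain j where q: "q = 2 * j + 1" by (auto elim: oddE)
    have "(\<Prod>p<q + 1. if even (i + p) then w + of_nat p else 1) = (\<Prod>p<2 * Suc j. if even (i + p) then w + of_nat p else 1)"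
      by (simp add: q)
    also have "\<dots> = (\<Prod>k<Suc j. w + 2 * of_nat k)"
      unfolding prod_lessThan_double using True by (intro prod.cong[OF refl]) simp
    finally show ?thesis by (simp add: bracket_def q del: prod.lessThan_Suc)
  next
    case False
    then have "even q" using assms by simp
    then obtain j where q: "q = 2 * j" by (auto elim: evenE)
    have "(\<Prod>p<q + 1. if even (i + p) then w + of_nat p else 1) = (\<Prod>p<2 * j. if even (i + p) then w + of_nat p else 1)"
      using False by (simp add: q)
    also have "\<dots> = (\<Prod>k<j. w + 2 * of_nat k + 1)"
      unfolding prod_lessThan_double using False by (intro prod.cong[OF refl]) (simp add: add.commute add.left_commute)
    finally show ?thesis by (simp add: bracket_def q)
  qed
  finally show ?thesis .
qed

lemma prod_row_contents:
  "(\<Prod>c\<in>{i..<i + p + 1}. w - (of_nat c - of_nat i)) = w * ((-1) ^ p * pochhammer (1 - w) p)" for w :: complex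
proof -
  have "(\<Prod>c\<in>{i..<i + p + 1}. w - (of_nat c - of_nat i)) = (\<Prod>q<Suc p. w - of_nat q)"
    by (rule prod.reindex_bij_witness[of _ "\<lambda>q. i + q" "\<lambda>c. c - i"]) auto
  also have "\<dots> = w * (\<Prod>q<p. (-1) * (1 - w + of_nat q))"
    unfolding prod.lessThan_Suc_shift by (simp add: algebra_simps)
  also have "(\<Prod>q<p. (-1) * (1 - w + of_nat q)) = (-1) ^ p * pochhammer (1 - w) p"
    unfolding prod.distrib by (simp add: pochhammer_prod atLeast0LessThan)
  finally show ?thesis .
qed

text \<open>Evaluated along the principal hooks of the doubled diagram. The remaining signs
  \<open>(-1) ^ P\<close> do not involve \<open>z\<close>, so they disappear when the products for
  \<open>z\<close> and \<open>z'\<close> are multiplied.\<close>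

lemma content_product_frobenius:
  fixes m :: young and z :: complex
  defines "\<nu> \<equiv> double_rows m"
  shows "content_product (\<lambda>c. 2 * z - of_real c) m =
    (\<Prod>i<diag_len \<nu>. if even i then (-1) ^ frob_P \<nu> i else 1) *
    ((\<Prod>i<diag_len \<nu>. bracket (2 * z) (frob_Q \<nu> i)) * (\<Prod>i<diag_len \<nu>. bracket (- 2 * z + 1) (frob_P \<nu> i)))"
proof -
  let ?D = "diag_len \<nu>" and ?P = "frob_P \<nu>" and ?Q = "frob_Q \<nu>"
  have df: "doubled_frobenius ?D ?P ?Q" unfolding \<nu>_def by (rule doubled_frobenius_double_rows)
  \<comment> \<open>The content factor of a box of \<open>m\<close> is given to the even one of its
    two copies and 1 to the odd one; on even rows it is \<open>2 * z\<close> minus the distance from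
    the diagonal.\<close>
  define g where "g = (\<lambda>r c. if even r then 2 * z - (of_nat c - of_nat r) else 1)"
  have "content_product (\<lambda>c. 2 * z - of_real c) m = (\<Prod>(k, c)\<in>boxes m. g (2 * k) c * g (2 * k + 1) c)"
    unfolding content_product_def by (rule prod.cong[OF refl]) (auto simp: g_def)
  also have "\<dots> = (\<Prod>(r, c)\<in>boxes \<nu>. g r c)" unfolding \<nu>_def by (rule prod_boxes_double_rows[symmetric])
  also have "\<dots> = (\<Prod>i<?D. (\<Prod>j\<in>{i..<i + ?P i + 1}. g i j) * (\<Prod>j\<in>{i<..<i + ?Q i + 1}. g j i))"
    by (rule prod_boxes_hooks)
  also have "\<dots> = (\<Prod>i<?D. (if even i then (-1) ^ ?P i else 1) *
      (bracket (2 * z) (?Q i) * (if even i then pochhammer (- 2 * z + 1) (?P i) else 1)))"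
  proof (rule prod.cong[OF refl])
    fix i assume "i \<in> {..<?D}"
    then have par: "even (?Q i) \<longleftrightarrow> odd i" using doubled_frobeniusD(3)[OF df] by simp
    have "{i..<i + ?Q i + 1} = insert i {i<..<i + ?Q i + 1}" by auto
    then have "(\<Prod>r\<in>{i..<i + ?Q i + 1}. if even r then 2 * z + (of_nat r - of_nat i) else 1) =
        (if even i then 2 * z else 1) * (\<Prod>r\<in>{i<..<i + ?Q i + 1}. if even r then 2 * z + (of_nat r - of_nat i) else 1)"
      by simp
    also have "(\<Prod>r\<in>{i<..<i + ?Q i + 1}. if even r then 2 * z + (of_nat r - of_nat i) else 1) =
        (\<Prod>r\<in>{i<..<i + ?Q i + 1}. g r i)"
      by (rule prod.cong[OF refl]) (simp add: g_def)
    \<comment> \<open>The factor \<open>2 * z\<close> of the diagonal box is taken from the row and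
      given to the column, where the bracket starts with it.\<close>
    finally have col: "(if even i then 2 * z else 1) * (\<Prod>r\<in>{i<..<i + ?Q i + 1}. g r i) = bracket (2 * z) (?Q i)"
      unfolding prod_column_contents[OF par] ..
    have row: "(\<Prod>j\<in>{i..<i + ?P i + 1}. g i j) =
        (if even i then 2 * z else 1) * ((if even i then (-1) ^ ?P i else 1) * (if even i then pochhammer (- 2 * z + 1) (?P i) else 1))"
      using prod_row_contents[where i = i and p = "?P i" and w = "2 * z"] by (simp add: g_def add.commute)
    show "(\<Prod>j\<in>{i..<i + ?P i + 1}. g i j) * (\<Prod>j\<in>{i<..<i + ?Q i + 1}. g j i) =
        (if even i then (-1) ^ ?P i else 1) *
          (bracket (2 * z) (?Q i) * (if even i then pochhammer (- 2 * z + 1) (?P i) else 1))"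
      unfolding row col[symmetric] by (simp only: mult_ac)
  qed
  finally show ?thesis unfolding prod.distrib prod_bracket_pairs[OF df] .
qed

lemma content_product_mult:
  "content_product (\<lambda>c. f c * g c) m = content_product f m * content_product g m"
  unfolding content_product_def prod.distrib[symmetric] by (rule prod.cong) auto

lemma poch_young_half:
  "poch_young z (1/2) \<mu> * 2 ^ num_boxes \<mu> = content_product (\<lambda>c. 2 * z - of_real c) (transpose_young \<mu>)"
proof -
  have two: "2 ^ num_boxes \<mu> = (\<Prod>(i, j)\<in>boxes \<mu>. 2::complex)" by (simp add: num_boxes_def case_prod_unfold)
  have "poch_young z (1/2) \<mu> * 2 ^ num_boxes \<mu> = (\<Prod>(i, j)\<in>boxes \<mu>. (z + of_nat j - of_nat i * of_real (1/2)) * 2)"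
    unfolding poch_young_def two prod.distrib[symmetric] by (rule prod.cong) auto
  also have "\<dots> = (\<Prod>(j, i)\<in>boxes (transpose_young \<mu>). (z + of_nat j - of_nat i * of_real (1/2)) * 2)"
    by (rule prod_boxes_transpose)
  also have "\<dots> = content_product (\<lambda>c. 2 * z - of_real c) (transpose_young \<mu>)"
    unfolding content_product_def by (rule prod.cong[OF refl]) (auto simp: algebra_simps)
  finally show ?thesis .
qed

abbreviation mixed_factor :: "complex \<Rightarrow> complex \<Rightarrow> real \<Rightarrow> complex" where
  "mixed_factor z z' \<equiv> \<lambda>c. (2 * z - of_real c) * (2 * z' - of_real c)"

lemma Pf_minor_mixed:
  assumes "\<xi> > 0"
  shows "Pf_minor (L_mat (h_mixed z z' \<xi>)) (X_embed \<mu>) = of_real (\<xi> ^ num_boxes \<mu>) *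
    (content_product (mixed_factor z z') (transpose_young \<mu>) / of_real (hook_product (double_rows (transpose_young \<mu>))))"
proof -
  let ?\<nu> = "double_rows (transpose_young \<mu>)"
  let ?D = "diag_len ?\<nu>" and ?P = "frob_P ?\<nu>" and ?Q = "frob_Q ?\<nu>"
  let ?x = "\<lambda>q. complex_of_real (\<xi> powr ((real q + 1/2) / 2))"
  have fl: "nat \<lfloor>- (- real q - 1/2) - 1/2\<rfloor> = q" "nat \<lfloor>real q + 1/2 - 1/2\<rfloor> = q" for q
    by simp_all
  have arg: "- (- real q - 1/2) + 1/2 = real q + 1/2 + 1/2" "- (- real q - 1/2) / 2 = (real q + 1/2) / 2"
    "\<not> - real q - 1/2 > 0" "real q + 1/2 > 0" for q
    by simp_all
  have hQ: "h_mixed z z' \<xi> (- real q - 1/2) * fact q = bracket (2 * z) q * bracket (2 * z') q * ?x q" for q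
    unfolding h_mixed_def if_not_P[OF arg(3)] fl(1) arg(1,2) Gamma_half_shift by simp
  have hP: "h_mixed z z' \<xi> (real q + 1/2) * fact q = bracket (- 2 * z + 1) q * bracket (- 2 * z' + 1) q * ?x q" for q
    unfolding h_mixed_def if_P[OF arg(4)] fl(2) Gamma_half_shift by simp
  let ?s = "\<Prod>i<?D. if even i then (-1) ^ ?P i else (1::complex)"
  have s2: "?s * ?s = 1"
    unfolding prod.distrib[symmetric] by (rule prod.neutral) (simp add: power_mult_distrib[symmetric])
  have "(\<Prod>i<?D. \<xi> powr ((real (?Q i) + 1/2) / 2) * \<xi> powr ((real (?P i) + 1/2) / 2)) =
      (\<Prod>i<?D. sqrt \<xi> ^ (?P i + ?Q i + 1))"
    by (rule prod.cong[OF refl], rule powr_half_product) (use assms in simp)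
  also have "\<dots> = \<xi> ^ num_boxes \<mu>"
    unfolding prod_frobenius_power num_boxes_transpose using assms by simp
  finally have "of_real (\<xi> ^ num_boxes \<mu>) = complex_of_real (\<Prod>i<?D. \<xi> powr ((real (?Q i) + 1/2) / 2) * \<xi> powr ((real (?P i) + 1/2) / 2))"
    by simp
  also have "\<dots> = (\<Prod>i<?D. ?x (?Q i)) * (\<Prod>i<?D. ?x (?P i))"
    unfolding prod.distrib of_real_mult of_real_prod ..
  finally have xi: "of_real (\<xi> ^ num_boxes \<mu>) = (\<Prod>i<?D. ?x (?Q i)) * (\<Prod>i<?D. ?x (?P i))" .
  have rearrange: "(a * a' * x) * (b * b' * y) / h = x * y * ((s * (a * b)) * (s * (a' * b')) / h)"
    if "s * s = 1" for a a' b b' x y s h :: complex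
  proof -
    have "x * y * ((s * (a * b)) * (s * (a' * b')) / h) = (s * s) * ((a * a' * x) * (b * b' * y) / h)"
      by (simp add: mult_ac)
    then show ?thesis using that by simp
  qed
  show ?thesis
    unfolding Pf_minor_L_mat_X_embed hQ hP content_product_mult content_product_frobenius xi prod.distrib
    by (rule rearrange[OF s2])
qed

section \<open>Nonnegativity of the weights for admissible parameters\<close>

lemma content_product_nonneg:
  assumes "\<And>k i. (k, i) \<in> boxes m \<Longrightarrow> f (real i - 2 * real k) \<in> \<real>\<^sub>\<ge>\<^sub>0"
  shows "content_product f m \<in> \<real>\<^sub>\<ge>\<^sub>0"
proof -
  have prod_nonneg: "prod g A \<in> \<real>\<^sub>\<ge>\<^sub>0" if "\<And>x. x \<in> A \<Longrightarrow> g x \<in> \<real>\<^sub>\<ge>\<^sub>0" for g :: "nat \<times> nat \<Rightarrow> complex" and A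
    using that by (induction A rule: infinite_finite_induct) auto
  show ?thesis unfolding content_product_def by (rule prod_nonneg) (use assms in auto)
qed

lemma content_product_zero:
  assumes "(k, i) \<in> boxes m" "f (real i - 2 * real k) = 0"
  shows "content_product f m = 0"
  unfolding content_product_def using assms by (intro prod_zero) (auto intro!: bexI[of _ "(k, i)"])

text \<open>Either the diagram contains the box at which the factor of \<open>x\<close> is zero, or
  it avoids this box, and then it is so narrow that at each box the two linear factors are both
  nonnegative or both nonpositive.\<close>

lemma degenerate_content_product:
  fixes x y :: real
  assumes "n \<ge> 1" "x = real n * (1/2) \<and> y > (real n - 1) * (1/2) \<or> x = - real n \<and> y < - real n + 1"
  shows "content_product (mixed_factor (of_real x) (of_real y)) m \<in> \<real>\<^sub>\<ge>\<^sub>0"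
  using assms(2)
proof
  assume xy: "x = real n * (1/2) \<and> y > (real n - 1) * (1/2)"
  show ?thesis
  proof (cases "(0, n) \<in> boxes m")
    case True
    have "2 * x = real n" using xy by simp
    then have "complex_of_real (2 * x) = of_real (real n)" by (simp only:)
    then have zero: "2 * complex_of_real x - of_real (real n - 2 * real 0) = 0" by simp
    have "content_product (mixed_factor (of_real x) (of_real y)) m = 0"
      by (rule content_product_zero[OF True]) (simp only: zero mult_zero_left)
    then show ?thesis by simp
  next
    case False
    show ?thesis
    proof (rule content_product_nonneg)
      fix k i assume "(k, i) \<in> boxes m"
      then have "i < row_len m 0" using row_len_antimono[of 0 k m] by (simp add: boxes_def)
      then have "i < n" using False by (auto simp: boxes_def)
      then have "real i + 1 \<le> real n" by linarith
      then have "2 * x - (real i - 2 * real k) \<ge> 0" "2 * y - (real i - 2 * real k) \<ge> 0"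
        using xy by auto
      then have "complex_of_real ((2 * x - (real i - 2 * real k)) * (2 * y - (real i - 2 * real k))) \<in> \<real>\<^sub>\<ge>\<^sub>0"
        by (simp only: nonneg_Reals_of_real_iff mult_nonneg_nonneg)
      then show "mixed_factor (of_real x) (of_real y) (real i - 2 * real k) \<in> \<real>\<^sub>\<ge>\<^sub>0" by simp
    qed
  qed
next
  assume xy: "x = - real n \<and> y < - real n + 1"
  show ?thesis
  proof (cases "(n, 0) \<in> boxes m")
    case True
    have "content_product (mixed_factor (of_real x) (of_real y)) m = 0"
      by (rule content_product_zero[OF True]) (use xy in simp)
    then show ?thesis by simp
  next
    case False
    show ?thesis
    proof (rule content_product_nonneg)
      fix k i assume "(k, i) \<in> boxes m"
      then have "k < n" using False row_len_antimono[of n k m] by (cases "k < n") (auto simp: boxes_def)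
      then have "real k + 1 \<le> real n" by linarith
      then have "2 * x - (real i - 2 * real k) \<le> 0" "2 * y - (real i - 2 * real k) \<le> 0"
        using xy by auto
      then have "complex_of_real ((2 * x - (real i - 2 * real k)) * (2 * y - (real i - 2 * real k))) \<in> \<real>\<^sub>\<ge>\<^sub>0"
        by (simp only: nonneg_Reals_of_real_iff mult_nonpos_nonpos)
      then show "mixed_factor (of_real x) (of_real y) (real i - 2 * real k) \<in> \<real>\<^sub>\<ge>\<^sub>0" by simp
    qed
  qed
qed

text \<open>Half the content \<open>?c\<close> is a lattice point and hence does not lie between
  \<open>z\<close> and \<open>z'\<close>, so the two linear factors cannot have opposite strict
  signs.\<close>

lemma complementary_content_product:
  assumes "complementary_series z z' (1/2)"
  shows "content_product (mixed_factor z z') m \<in> \<real>\<^sub>\<ge>\<^sub>0"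
proof (rule content_product_nonneg)
  fix k i
  obtain a b where ab: "{a<..<b} \<inter> lattice (1/2) = {}" "Re z \<in> {a<..<b}" "Re z' \<in> {a<..<b}"
    and R: "z \<in> \<real>" "z' \<in> \<real>"
    using assms unfolding complementary_series_def by blast
  let ?c = "real i - 2 * real k"
  have "?c / 2 = of_int (- int k) + of_int (int i) * (1/2)" by simp
  then have "?c / 2 \<in> lattice (1/2)" unfolding lattice_def by blast
  then have "?c / 2 \<notin> {a<..<b}" using ab(1) by blast
  then have "?c / 2 \<le> a \<or> b \<le> ?c / 2" by auto
  then have "(2 * Re z - ?c) * (2 * Re z' - ?c) \<ge> 0"
  proof
    assume "?c / 2 \<le> a"
    then show ?thesis using ab by (intro mult_nonneg_nonneg) auto
  next
    assume "b \<le> ?c / 2"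
    then show ?thesis using ab by (intro mult_nonpos_nonpos) auto
  qed
  then have "complex_of_real ((2 * Re z - ?c) * (2 * Re z' - ?c)) \<in> \<real>\<^sub>\<ge>\<^sub>0"
    by (simp only: nonneg_Reals_of_real_iff)
  moreover have "complex_of_real (Re z) = z" "complex_of_real (Re z') = z'" using R by simp_all
  ultimately show "mixed_factor z z' ?c \<in> \<real>\<^sub>\<ge>\<^sub>0" by simp
qed

lemma admissible_content_product:
  assumes "admissible z z' (1/2)"
  shows "content_product (mixed_factor z z') m \<in> \<real>\<^sub>\<ge>\<^sub>0"
  using assms unfolding admissible_def
proof (elim disjE)
  assume "principal_series z z' (1/2)"
  then have z': "z' = cnj z" by (simp add: principal_series_def)
  show ?thesis
  proof (rule content_product_nonneg)
    fix k i
    let ?w = "2 * z - of_real (real i - 2 * real k)"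
    have "mixed_factor z z' (real i - 2 * real k) = ?w * cnj ?w" by (simp add: z')
    also have "\<dots> = of_real ((norm ?w)\<^sup>2)" by (rule complex_norm_square[symmetric])
    finally show "mixed_factor z z' (real i - 2 * real k) \<in> \<real>\<^sub>\<ge>\<^sub>0"
      by (simp only: nonneg_Reals_of_real_iff zero_le_power2)
  qed
next
  assume "complementary_series z z' (1/2)"
  then show ?thesis by (rule complementary_content_product)
next
  assume deg: "degenerate_series z z' (1/2)"
  then have R: "complex_of_real (Re z) = z" "complex_of_real (Re z') = z'"
    by (simp_all add: degenerate_series_def)
  from deg obtain n where n: "n \<ge> 1"
    "(Re z = real n * (1/2) \<and> Re z' > (real n - 1) * (1/2) \<or> Re z = - real n \<and> Re z' < - real n + 1) \<or>
     (Re z' = real n * (1/2) \<and> Re z > (real n - 1) * (1/2) \<or> Re z' = - real n \<and> Re z < - real n + 1)"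
    unfolding degenerate_series_def by blast
  from n(2) show ?thesis
  proof
    assume "Re z = real n * (1/2) \<and> Re z' > (real n - 1) * (1/2) \<or> Re z = - real n \<and> Re z' < - real n + 1"
    from degenerate_content_product[OF n(1) this] show ?thesis unfolding R .
  next
    assume "Re z' = real n * (1/2) \<and> Re z > (real n - 1) * (1/2) \<or> Re z' = - real n \<and> Re z < - real n + 1"
    from degenerate_content_product[OF n(1) this] show ?thesis unfolding R by (simp only: mult.commute)
  qed
qed

lemma admissible_product_real:
  assumes "admissible z z' (1/2)"
  shows "2 * z * z' \<in> \<real>"
  using assms unfolding admissible_def
proof (elim disjE)
  assume "principal_series z z' (1/2)"
  then have "2 * z * z' = of_real (2 * (norm z)\<^sup>2)"
    by (simp add: principal_series_def complex_norm_square del: of_real_power)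
  then show ?thesis by (simp only: Reals_of_real)
qed (auto simp: complementary_series_def degenerate_series_def)

text \<open>Newton's binomial series at \<open>- \<xi>\<close> with exponent \<open>- t\<close>; the
  two alternating signs cancel.\<close>

lemma negative_binomial_sums:
  fixes t :: real
  assumes "0 < \<xi>" "\<xi> < 1"
  shows "(\<lambda>n. \<xi> ^ n * (pochhammer t n / fact n)) sums ((1 - \<xi>) powr (- t))"
proof -
  have "(\<lambda>n. (- t gchoose n) * (- \<xi>) ^ n) sums (1 + - \<xi>) powr (- t)"
    by (rule gen_binomial_real) (use assms in simp)
  moreover have "(- t gchoose n) * (- \<xi>) ^ n = \<xi> ^ n * (pochhammer t n / fact n)" for n
  proof -
    have "(- t gchoose n) * (- \<xi>) ^ n = (-1) ^ n * (-1) ^ n * (\<xi> ^ n * (pochhammer t n / fact n))"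
      unfolding gbinomial_pochhammer power_minus[of \<xi>] by simp
    also have "(-1) ^ n * (-1) ^ n = (1::real)" by (simp add: power_mult_distrib[symmetric])
    finally show ?thesis by simp
  qed
  ultimately show ?thesis by simp
qed

lemma mixed_z_ensemble:
  assumes adm: "admissible z z' (1/2)" and \<xi>: "0 < \<xi>" "\<xi> < 1"
  shows "\<exists>M. is_mixed_z_measure z z' \<xi> (1/2) M \<and>
      is_Pfaffian_L_ensemble half_ints (L_mat (h_mixed z z' \<xi>)) (map_pmf X_embed M)"
    and "Pf_J_plus half_ints (L_mat (h_mixed z z' \<xi>)) = (1 - of_real \<xi>) powr (- 2 * z * z')"
proof -
  define t where "t = Re (2 * z * z')"
  have t: "2 * z * z' = of_real t" unfolding t_def by (rule of_real_Re[OF admissible_product_real[OF adm], symmetric])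
  let ?c = "content_product (mixed_factor z z')" and ?h = "\<lambda>m. hook_product (double_rows m)"
  define V where "V = (\<lambda>m. Re (?c m) / ?h m)"
  have cV: "?c m / of_real (?h m) = of_real (V m)" and V: "V m \<ge> 0" for m
  proof -
    obtain r where r: "?c m = of_real r" "r \<ge> 0"
      using admissible_content_product[OF adm, of m] by (rule nonneg_Reals_cases)
    then show "?c m / of_real (?h m) = of_real (V m)" "V m \<ge> 0"
      using hook_product_pos[of "double_rows m"] by (simp_all add: V_def)
  qed
  have lev: "(\<Sum>m\<in>level n. V m) = pochhammer t n / fact n" for n
  proof -
    have "complex_of_real (\<Sum>m\<in>level n. V m) = level_sum (mixed_factor z z') n"
      unfolding level_sum_def cV by simp
    also have "\<dots> = of_real (pochhammer t n / fact n)"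
      unfolding level_sum_mixed t pochhammer_of_real by simp
    finally show ?thesis by (simp only: of_real_eq_iff)
  qed
  let ?s = "(1 - \<xi>) powr (- t)"
  have "(\<lambda>n. \<xi> ^ n * (\<Sum>m\<in>level n. V m)) sums ?s"
    unfolding lev by (rule negative_binomial_sums[OF \<xi>])
  from has_sum_levels[OF V _ this]
  have hs: "((\<lambda>\<mu>. \<xi> ^ num_boxes \<mu> * V (transpose_young \<mu>)) has_sum ?s) UNIV" using \<xi> by simp
  have g: "\<xi> ^ num_boxes \<mu> * V (transpose_young \<mu>) \<ge> 0" for \<mu> using V \<xi> by simp
  have s: "?s > 0" using \<xi> by simp
  have Pf: "Pf_minor (L_mat (h_mixed z z' \<xi>)) (X_embed \<mu>) = of_real (\<xi> ^ num_boxes \<mu> * V (transpose_young \<mu>))" for \<mu>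
    unfolding Pf_minor_mixed[OF \<xi>(1)] cV by simp
  have base: "1 - complex_of_real \<xi> = of_real (1 - \<xi>)" by simp
  have "- 2 * z * z' = of_real (- t)" using t by simp
  \<comment> \<open>The exponent is real and the base positive, so the complex power agrees with the
    real one in the binomial series.\<close>
  then have "(1 - complex_of_real \<xi>) powr (- 2 * z * z') = of_real ?s"
    unfolding base by (simp only:) (rule powr_of_real, use \<xi> in simp)
  then show "Pf_J_plus half_ints (L_mat (h_mixed z z' \<xi>)) = (1 - of_real \<xi>) powr (- 2 * z * z')"
    using Pfaffian_ensemble_of_weights(1)[OF g hs s Pf] by simp
  obtain M where M: "\<And>\<mu>. pmf M \<mu> = \<xi> ^ num_boxes \<mu> * V (transpose_young \<mu>) / ?s"
    "is_Pfaffian_L_ensemble half_ints (L_mat (h_mixed z z' \<xi>)) (map_pmf X_embed M)"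
    using Pfaffian_ensemble_of_weights(2)[OF g hs s Pf] by blast
  have "is_mixed_z_measure z z' \<xi> (1/2) M"
    unfolding is_mixed_z_measure_def
  proof
    fix \<mu>
    let ?n = "num_boxes \<mu>" and ?H = "H_hook \<mu> (1/2) * H'_hook \<mu> (1/2)" and ?m = "transpose_young \<mu>"
    have H: "complex_of_real (?h ?m) = of_real ?H * 4 ^ ?n"
      using arg_cong[OF H_hook_H'_hook_half[of \<mu>], of complex_of_real] by simp
    have cc: "?c ?m = (poch_young z (1/2) \<mu> * 2 ^ ?n) * (poch_young z' (1/2) \<mu> * 2 ^ ?n)"
      unfolding content_product_mult poch_young_half ..
    have "(a * 2 ^ k) * (b * 2 ^ k) / (h * 4 ^ k) = a * b / h" for a b h :: complex and k
    proof -
      have "(4::complex) ^ k = 2 ^ k * 2 ^ k" unfolding power_mult_distrib[symmetric] by simp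
      then show ?thesis by simp
    qed
    then have w: "poch_young z (1/2) \<mu> * poch_young z' (1/2) \<mu> / of_real ?H = of_real (V ?m)"
      unfolding cV[symmetric] cc H by simp
    have "z * z' / of_real (1/2) = 2 * z * z'" by (simp add: algebra_simps)
    then have "z * z' / of_real (1/2) = of_real t" unfolding t .
    then have p: "(1 - complex_of_real \<xi>) powr (z * z' / of_real (1/2)) = of_real ((1 - \<xi>) powr t)"
      unfolding base by (simp only:) (rule powr_of_real, use \<xi> in simp)
    have "pmf M \<mu> = (1 - \<xi>) powr t * \<xi> ^ ?n * V ?m"
      unfolding M(1) powr_minus by (simp only: divide_inverse inverse_inverse_eq mult_ac)
    then show "complex_of_real (pmf M \<mu>) = (1 - of_real \<xi>) powr (z * z' / of_real (1/2)) * of_real \<xi> ^ ?n *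
        (poch_young z (1/2) \<mu> * poch_young z' (1/2) \<mu> / of_real ?H)"
      unfolding w p by (simp only: of_real_mult of_real_power)
  qed
  then show "\<exists>M. is_mixed_z_measure z z' \<xi> (1/2) M \<and>
      is_Pfaffian_L_ensemble half_ints (L_mat (h_mixed z z' \<xi>)) (map_pmf X_embed M)"
    using M(2) by blast
qed

theorem theorem4p2:
  fixes z z' :: complex and \<xi> \<eta> :: real
  assumes "admissible z z' (1/2)"
    and "0 < \<xi>" and "\<xi> < 1" and "0 < \<eta>"
  shows "((\<exists>M. is_mixed_z_measure z z' \<xi> (1/2) M \<and>
               is_Pfaffian_L_ensemble half_ints (L_mat (h_mixed z z' \<xi>)) (map_pmf X_embed M)) \<and>
          Pf_J_plus half_ints (L_mat (h_mixed z z' \<xi>)) = (1 - of_real \<xi>) powr (- 2 * z * z')) \<and>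
         (\<exists>M. is_poissonized_Plancherel \<eta> (1/2) M \<and>
              is_Pfaffian_L_ensemble half_ints (L_mat (h_Plancherel \<eta>)) (map_pmf X_embed M))"
  using mixed_z_ensemble[OF assms(1-3)] poissonized_Plancherel_ensemble[OF assms(4)] by blast

end
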